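(* Let $P:L^1_{\mathrm{loc}}(\mathbb{R})\rightarrow AC_{\mathrm{loc}}(\mathbb{R})$ denote the primitive operator $Pf(x)=\int_0^xf$. Fix $a_1,a_2,a_3,a_4\in L^1_{\mathrm{loc}}(\mathbb{R})$ (complex valued). (I) Set $$C=T_{a_2e^{-Pa_1},\,e^{Pa_1};\,2}\quad\text{ and }\quad S=T_{e^{Pa_1},\,a_2e^{-Pa_1};\,1}.$$ The global solution to the second order equation $y^{\prime\prime}=a_1y^\prime+a_2y$ is given by the formula $$y=y(0)C+y^\prime(0)S.$$ (II) Set $$\varphi_3=C=T_{a_2e^{-Pa_1},\,e^{Pa_1};\,2},\qquad\varphi_2=e^{Pa_1}C^{-2},\qquad\varphi_1=a_3e^{-Pa_1}C.$$ In a neighbourhood of $x=0$, the general solution to the third order equation $y^{(3)}=a_1y^{\prime\prime}+a_2y^\prime+a_3y$ is given by the formula $$y=y(0)T_{\varphi_1,\varphi_2,\varphi_3;3}+y^\prime(0)T_{\varphi_3,\varphi_1,\varphi_2;1}+y^{\prime\prime}(0)T_{\varphi_2,\varphi_3,\varphi_1;2}.$$ (III) With $\varphi_1,\varphi_2,\varphi_3$ as defined in (II), set $$\psi_4=T_{\varphi_1,\varphi_2,\varphi_3;3},\qquad \psi_3=T_{e^{-Pa_1}\psi_4^2(a_2\psi_4+2a_1\psi_4^\prime-3\psi_4^{\prime\prime}),\;e^{Pa_1}\psi_4^{-3};\;2},$$ $$\psi_2=e^{Pa_1}\psi_3^{-2}\psi_4^{-3},\qquad \psi_1=a_4e^{-Pa_1}\psi_3\psi_4^2.$$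 In a neighbourhood of $x=0$, the general solution to the fourth order equation $y^{(4)}=a_1y^{(3)}+a_2y^{\prime\prime}+a_3y^\prime+a_4y$ is given by the formula $$y=y(0)T_{\psi_1,\psi_2,\psi_3,\psi_4;4}+y^\prime(0)T_{\psi_4,\psi_1,\psi_2,\psi_3;1}+y^{\prime\prime}(0)T_{\psi_3,\psi_4,\psi_1,\psi_2;2}+y^{(3)}(0)T_{\psi_2,\psi_3,\psi_4,\psi_1;3}.$$
   Context: Conventions. $L^1_{\mathrm{loc}}(\mathbb{R})$ denotes the complex valued locally integrable functions on $\mathbb{R}$, and $AC_{\mathrm{loc}}(\mathbb{R})$ the locally absolutely continuous ones. A solution $y$ of an order-$n$ linear equation with locally integrable coefficients is a function with $y^{(n-1)}$ locally absolutely continuous, the equation holding almost everywhere. Trig operators. For fixed $n\geq 1$, let $\nu:\mathbb{Z}_{\geq 0}\rightarrow\{1,\ldots,n\}$ map each $j\geq 0$ to the unique element of $\{1,\ldots,n\}$ congruent to $j$ modulo $n$ (so $\nu(0)=n$). For locally integrable $f_1,\ldots,f_n$ and $j\geq 1$ set $$\mathcal{S}^j_{f_1,\ldots,f_n}(x)=\int_{0<s_1<\cdots<s_j<x}f_{\nu(1)}(s_1)f_{\nu(2)}(s_2)\cdots f_{\nu(j)}(s_j)\,ds_1\cdots ds_j\quad\text{if }x\geq 0,$$ $$\mathcal{S}^j_{f_1,\ldots,f_n}(x)=(-1)^j\int_{x<s_j<\cdots<s_1<0}f_{\nu(1)}(s_1)f_{\nu(2)}(s_2)\cdots f_{\nu(j)}(s_j)\,ds_1\cdots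 ds_j\quad\text{if }x\leq 0,$$ and $\mathcal{S}^0_{f_1,\ldots,f_n}(x)=1$. For $1\leq j\leq n$ define $$T_{f_1,\ldots,f_n;j}=\sum_{k\geq 0,\ \nu(k)=j}\mathcal{S}^k_{f_1,\ldots,f_n}$$ (the series converges absolutely, uniformly on compact sets). The arity $n$ is the number of functions in the subscript before the semicolon. If the $f_i$ are defined and integrable only on an open interval containing $0$, the same formulas define $T_{f_1,\ldots,f_n;j}(x)$ for $x$ in that interval, since only values of the $f_i$ between $0$ and $x$ are used; in (II) and (III) the functions involving negative powers are considered in a neighbourhood of $x=0$ on which $C$, $\psi_4$ and $\psi_3$ (each equal to $1$ at $x=0$) do not vanish. *)

theory Defs
  imports "HOL-Analysis.Analysis"
begin

subsection \<open>Locally integrable and locally absolutely continuous functions\<close>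

definition loc_integrable :: "(real \<Rightarrow> complex) \<Rightarrow> bool" where
  "loc_integrable f \<longleftrightarrow> (\<forall>a b. f absolutely_integrable_on {a..b})"

text \<open>
  The integral is taken over \<open>lebesgue\<close> and not over \<open>lborel\<close>: a locally integrable function
  need only be Lebesgue measurable, and \<open>lborel\<close> integrals of non-Borel functions are 0.
  For \<open>x < 0\<close> the value is minus the integral over \<open>(x, 0)\<close>.
\<close>

definition primitive :: "(real \<Rightarrow> complex) \<Rightarrow> real \<Rightarrow> complex" where
  "primitive f x = interval_lebesgue_integral lebesgue (ereal 0) (ereal x) f"

text \<open>
  A division is a finite family of nonempty compact intervals with disjoint interiors;
  \<open>Inf k\<close> and \<open>Sup k\<close> are the end points of its member \<open>k\<close>.
\<close>

definition abs_cont_on :: "real set \<Rightarrow> (real \<Rightarrow> complex) \<Rightarrow> bool" where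
  "abs_cont_on S f \<longleftrightarrow>
    (\<forall>\<epsilon>>0. \<exists>\<delta>>0. \<forall>\<D> T. \<D> division_of T \<and> T \<subseteq> S \<and> (\<Sum>k\<in>\<D>. Sup k - Inf k) < \<delta> \<longrightarrow>
      (\<Sum>k\<in>\<D>. norm (f (Sup k) - f (Inf k))) < \<epsilon>)"

definition loc_abs_cont_on :: "real set \<Rightarrow> (real \<Rightarrow> complex) \<Rightarrow> bool" where
  "loc_abs_cont_on I f \<longleftrightarrow> (\<forall>a b. {a..b} \<subseteq> I \<longrightarrow> abs_cont_on {a..b} f)"


subsection \<open>Linear differential equations with locally integrable coefficients\<close>

text \<open>\<open>D k y\<close> is the \<open>k\<close>-th derivative of \<open>y\<close>.\<close>

definition D :: "nat \<Rightarrow> (real \<Rightarrow> complex) \<Rightarrow> real \<Rightarrow> complex" where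
  "D k = (\<lambda>f x. vector_derivative f (at x)) ^^ k"

text \<open>
  Solutions on an open set \<open>I\<close> of
  \<open>y\<^sup>(\<^sup>n\<^sup>) = a\<^sub>1 y\<^sup>(\<^sup>n\<^sup>-\<^sup>1\<^sup>) + \<dots> + a\<^sub>n y\<close>, where \<open>as = [a\<^sub>1, \<dots>, a\<^sub>n]\<close>. Since \<open>vector_derivative\<close> is total,
  the existence of the derivatives of order up to \<open>n - 1\<close> is required explicitly; that of order
  \<open>n\<close> is required almost everywhere.
\<close>

definition ode_solution_on ::
    "real set \<Rightarrow> (real \<Rightarrow> complex) list \<Rightarrow> (real \<Rightarrow> complex) \<Rightarrow> bool" where
  "ode_solution_on I as y \<longleftrightarrow> (let n = length as in
     (\<forall>k<n - 1. \<forall>x\<in>I. D k y differentiable (at x)) \<and>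
     loc_abs_cont_on I (D (n - 1) y) \<and>
     (AE x in lebesgue. x \<in> I \<longrightarrow>
       (D (n - 1) y has_vector_derivative (\<Sum>i<n. (as ! i) x * D (n - 1 - i) y x)) (at x)))"

text \<open>
  The general solution on \<open>I\<close> is \<open>F c\<close>, the parameters being the initial values
  \<open>c k = y\<^sup>(\<^sup>k\<^sup>)(0)\<close>, \<open>k < n\<close>: every solution is of this form on \<open>I\<close>, and for arbitrary
  parameters \<open>F c\<close> is a solution with these initial values.
\<close>

definition general_solution_on ::
    "real set \<Rightarrow> (real \<Rightarrow> complex) list \<Rightarrow> ((nat \<Rightarrow> complex) \<Rightarrow> real \<Rightarrow> complex) \<Rightarrow> bool" where
  "general_solution_on I as F \<longleftrightarrow>
     (\<forall>y. ode_solution_on I as y \<longrightarrow> (\<forall>x\<in>I. y x = F (\<lambda>k. D k y 0) x)) \<and>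
     (\<forall>c. ode_solution_on I as (F c) \<and> (\<forall>k<length as. D k (F c) 0 = c k))"


subsection \<open>Trig operators\<close>

definition \<nu> :: "nat \<Rightarrow> nat \<Rightarrow> nat" where
  "\<nu> n j = (if j mod n = 0 then n else j mod n)"

text \<open>
  The list \<open>fs = [f\<^sub>1, \<dots>, f\<^sub>n]\<close> carries the arity; lists are indexed from 0, hence
  \<open>f\<^sub>\<nu>\<^sub>(\<^sub>i\<^sub>)\<close> is \<open>fs ! (\<nu> n i - 1)\<close>. The integrals are over \<open>j\<close>-dimensional
  simplices in the product of \<open>j\<close> copies of Lebesgue measure, with coordinates \<open>s 1, \<dots>, s j\<close>.
\<close>

definition trigS :: "(real \<Rightarrow> complex) list \<Rightarrow> nat \<Rightarrow> real \<Rightarrow> complex" where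
  "trigS fs j x =
    (if j = 0 then 1
     else if x \<ge> 0 then
       (LINT s:{s. (\<forall>i\<in>{1..j}. 0 < s i \<and> s i < x) \<and> (\<forall>i\<in>{1..<j}. s i < s (Suc i))}
           | PiM {1..j} (\<lambda>_. lebesgue). (\<Prod>i=1..j. (fs ! (\<nu> (length fs) i - 1)) (s i)))
     else
       (- 1) ^ j *
       (LINT s:{s. (\<forall>i\<in>{1..j}. x < s i \<and> s i < 0) \<and> (\<forall>i\<in>{1..<j}. s (Suc i) < s i)}
           | PiM {1..j} (\<lambda>_. lebesgue). (\<Prod>i=1..j. (fs ! (\<nu> (length fs) i - 1)) (s i))))"

definition trigT :: "(real \<Rightarrow> complex) list \<Rightarrow> nat \<Rightarrow> real \<Rightarrow> complex" where
  "trigT fs j x = (\<Sum>\<^sub>\<infinity>k\<in>{k. \<nu> (length fs) k = j}. trigS fs k x)"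

end

theory Submission
  imports Defs
begin

text \<open>
  The trig functions solve a cyclic first order system: since the integral \<open>S\<^sup>j\<close> is the primitive of
  \<open>f\<^sub>\<nu>\<^sub>(\<^sub>j\<^sub>) S\<^sup>j\<^sup>-\<^sup>1\<close> by Fubini's theorem (\<open>trigS_Suc\<close>), summation over a residue class gives
  \<open>T\<^sub>j' = f\<^sub>j T\<^sub>j\<^sub>-\<^sub>1\<close> with cyclic indices, and \<open>T\<^sub>n(0) = 1\<close>, \<open>T\<^sub>j(0) = 0\<close> otherwise
  (\<open>trigT_eq_primitive\<close>). Hence the trig functions of the rotations of \<open>f\<^sub>1, \<dots>, f\<^sub>n\<close> form the
  fundamental system, normalised at \<open>0\<close>, of the system
  \<open>y' = f\<^sub>n z\<close>, \<open>z' = f\<^sub>n\<^sub>-\<^sub>1 w\<close>, and so on, whose last unknown has the derivative \<open>f\<^sub>1 y\<close>.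

  With \<open>P = \<integral> a\<^sub>1\<close>, the substitutions \<open>y' = e\<^sup>P z\<close>, \<open>y' = C z\<close> and \<open>y' = \<psi>\<^sub>4 z\<close>, where the factor is
  a solution with initial values \<open>1, 0, \<dots>\<close> of the equation of the next lower order, turn
  the equations of order two, three and four into such systems. The coefficients \<open>\<phi>\<^sub>2\<close>, \<open>\<psi>\<^sub>3\<close>,
  \<open>\<psi>\<^sub>2\<close> are what makes the remaining terms of the equation cancel; this is the algebra in
  \<open>second_order_from_system\<close>, \<open>third_order_from_system\<close> and \<open>fourth_order_from_system\<close>.

  As the coefficients are merely locally integrable, three facts of Lebesgue's theory are needed:
  a primitive is absolutely continuous (\<open>abs_cont_on_primitive\<close>), it is differentiable almost
  everywhere with the expected derivative (\<open>lebesgue_differentiation_interval\<close>), and an absolutely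
  continuous function is recovered from its derivative (\<open>abs_cont_on_has_integral\<close>). Convergence of
  the series and uniqueness of solutions both come from one contraction estimate in a weighted
  supremum norm (\<open>norm_primitive_le_weight\<close>).
\<close>

section \<open>Absolutely continuous functions\<close>

lemma abs_cont_onE:
  assumes "abs_cont_on S f" "0 < e"
  obtains d where "0 < d" "\<And>\<D> T. \<D> division_of T \<Longrightarrow> T \<subseteq> S \<Longrightarrow>
    (\<Sum>k\<in>\<D>. Sup k - Inf k) < d \<Longrightarrow> (\<Sum>k\<in>\<D>. norm (f (Sup k) - f (Inf k))) < e"
proof -
  let ?P = "\<lambda>d \<D> T. \<D> division_of T \<and> T \<subseteq> S \<and> (\<Sum>k\<in>\<D>. Sup k - Inf k) < d \<longrightarrow>
      (\<Sum>k\<in>\<D>. norm (f (Sup k) - f (Inf k))) < e"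
  have "\<exists>d>0. \<forall>\<D> T. ?P d \<D> T"
    using assms unfolding abs_cont_on_def by (elim allE impE)
  then obtain d where d: "d > 0 \<and> (\<forall>\<D> T. ?P d \<D> T)" ..
  have P: "?P d \<D> T" for \<D> T using d by (elim conjE allE)
  show ?thesis by (rule that[of d]) (use d P in blast)+
qed

lemma abs_cont_on_imp_continuous_on:
  assumes "abs_cont_on {a..b} f"
  shows "continuous_on {a..b} f"
proof -
  have *: "\<exists>d>0. \<forall>x\<in>{a..b}. \<forall>y\<in>{a..b}. x < y \<and> y - x < d \<longrightarrow> dist (f y) (f x) < e" if "e > 0" for e
  proof -
    obtain d where "d > 0" and d: "\<And>\<D> T. \<D> division_of T \<Longrightarrow> T \<subseteq> {a..b} \<Longrightarrow>
        (\<Sum>k\<in>\<D>. Sup k - Inf k) < d \<Longrightarrow> (\<Sum>k\<in>\<D>. norm (f (Sup k) - f (Inf k))) < e"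
      by (rule abs_cont_onE[OF assms \<open>e > 0\<close>]) (rule that)
    have "dist (f y) (f x) < e" if "x \<in> {a..b}" "y \<in> {a..b}" "x < y" "y - x < d" for x y
      using d[of "{{x..y}}" "{x..y}"] that division_of_self[of x y]
      by (auto simp: dist_norm)
    with \<open>d > 0\<close> show ?thesis by blast
  qed
  show ?thesis
    unfolding continuous_on_iff
  proof (intro ballI allI impI)
    fix x e :: real assume x: "x \<in> {a..b}" and "e > 0"
    obtain d where "d > 0" and d: "\<And>x y. x\<in>{a..b} \<Longrightarrow> y\<in>{a..b} \<Longrightarrow> x < y \<Longrightarrow> y - x < d \<Longrightarrow> dist (f y) (f x) < e"
      using *[OF \<open>e > 0\<close>] by blast
    have "dist (f y) (f x) < e" if "y \<in> {a..b}" "dist y x < d" for y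
      using d[of x y] d[of y x] x that \<open>e > 0\<close>
      by (cases x y rule: linorder_cases) (auto simp: dist_norm dist_commute norm_minus_commute)
    with \<open>d > 0\<close> show "\<exists>d>0. \<forall>y\<in>{a..b}. dist y x < d \<longrightarrow> dist (f y) (f x) < e" by blast
  qed
qed

lemma division_of_Inf_Sup:
  fixes T :: "real set"
  assumes "\<D> division_of T" "K \<in> \<D>"
  shows "Inf K \<in> K" "Sup K \<in> K" "Inf K \<le> Sup K" "K = {Inf K..Sup K}" "measure lborel K = Sup K - Inf K"
proof -
  obtain c d where K: "K = cbox c d" "K \<noteq> {}"
    using assms division_ofD(3,4) by metis
  then show "Inf K \<in> K" "Sup K \<in> K" "Inf K \<le> Sup K" "K = {Inf K..Sup K}" "measure lborel K = Sup K - Inf K"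
    by auto
qed

text \<open>
  Absolute continuity passes to every function whose increments are controlled by those of
  finitely many, here two, absolutely continuous functions. Sums, products, reciprocals and
  exponentials are instances.
\<close>

lemma abs_cont_on_dominated:
  assumes f: "abs_cont_on {a..b} f" and g: "abs_cont_on {a..b} g" and "0 \<le> L"
    and L: "\<And>x y. x \<in> {a..b} \<Longrightarrow> y \<in> {a..b} \<Longrightarrow>
      norm (h y - h x) \<le> L * (norm (f y - f x) + norm (g y - g x))"
  shows "abs_cont_on {a..b} h"
  unfolding abs_cont_on_def
proof (intro allI impI)
  fix e :: real assume "e > 0"
  define e' where "e' = e / 2 / (L + 1)"
  have "e' > 0" using \<open>e > 0\<close> \<open>0 \<le> L\<close> by (simp add: e'_def)
  have "(L + 1) * e' = e / 2" using \<open>0 \<le> L\<close>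
    unfolding e'_def by (subst times_divide_eq_right, subst nonzero_mult_div_cancel_left) auto
  then have e': "L * (e' + e') < e"
    using \<open>e' > 0\<close> by (simp add: algebra_simps)
  obtain d1 where "d1 > 0" and d1: "\<And>\<D> T. \<D> division_of T \<Longrightarrow> T \<subseteq> {a..b} \<Longrightarrow>
      (\<Sum>k\<in>\<D>. Sup k - Inf k) < d1 \<Longrightarrow> (\<Sum>k\<in>\<D>. norm (f (Sup k) - f (Inf k))) < e'"
    by (rule abs_cont_onE[OF f \<open>e' > 0\<close>]) (rule that)
  obtain d2 where "d2 > 0" and d2: "\<And>\<D> T. \<D> division_of T \<Longrightarrow> T \<subseteq> {a..b} \<Longrightarrow>
      (\<Sum>k\<in>\<D>. Sup k - Inf k) < d2 \<Longrightarrow> (\<Sum>k\<in>\<D>. norm (g (Sup k) - g (Inf k))) < e'"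
    by (rule abs_cont_onE[OF g \<open>e' > 0\<close>]) (rule that)
  have "(\<Sum>k\<in>\<D>. norm (h (Sup k) - h (Inf k))) < e"
    if "\<D> division_of T" "T \<subseteq> {a..b}" "(\<Sum>k\<in>\<D>. Sup k - Inf k) < min d1 d2" for \<D> T
  proof -
    have in_ab: "Inf k \<in> {a..b}" "Sup k \<in> {a..b}" if "k \<in> \<D>" for k
      using division_of_Inf_Sup[OF \<open>\<D> division_of T\<close> that] \<open>T \<subseteq> {a..b}\<close>
        division_ofD(2)[OF \<open>\<D> division_of T\<close> that] by blast+
    have "(\<Sum>k\<in>\<D>. norm (h (Sup k) - h (Inf k)))
        \<le> (\<Sum>k\<in>\<D>. L * (norm (f (Sup k) - f (Inf k)) + norm (g (Sup k) - g (Inf k))))"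
      by (intro sum_mono L in_ab)
    also have "\<dots> = L * ((\<Sum>k\<in>\<D>. norm (f (Sup k) - f (Inf k))) + (\<Sum>k\<in>\<D>. norm (g (Sup k) - g (Inf k))))"
      by (simp add: sum_distrib_left sum.distrib distrib_left)
    also have "\<dots> \<le> L * (e' + e')"
      using d1[OF that(1,2)] d2[OF that(1,2)] that(3) \<open>0 \<le> L\<close>
      by (intro mult_left_mono add_mono) auto
    finally show ?thesis using e' by simp
  qed
  then show "\<exists>\<delta>>0. \<forall>\<D> T. \<D> division_of T \<and> T \<subseteq> {a..b} \<and> (\<Sum>k\<in>\<D>. Sup k - Inf k) < \<delta> \<longrightarrow>
      (\<Sum>k\<in>\<D>. norm (h (Sup k) - h (Inf k))) < e"
    using \<open>d1 > 0\<close> \<open>d2 > 0\<close> by (intro exI[of _ "min d1 d2"]) auto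
qed

lemma abs_cont_on_const: "abs_cont_on S (\<lambda>x. c)"
  unfolding abs_cont_on_def by (auto intro: exI[of _ 1])

lemma abs_cont_on_cong:
  assumes "\<And>x. x \<in> S \<Longrightarrow> f x = g x" "abs_cont_on S f"
  shows "abs_cont_on S g"
proof -
  have "(\<Sum>k\<in>\<D>. norm (f (Sup k) - f (Inf k))) = (\<Sum>k\<in>\<D>. norm (g (Sup k) - g (Inf k)))"
    if "\<D> division_of T" "T \<subseteq> S" for \<D> T
  proof (rule sum.cong)
    fix k assume "k \<in> \<D>"
    then have "Inf k \<in> S" "Sup k \<in> S"
      using division_of_Inf_Sup[OF that(1)] that(2) division_ofD(2)[OF that(1)] by blast+
    then show "norm (f (Sup k) - f (Inf k)) = norm (g (Sup k) - g (Inf k))"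
      using assms(1) by simp
  qed simp
  note eq = this
  show ?thesis
    unfolding abs_cont_on_def
  proof (intro allI impI)
    fix e :: real assume "e > 0"
    obtain d where "d > 0" and d: "\<And>\<D> T. \<D> division_of T \<Longrightarrow> T \<subseteq> S \<Longrightarrow>
        (\<Sum>k\<in>\<D>. Sup k - Inf k) < d \<Longrightarrow> (\<Sum>k\<in>\<D>. norm (f (Sup k) - f (Inf k))) < e"
      by (rule abs_cont_onE[OF assms(2) \<open>e > 0\<close>]) (rule that)
    then show "\<exists>d>0. \<forall>\<D> T. \<D> division_of T \<and> T \<subseteq> S \<and> (\<Sum>k\<in>\<D>. Sup k - Inf k) < d \<longrightarrow>
        (\<Sum>k\<in>\<D>. norm (g (Sup k) - g (Inf k))) < e"
      using eq by (intro exI[of _ d]) auto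
  qed
qed

lemma abs_cont_on_subset: "abs_cont_on T f \<Longrightarrow> S \<subseteq> T \<Longrightarrow> abs_cont_on S f"
  unfolding abs_cont_on_def by (meson order_trans)

lemma abs_cont_on_bounded:
  assumes "abs_cont_on {a..b} f"
  obtains B where "B \<ge> 0" "\<And>x. x \<in> {a..b} \<Longrightarrow> norm (f x) \<le> B"
proof -
  have "bounded (f ` {a..b})"
    using abs_cont_on_imp_continuous_on[OF assms] compact_continuous_image compact_imp_bounded by blast
  then obtain B where "\<forall>x\<in>{a..b}. norm (f x) \<le> B" unfolding bounded_iff by auto
  then show ?thesis using that[of "max B 0"] by force
qed

lemma abs_cont_on_add:
  assumes "abs_cont_on {a..b} f" "abs_cont_on {a..b} g"
  shows "abs_cont_on {a..b} (\<lambda>x. f x + g x)"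
proof (rule abs_cont_on_dominated[OF assms, of 1])
  fix x y
  have "f y + g y - (f x + g x) = (f y - f x) + (g y - g x)" by simp
  then show "norm (f y + g y - (f x + g x)) \<le> 1 * (norm (f y - f x) + norm (g y - g x))"
    by (metis mult_1 norm_triangle_ineq)
qed simp

lemma abs_cont_on_mult:
  assumes f: "abs_cont_on {a..b} f" and g: "abs_cont_on {a..b} g"
  shows "abs_cont_on {a..b} (\<lambda>x. f x * g x)"
proof -
  obtain A where A: "A \<ge> 0" "\<And>x. x \<in> {a..b} \<Longrightarrow> norm (f x) \<le> A" using abs_cont_on_bounded[OF f] by metis
  obtain B where B: "B \<ge> 0" "\<And>x. x \<in> {a..b} \<Longrightarrow> norm (g x) \<le> B" using abs_cont_on_bounded[OF g] by metis
  show ?thesis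
  proof (rule abs_cont_on_dominated[OF f g, of "A + B"])
    fix x y assume xy: "x \<in> {a..b}" "y \<in> {a..b}"
    have "f y * g y - f x * g x = f y * (g y - g x) + (f y - f x) * g x" by (simp add: algebra_simps)
    then have "norm (f y * g y - f x * g x) \<le> norm (f y) * norm (g y - g x) + norm (f y - f x) * norm (g x)"
      by (metis norm_mult norm_triangle_ineq)
    also have "\<dots> \<le> (A + B) * norm (g y - g x) + norm (f y - f x) * (A + B)"
      using A(2)[OF xy(2)] B(2)[OF xy(1)] \<open>A \<ge> 0\<close> \<open>B \<ge> 0\<close> by (intro add_mono mult_mono) auto
    finally show "norm (f y * g y - f x * g x) \<le> (A + B) * (norm (f y - f x) + norm (g y - g x))"
      by (simp add: algebra_simps)
  qed (use A B in auto)
qed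

lemma abs_cont_on_inverse:
  assumes f: "abs_cont_on {a..b} f" and nz: "\<And>x. x \<in> {a..b} \<Longrightarrow> f x \<noteq> 0"
  shows "abs_cont_on {a..b} (\<lambda>x. inverse (f x))"
proof -
  have "continuous_on {a..b} (\<lambda>x. inverse (f x))"
    using abs_cont_on_imp_continuous_on[OF f] nz by (intro continuous_intros) auto
  then have "bounded ((\<lambda>x. inverse (f x)) ` {a..b})"
    using compact_continuous_image compact_imp_bounded by blast
  then obtain B where B: "\<And>x. x \<in> {a..b} \<Longrightarrow> norm (inverse (f x)) \<le> B"
    unfolding bounded_iff by blast
  show ?thesis
  proof (rule abs_cont_on_dominated[OF f f, of "B\<^sup>2"])
    fix x y assume xy: "x \<in> {a..b}" "y \<in> {a..b}"
    have "inverse (f y) - inverse (f x) = inverse (f y) * (f x - f y) * inverse (f x)"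
      using nz xy by (simp add: field_simps)
    then have "norm (inverse (f y) - inverse (f x))
        = norm (inverse (f y)) * norm (inverse (f x)) * norm (f y - f x)"
      by (simp add: norm_mult norm_minus_commute)
    also have "\<dots> \<le> B * B * norm (f y - f x)"
      using B xy by (intro mult_mono mult_nonneg_nonneg) (auto intro: order_trans[OF norm_ge_zero])
    also have "\<dots> \<le> B\<^sup>2 * (norm (f y - f x) + norm (f y - f x))"
      by (simp add: power2_eq_square mult_left_mono distrib_left)
    finally show "norm (inverse (f y) - inverse (f x)) \<le> B\<^sup>2 * (norm (f y - f x) + norm (f y - f x))" .
  qed simp
qed

lemma abs_cont_on_exp:
  assumes f: "abs_cont_on {a..b} f"
  shows "abs_cont_on {a..b} (\<lambda>x. exp (f x))"
proof -
  obtain B where B: "B \<ge> 0" "\<And>x. x \<in> {a..b} \<Longrightarrow> norm (f x) \<le> B" using abs_cont_on_bounded[OF f] by metis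
  show ?thesis
  proof (rule abs_cont_on_dominated[OF f f, of "exp B"])
    fix x y assume xy: "x \<in> {a..b}" "y \<in> {a..b}"
    have "norm (exp (f y) - exp (f x)) \<le> exp B * norm (f y - f x)"
    proof (rule field_differentiable_bound[of "cball 0 B"])
      fix z :: complex assume "z \<in> cball 0 B"
      then show "norm (exp z) \<le> exp B"
        using complex_Re_le_cmod[of z] by (auto simp: norm_exp_eq_Re intro: order_trans)
    qed (use B xy in \<open>auto intro!: derivative_eq_intros\<close>)
    also have "\<dots> \<le> exp B * (norm (f y - f x) + norm (f y - f x))"
      by (intro mult_left_mono) auto
    finally show "norm (exp (f y) - exp (f x)) \<le> exp B * (norm (f y - f x) + norm (f y - f x))" .
  qed simp
qed

text \<open>
  The fundamental theorem of calculus for absolutely continuous functions. Riemann sums of \<open>f\<close>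
  over a fine tagged division are compared with the telescoping sum of \<open>F\<close>: tags outside \<open>N\<close>
  are controlled by differentiability, and the intervals tagged in \<open>N\<close> lie in an open set of
  small measure, so that absolute continuity makes their total increment small.
\<close>

lemma abs_cont_on_has_integral:
  assumes ac: "abs_cont_on {a..b} F" and "a \<le> b" and N: "negligible N"
    and der: "\<And>x. x \<in> {a..b} - N \<Longrightarrow> (F has_vector_derivative f x) (at x within {a..b})"
  shows "(f has_integral F b - F a) {a..b}"
proof -
  \<comment> \<open>The values of \<open>f\<close> on \<open>N\<close> are arbitrary and could spoil the Riemann sums.\<close>
  define g where "g x = (if x \<in> N then 0 else f x)" for x
  have "(g has_integral F b - F a) (cbox a b)"
    unfolding has_integral
  proof (intro allI impI)
    fix e :: real assume "e > 0"
    define e' where "e' = e / (2 * (b - a + 1))"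
    have "e' > 0" and e'1: "e' * (b - a) < e / 2"
      using \<open>e > 0\<close> \<open>a \<le> b\<close> by (auto simp: e'_def field_simps add_pos_nonneg)
    obtain d where "d > 0" and d: "\<And>\<D> T. \<D> division_of T \<Longrightarrow> T \<subseteq> {a..b} \<Longrightarrow>
        (\<Sum>k\<in>\<D>. Sup k - Inf k) < d \<Longrightarrow> (\<Sum>k\<in>\<D>. norm (F (Sup k) - F (Inf k))) < e / 2"
      by (rule abs_cont_onE[OF ac half_gt_zero[OF \<open>e > 0\<close>]]) (rule that)
    have N0: "N \<in> null_sets lebesgue" using N by (simp add: negligible_iff_null_sets)
    obtain U where U: "open U" "N \<subseteq> U" and mUN: "emeasure lebesgue (U - N) < ennreal d"
      by (rule sets_lebesgue_outer_open[OF null_setsD2[OF N0] \<open>d > 0\<close>])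
    have "emeasure lebesgue U = emeasure lebesgue (U - N)"
      using U N0 by (simp add: emeasure_Diff_null_set)
    then have emU: "emeasure lebesgue U < ennreal d" using mUN by simp
    then have Um: "U \<in> lmeasurable"
      using U less_trans[OF emU ennreal_less_top] by (intro fmeasurableI) auto
    have mU: "measure lebesgue U < d"
      using emU Um by (simp add: emeasure_eq_measure2 ennreal_less_iff)
    have "\<exists>r>0. \<forall>y\<in>{a..b}. \<bar>y - x\<bar> < r \<longrightarrow> norm (F y - F x - (y - x) *\<^sub>R f x) \<le> e' * \<bar>y - x\<bar>"
      if "x \<in> {a..b} - N" for x
      using der[OF that] \<open>e' > 0\<close> unfolding has_vector_derivative_def has_derivative_within_alt
      by auto
    then obtain r where r: "\<And>x. x \<in> {a..b} - N \<Longrightarrow> r x > 0"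
      "\<And>x y. x \<in> {a..b} - N \<Longrightarrow> y \<in> {a..b} \<Longrightarrow> \<bar>y - x\<bar> < r x \<Longrightarrow> norm (F y - F x - (y - x) *\<^sub>R f x) \<le> e' * \<bar>y - x\<bar>"
      by metis
    define \<gamma> where "\<gamma> x = (if x \<in> N then U else if x \<in> {a..b} then ball x (r x) else UNIV)" for x
    have "gauge \<gamma>"
      using U r by (auto simp: gauge_def \<gamma>_def)
    have close: "norm ((\<Sum>(x,k)\<in>\<D>. measure lborel k *\<^sub>R g x) - (F b - F a)) < e"
      if tag: "\<D> tagged_division_of cbox a b" and fine: "\<gamma> fine \<D>" for \<D>
    proof -
      have fin: "finite \<D>" using tag by blast
      define A where "A = {(x,k)\<in>\<D>. x \<in> N}"
      have AD: "A \<subseteq> \<D>" by (auto simp: A_def)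
      have k: "k = {Inf k..Sup k}" "Inf k \<le> Sup k" "x \<in> k" "k \<subseteq> {a..b}" "measure lborel k = Sup k - Inf k" "k \<subseteq> \<gamma> x"
        if xk: "(x,k) \<in> \<D>" for x k
      proof -
        obtain c d where "k = cbox c d" using tagged_division_ofD(4)[OF tag xk] by blast
        then have cd: "k = {c..d}" by simp
        show "x \<in> k" using tagged_division_ofD(2)[OF tag xk] .
        then have "c \<le> d" using cd by auto
        then have "Inf k = c" "Sup k = d" "measure lborel k = d - c" by (simp_all add: cd)
        then show "k = {Inf k..Sup k}" "Inf k \<le> Sup k" "measure lborel k = Sup k - Inf k"
          using \<open>c \<le> d\<close> cd by simp_all
        show "k \<subseteq> {a..b}" using tagged_division_ofD(3)[OF tag xk] by simp
        show "k \<subseteq> \<gamma> x" using fine xk by (auto simp: fine_def)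
      qed
      have telescope: "(\<Sum>(x,k)\<in>\<D>. F (Sup k) - F (Inf k)) = F b - F a"
        using additive_tagged_division_1[of a b \<D> F] tag \<open>a \<le> b\<close> by simp
      have A: "A tagged_partial_division_of cbox a b"
        by (rule tagged_partial_division_subset[OF conjunct1[OF tag[unfolded tagged_division_of_def]] AD])
      let ?T = "\<Union>(snd ` A)"
      have div: "snd ` A division_of ?T"
        using partial_division_of_tagged_division[OF A] .
      have over: "(\<Sum>(x,k)\<in>A. h k) = (\<Sum>k\<in>snd ` A. h k)"
        if "\<And>u. h {u} = 0" "h {} = 0" for h :: "real set \<Rightarrow> real"
      proof (rule sum.over_tagged_division_lemma[OF tagged_partial_division_of_Union_self[OF A]])
        fix u v :: real assume "box u v = {}"
        then show "h (cbox u v) = 0" using that by (cases "u = v") auto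
      qed
      have "(\<Sum>(x,k)\<in>A. norm (F (Sup k) - F (Inf k))) = (\<Sum>k\<in>snd ` A. norm (F (Sup k) - F (Inf k)))"
      proof -
        have ne: "k \<noteq> {}" if "(x,k) \<in> A" for x k using k(3) that AD by blast
        have "(\<Sum>(x,k)\<in>A. norm (F (Sup k) - F (Inf k)))
            = (\<Sum>(x,k)\<in>A. if k = {} then 0 else norm (F (Sup k) - F (Inf k)))"
          using ne by (intro sum.cong) auto
        also have "\<dots> = (\<Sum>k\<in>snd ` A. if k = {} then 0 else norm (F (Sup k) - F (Inf k)))"
          by (rule over) auto
        also have "\<dots> = (\<Sum>k\<in>snd ` A. norm (F (Sup k) - F (Inf k)))"
          using ne by (intro sum.cong) auto
        finally show ?thesis .
      qed
      also have "\<dots> < e / 2"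
      proof (rule d[OF div])
        show "?T \<subseteq> {a..b}"
        proof (rule Union_least)
          fix K assume "K \<in> snd ` A"
          then obtain x where "(x, K) \<in> A" by auto
          then show "K \<subseteq> {a..b}" using k(4) AD by blast
        qed
        have "Sup K - Inf K = measure lebesgue K" if "K \<in> snd ` A" for K
          using division_of_Inf_Sup(4,5)[OF div that]
          by (metis completion.complete2 lborelD measure_completion borel_closed closed_atLeastAtMost sets_lborel)
        then have "(\<Sum>k\<in>snd ` A. Sup k - Inf k) = (\<Sum>k\<in>snd ` A. measure lebesgue k)"
          by (rule sum.cong[OF refl])
        also have "\<dots> = measure lebesgue ?T"
          by (rule content_division[OF div])
        also have "\<dots> \<le> measure lebesgue U"
        proof (rule measure_mono_fmeasurable)
          show "?T \<subseteq> U"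
          proof (rule Union_least)
            fix K assume "K \<in> snd ` A"
            then obtain x where "(x, K) \<in> A" by auto
            then have "(x, K) \<in> \<D>" "x \<in> N" by (simp_all add: A_def)
            then show "K \<subseteq> U" using k(6)[of x K] by (simp add: \<gamma>_def)
          qed
          show "?T \<in> sets lebesgue"
            using lmeasurable_division[OF div] by (simp add: fmeasurableD)
        qed (rule Um)
        finally show "(\<Sum>k\<in>snd ` A. Sup k - Inf k) < d" using mU by simp
      qed
      finally have bad: "(\<Sum>(x,k)\<in>A. norm (F (Sup k) - F (Inf k))) < e / 2" .
      have good: "norm (measure lborel k *\<^sub>R g x - (F (Sup k) - F (Inf k))) \<le> e' * measure lborel k"
        if "(x,k) \<in> \<D> - A" for x k
      proof -
        have xk: "(x,k) \<in> \<D>" "x \<notin> N" using that by (auto simp: A_def)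
        note kk = k[OF xk(1)]
        have x: "x \<in> {a..b} - N" using kk xk by auto
        have sub: "k \<subseteq> ball x (r x)" using kk(6) x by (simp add: \<gamma>_def)
        have ends: "Inf k \<in> k" "Sup k \<in> k" "Inf k \<le> x" "x \<le> Sup k"
        proof -
          show "Inf k \<in> k" by (subst (2) kk(1)) (simp add: kk(2))
          show "Sup k \<in> k" by (subst (2) kk(1)) (simp add: kk(2))
          have "x \<in> {Inf k..Sup k}" using kk(3) kk(1) by simp
          then show "Inf k \<le> x" "x \<le> Sup k" by auto
        qed
        have 1: "norm (F (Inf k) - F x - (Inf k - x) *\<^sub>R f x) \<le> e' * (x - Inf k)"
          using r(2)[OF x, of "Inf k"] ends(3) subsetD[OF sub ends(1)] subsetD[OF kk(4) ends(1)]
          by (auto simp: dist_real_def abs_minus_commute)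
        have 2: "norm (F (Sup k) - F x - (Sup k - x) *\<^sub>R f x) \<le> e' * (Sup k - x)"
          using r(2)[OF x, of "Sup k"] ends(4) subsetD[OF sub ends(2)] subsetD[OF kk(4) ends(2)]
          by (auto simp: dist_real_def abs_minus_commute)
        have "measure lborel k *\<^sub>R g x - (F (Sup k) - F (Inf k))
            = (F (Inf k) - F x - (Inf k - x) *\<^sub>R f x) - (F (Sup k) - F x - (Sup k - x) *\<^sub>R f x)"
          using xk by (simp add: g_def kk(5) algebra_simps)
        also have "norm \<dots> \<le> e' * (x - Inf k) + e' * (Sup k - x)"
          by (rule order_trans[OF norm_triangle_ineq4 add_mono[OF 1 2]])
        also have "\<dots> = e' * measure lborel k" by (simp add: kk(5) algebra_simps)
        finally show ?thesis .
      qed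
      have "(\<Sum>(x,k)\<in>\<D>. measure lborel k *\<^sub>R g x) - (F b - F a)
          = (\<Sum>(x,k)\<in>\<D>. measure lborel k *\<^sub>R g x - (F (Sup k) - F (Inf k)))"
        unfolding telescope[symmetric] by (simp add: sum_subtractf split_def)
      also have "\<dots> = (\<Sum>(x,k)\<in>\<D> - A. measure lborel k *\<^sub>R g x - (F (Sup k) - F (Inf k)))
          + (\<Sum>(x,k)\<in>A. measure lborel k *\<^sub>R g x - (F (Sup k) - F (Inf k)))"
        by (rule sum.subset_diff[OF AD fin])
      also have "norm \<dots> \<le> (\<Sum>(x,k)\<in>\<D> - A. e' * measure lborel k) + (\<Sum>(x,k)\<in>A. norm (F (Sup k) - F (Inf k)))"
      proof (intro norm_triangle_mono order_trans[OF norm_sum] sum_mono)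
        fix z assume "z \<in> \<D> - A"
        then show "norm (case z of (x,k) \<Rightarrow> measure lborel k *\<^sub>R g x - (F (Sup k) - F (Inf k))) \<le> (case z of (x,k) \<Rightarrow> e' * measure lborel k)"
          using good by (cases z) auto
      next
        fix z assume "z \<in> A"
        then show "norm (case z of (x,k) \<Rightarrow> measure lborel k *\<^sub>R g x - (F (Sup k) - F (Inf k)))
            \<le> (case z of (x,k) \<Rightarrow> norm (F (Sup k) - F (Inf k)))"
          by (cases z) (auto simp: A_def g_def norm_minus_commute)
      qed
      also have "(\<Sum>(x,k)\<in>\<D> - A. e' * measure lborel k) \<le> (\<Sum>(x,k)\<in>\<D>. e' * measure lborel k)"
        using \<open>e' > 0\<close> fin by (intro sum_mono2) (auto simp: A_def)
      also have "\<dots> = e' * (\<Sum>(x,k)\<in>\<D>. measure lborel k)"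
        by (simp add: sum_distrib_left split_def)
      also have "\<dots> = e' * (b - a)"
        using additive_content_tagged_division[OF tag] \<open>a \<le> b\<close> by simp
      finally show ?thesis using bad e'1 by simp
    qed
    show "\<exists>\<gamma>. gauge \<gamma> \<and> (\<forall>\<D>. \<D> tagged_division_of cbox a b \<and> \<gamma> fine \<D> \<longrightarrow>
        norm ((\<Sum>(x,k)\<in>\<D>. measure lborel k *\<^sub>R g x) - (F b - F a)) < e)"
      using \<open>gauge \<gamma>\<close> close by (intro exI[of _ \<gamma>] conjI allI impI) simp_all
  qed
  then have "(g has_integral F b - F a) {a..b}" by simp
  then show ?thesis
    by (rule has_integral_spike[OF N, rotated]) (simp add: g_def)
qed


section \<open>Primitives of integrable functions\<close>

text \<open>Absolute continuity of the integral, by truncation of the integrand at a height \<open>n\<close>.\<close>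

lemma sum_integral_division_small:
  fixes f :: "real \<Rightarrow> complex"
  assumes f: "f absolutely_integrable_on {a..b}" and "e > 0"
  obtains d where "d > 0" "\<And>\<D> T. \<D> division_of T \<Longrightarrow> T \<subseteq> {a..b} \<Longrightarrow>
        (\<Sum>k\<in>\<D>. Sup k - Inf k) < d \<Longrightarrow> (\<Sum>k\<in>\<D>. integral k (\<lambda>x. norm (f x))) < e"
proof -
  define h where "h n x = norm (f x) - min (norm (f x)) (real n)" for n x
  have nf: "(\<lambda>x. norm (f x)) integrable_on {a..b}"
    using f by (simp add: absolutely_integrable_on_def)
  have hm: "(\<lambda>x. min (norm (f x)) (real n)) integrable_on {a..b}" for n
  proof -
    have "(\<lambda>x. min (norm (f x)) (real n)) absolutely_integrable_on {a..b}"
      using absolutely_integrable_norm[OF f]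
      by (intro absolutely_integrable_min_1) (auto simp: o_def intro!: absolutely_integrable_continuous_real)
    then show ?thesis by (simp add: absolutely_integrable_on_def)
  qed
  have hi: "h n integrable_on {a..b}" for n
    unfolding h_def by (intro integrable_diff nf hm)
  have "(\<lambda>n. integral {a..b} (h n)) \<longlonglongrightarrow> integral {a..b} (\<lambda>x. 0)"
  proof (rule dominated_convergence(2)[OF hi nf])
    show "norm (h n x) \<le> norm (f x)" for n x by (auto simp: h_def)
    fix x
    obtain m where "norm (f x) \<le> real m" using real_arch_simple by blast
    then have "h n x = 0" if "n \<ge> m" for n using that by (auto simp: h_def)
    then show "(\<lambda>n. h n x) \<longlonglongrightarrow> 0"
      by (intro tendsto_eventually eventually_sequentiallyI[of m])
  qed
  then have "\<forall>\<^sub>F n in sequentially. integral {a..b} (h n) < e / 2"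
    using \<open>e > 0\<close> by (intro order_tendstoD) auto
  then obtain n where n: "integral {a..b} (h n) < e / 2"
    by (auto simp: eventually_sequentially)
  define d where "d = e / (2 * (real n + 1))"
  have "d > 0" using \<open>e > 0\<close> by (simp add: d_def)
  moreover have "(\<Sum>k\<in>\<D>. integral k (\<lambda>x. norm (f x))) < e"
    if div: "\<D> division_of T" and T: "T \<subseteq> {a..b}" and small: "(\<Sum>k\<in>\<D>. Sup k - Inf k) < d" for \<D> T
  proof -
    have int: "g integrable_on k" if "k \<in> \<D>" "g integrable_on {a..b}" for g :: "real \<Rightarrow> real" and k
    proof -
      have "k \<subseteq> {a..b}" using division_ofD(2)[OF div that(1)] T by blast
      then show ?thesis
        using division_of_Inf_Sup(4)[OF div that(1)] that(2) integrable_on_subinterval by metis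
    qed
    have "h n integrable_on T"
    proof -
      have "h n absolutely_integrable_on {a..b}"
        by (intro nonnegative_absolutely_integrable_1 hi) (auto simp: h_def)
      moreover have "T \<in> sets lebesgue"
        using lmeasurable_division[OF div] by (simp add: fmeasurableD)
      ultimately show ?thesis
        using set_integrable_subset T absolutely_integrable_on_def by blast
    qed
    then have "(\<Sum>k\<in>\<D>. integral k (h n)) = integral T (h n)"
      by (rule integral_combine_division_topdown[OF _ div, symmetric])
    also have "\<dots> \<le> integral {a..b} (h n)"
      by (rule integral_subset_le[OF T \<open>h n integrable_on T\<close> hi]) (auto simp: h_def)
    finally have 1: "(\<Sum>k\<in>\<D>. integral k (h n)) < e / 2" using n by simp
    have "integral k (\<lambda>x. min (norm (f x)) (real n)) \<le> real n * (Sup k - Inf k)" if "k \<in> \<D>" for k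
    proof -
      define c d where "c = Inf k" and "d = Sup k"
      have k: "k = {c..d}" "c \<le> d"
        using division_of_Inf_Sup(3,4)[OF div that] by (simp_all only: c_def d_def)
      have "integral k (\<lambda>x. min (norm (f x)) (real n)) \<le> integral {c..d} (\<lambda>x. real n)"
        using int[OF that hm] unfolding k(1) by (intro integral_le integrable_const_ivl) auto
      also have "\<dots> = real n * (Sup k - Inf k)"
        using k(2) by (simp add: k(1))
      finally show ?thesis .
    qed
    then have "(\<Sum>k\<in>\<D>. integral k (\<lambda>x. min (norm (f x)) (real n))) \<le> real n * (\<Sum>k\<in>\<D>. Sup k - Inf k)"
      unfolding sum_distrib_left by (rule sum_mono)
    also have "\<dots> \<le> real n * d" using small by (intro mult_left_mono) auto
    also have "\<dots> \<le> e / 2" using \<open>e > 0\<close> by (simp add: d_def field_simps)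
    finally have 2: "(\<Sum>k\<in>\<D>. integral k (\<lambda>x. min (norm (f x)) (real n))) \<le> e / 2" .
    have "(\<Sum>k\<in>\<D>. integral k (\<lambda>x. norm (f x)))
        = (\<Sum>k\<in>\<D>. integral k (h n) + integral k (\<lambda>x. min (norm (f x)) (real n)))"
      by (intro sum.cong refl, subst integral_add[symmetric]) (auto intro!: int hm hi simp: h_def)
    with 1 2 show ?thesis by (simp add: sum.distrib)
  qed
  ultimately show ?thesis using that by blast
qed

lemma integral_diff_eq_integral:
  fixes f :: "real \<Rightarrow> complex"
  assumes "f integrable_on {a..b}" "a \<le> x" "x \<le> y" "y \<le> b"
  shows "integral {a..y} f - integral {a..x} f = integral {x..y} f"
proof -
  have "f integrable_on {a..y}" using assms integrable_on_subinterval by fastforce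
  from Henstock_Kurzweil_Integration.integral_combine[OF assms(2,3) this] show ?thesis
    by (simp add: algebra_simps)
qed

lemma primitive_eq_integral:
  assumes f: "f absolutely_integrable_on {a..b}" and "a \<le> 0" "0 \<le> b" "x \<in> {a..b}"
  shows "primitive f x = (if 0 \<le> x then integral {0..x} f else - integral {x..0} f)"
proof -
  have "(LINT t:{u<..<v}|lebesgue. f t) = integral {u..v} f" if "{u..v} \<subseteq> {a..b}" for u v
  proof -
    have "set_integrable lebesgue {u<..<v} f"
      using set_integrable_subset[OF f] that greaterThanLessThan_subseteq_atLeastAtMost_iff
      by (metis greaterThanLessThan_borel sets_completionI_sets sets_lborel subset_trans order_refl)
    then show ?thesis
      using set_lebesgue_integral_eq_integral(2) integral_open_interval_real by metis
  qed
  then show ?thesis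
    using assms by (auto simp: primitive_def interval_lebesgue_integral_def zero_ereal_def)
qed

lemma primitive_eq_diff:
  assumes f: "f absolutely_integrable_on {a..b}" and ab: "a \<le> 0" "0 \<le> b" "x \<in> {a..b}"
  shows "primitive f x = integral {a..x} f - integral {a..0} f"
proof -
  have "f integrable_on {a..b}" using f by (simp add: absolutely_integrable_on_def)
  then have "0 \<le> x \<Longrightarrow> integral {0..x} f = integral {a..x} f - integral {a..0} f"
    and "x \<le> 0 \<Longrightarrow> integral {x..0} f = integral {a..0} f - integral {a..x} f"
    using integral_diff_eq_integral[of f a b 0 x] integral_diff_eq_integral[of f a b x 0] ab by auto
  then show ?thesis
    unfolding primitive_eq_integral[OF assms] by auto
qed

lemma primitive_0 [simp]: "primitive f 0 = 0"
  by (simp add: primitive_def interval_lebesgue_integral_def einterval_def set_lebesgue_integral_def)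

lemma abs_cont_on_primitive:
  assumes f: "f absolutely_integrable_on {a..b}" and ab: "a \<le> 0" "0 \<le> b"
  shows "abs_cont_on {a..b} (primitive f)"
  unfolding abs_cont_on_def
proof (intro allI impI)
  fix e :: real assume "e > 0"
  obtain d where "d > 0" and d: "\<And>\<D> T. \<D> division_of T \<Longrightarrow> T \<subseteq> {a..b} \<Longrightarrow>
        (\<Sum>k\<in>\<D>. Sup k - Inf k) < d \<Longrightarrow> (\<Sum>k\<in>\<D>. integral k (\<lambda>x. norm (f x))) < e"
    using sum_integral_division_small[OF f \<open>e > 0\<close>] by metis
  have "(\<Sum>k\<in>\<D>. norm (primitive f (Sup k) - primitive f (Inf k))) < e"
    if div: "\<D> division_of T" and T: "T \<subseteq> {a..b}" and small: "(\<Sum>k\<in>\<D>. Sup k - Inf k) < d" for \<D> T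
  proof -
    have "norm (primitive f (Sup k) - primitive f (Inf k)) \<le> integral k (\<lambda>x. norm (f x))" if "k \<in> \<D>" for k
    proof -
      note k = division_of_Inf_Sup[OF div that]
      have sub: "k \<subseteq> {a..b}" using division_ofD(2)[OF div that] T by blast
      have in_ab: "Inf k \<in> {a..b}" "Sup k \<in> {a..b}" using k(1,2) sub by blast+
      have fi: "f integrable_on {a..b}" using f by (simp add: absolutely_integrable_on_def)
      have "primitive f (Sup k) - primitive f (Inf k) = integral {a..Sup k} f - integral {a..Inf k} f"
        using in_ab by (simp add: primitive_eq_diff[OF f ab])
      also have "\<dots> = integral k f"
        using integral_diff_eq_integral[OF fi _ k(3)] in_ab k(4) by simp
      also have "norm \<dots> \<le> integral k (\<lambda>x. norm (f x))"
      proof -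
        have "f absolutely_integrable_on k"
          using set_integrable_subset[OF f _ sub] by (subst k(4)) (metis k(4) lborelD sets_completionI_sets sets_lborel borel_closed closed_atLeastAtMost)
        then show ?thesis
          by (simp add: absolutely_integrable_on_def integral_norm_bound_integral)
      qed
      finally show ?thesis .
    qed
    then have "(\<Sum>k\<in>\<D>. norm (primitive f (Sup k) - primitive f (Inf k)))
        \<le> (\<Sum>k\<in>\<D>. integral k (\<lambda>x. norm (f x)))" by (rule sum_mono)
    also have "\<dots> < e" by (rule d[OF that])
    finally show ?thesis .
  qed
  with \<open>d > 0\<close> show "\<exists>\<delta>>0. \<forall>\<D> T. \<D> division_of T \<and> T \<subseteq> {a..b} \<and> (\<Sum>k\<in>\<D>. Sup k - Inf k) < \<delta> \<longrightarrow>
      (\<Sum>k\<in>\<D>. norm (primitive f (Sup k) - primitive f (Inf k))) < e" by blast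
qed

text \<open>
  Lebesgue's differentiation theorem on the line. A point \<open>x\<close> of the set \<open>E n\<close> is an end point of
  arbitrarily short intervals with other end point \<open>y\<close> on which the increment of \<open>F\<close> differs from
  \<open>(y - x) f(x)\<close> by more than \<open>\<bar>y - x\<bar> / (n + 1)\<close>. By Vitali's theorem, disjoint such intervals
  cover almost all of \<open>E n\<close>; tagged with \<open>x\<close>, finitely many of them form a fine partial division, so by Henstock's
  lemma their total length is at most \<open>(n + 1) e'\<close> for any prescribed \<open>e' > 0\<close>.
\<close>

lemma lebesgue_differentiation_interval:
  fixes f :: "real \<Rightarrow> complex"
  assumes f: "f integrable_on {a..b}"
  obtains N where "negligible N"
    "\<And>x. x \<in> {a<..<b} - N \<Longrightarrow> ((\<lambda>x. integral {a..x} f) has_vector_derivative f x) (at x)"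
proof -
  define F where "F x = integral {a..x} f" for x
  define bad where "bad n x y \<longleftrightarrow> y \<in> {a..b} \<and> y \<noteq> x \<and>
      norm (F y - F x - (y - x) *\<^sub>R f x) > \<bar>y - x\<bar> / (real n + 1)" for n x y
  define E where "E n = {x \<in> {a<..<b}. \<forall>d>0. \<exists>y. \<bar>y - x\<bar> < d \<and> bad n x y}" for n
  have "negligible (E n)" for n
  proof (rule negligible_outer_le[THEN iffD2], intro allI impI)
    fix e :: real assume "e > 0"
    define e' where "e' = e / (real n + 1)"
    have "e' > 0" using \<open>e > 0\<close> by (simp add: e'_def)
    obtain \<gamma> where "gauge \<gamma>"
      and \<gamma>: "\<And>p. p tagged_partial_division_of cbox a b \<Longrightarrow> \<gamma> fine p \<Longrightarrow>
             (\<Sum>(x,k)\<in>p. norm (measure lborel k *\<^sub>R f x - integral k f)) < e'"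
      using Henstock_lemma[of f a b e'] f \<open>e' > 0\<close> by auto
    \<comment> \<open>\<open>B (x, y)\<close> is the closed interval with end points \<open>x\<close> and \<open>y\<close>, as a ball.\<close>
    define c r where "c i = (fst i + snd i) / 2" and "r i = \<bar>snd i - fst i\<bar> / 2" for i :: "real \<times> real"
    define B where "B i = cball (c i) (r i)" for i
    have B: "B i = {min (fst i) (snd i)..max (fst i) (snd i)}" for i
      by (auto simp: B_def c_def r_def cball_eq_atLeastAtMost min_def max_def field_simps)
    define K where "K = {(x, y). x \<in> E n \<and> bad n x y \<and> B (x, y) \<subseteq> \<gamma> x}"
    obtain C where C: "countable C" "C \<subseteq> K"
      and disj: "pairwise (\<lambda>i j. disjnt (cball (c i) (r i)) (cball (c j) (r j))) C"
      and cov: "negligible (E n - (\<Union>i\<in>C. cball (c i) (r i)))"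
    proof (rule Vitali_covering_theorem_cballs[of K r "E n" c])
      show "0 < r i" if "i \<in> K" for i using that by (auto simp: K_def bad_def r_def)
      fix x d :: real assume x: "x \<in> E n" and "d > 0"
      have "open (\<gamma> x)" "x \<in> \<gamma> x" using \<open>gauge \<gamma>\<close> by (auto simp: gauge_def)
      then obtain s where "s > 0" and s: "ball x s \<subseteq> \<gamma> x" using open_contains_ball by blast
      obtain y where y: "\<bar>y - x\<bar> < min s d" "bad n x y"
      proof -
        have "\<forall>d>0. \<exists>y. \<bar>y - x\<bar> < d \<and> bad n x y" using x by (simp add: E_def)
        moreover have "min s d > 0" using \<open>s > 0\<close> \<open>d > 0\<close> by simp
        ultimately show ?thesis using that by blast
      qed
      have "B (x, y) \<subseteq> ball x s" using y(1) by (auto simp: B dist_real_def)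
      then have "(x, y) \<in> K" using x y s by (auto simp: K_def)
      moreover have "x \<in> cball (c (x, y)) (r (x, y))" by (auto simp: B[unfolded B_def])
      moreover have "r (x, y) < d" using y(1) by (auto simp: r_def)
      ultimately show "\<exists>i. i \<in> K \<and> x \<in> cball (c i) (r i) \<and> r i < d" by blast
    qed blast
    have disj': "B i \<inter> B j = {}" if "i \<in> C" "j \<in> C" "i \<noteq> j" for i j
      using disj that by (auto simp: pairwise_def disjnt_def B_def)
    have sum_le: "(\<Sum>i\<in>C'. measure lebesgue (B i)) \<le> e" if C': "C' \<subseteq> C" "finite C'" for C'
    proof -
      define tg where "tg i = (fst i, B i)" for i
      have ne: "B i \<noteq> {}" for i by (auto simp: B)
      have "inj_on tg C'"
        using disj' C' ne by (intro inj_onI) (metis Int_absorb snd_conv subset_iff tg_def)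
      have Kbad: "fst i \<in> {a<..<b}" "bad n (fst i) (snd i)" "B i \<subseteq> \<gamma> (fst i)" if "i \<in> C'" for i
      proof -
        have "(fst i, snd i) \<in> K" using that C C' by auto
        then show "fst i \<in> {a<..<b}" "bad n (fst i) (snd i)" "B i \<subseteq> \<gamma> (fst i)"
          by (auto simp: K_def E_def)
      qed
      have "tg ` C' tagged_partial_division_of cbox a b"
        unfolding tagged_partial_division_of_def
      proof (intro conjI allI impI)
        show "finite (tg ` C')" using C' by simp
        fix x k assume xk: "(x, k) \<in> tg ` C'"
        then obtain i where i: "i \<in> C'" "x = fst i" "k = B i" by (auto simp: tg_def)
        show "x \<in> k" "\<exists>u v. k = cbox u v" using i by (auto simp: B)
        show "k \<subseteq> cbox a b" using i Kbad[OF i(1)] by (auto simp: B bad_def)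
      next
        fix x k x' k' assume xk: "(x, k) \<in> tg ` C' \<and> (x', k') \<in> tg ` C' \<and> (x, k) \<noteq> (x', k')"
        then obtain i where i: "i \<in> C'" "x = fst i" "k = B i" by (auto simp: tg_def)
        obtain j where j: "j \<in> C'" "x' = fst j" "k' = B j" using xk by (auto simp: tg_def)
        have neq: "(x, k) \<noteq> (x', k')" using xk by blast
        have "B i \<inter> B j = {}" using disj'[of i j] neq i j C' by auto
        then show "interior k \<inter> interior k' = {}"
          using i j interior_subset[of "B i"] interior_subset[of "B j"] by blast
      qed
      moreover have "\<gamma> fine tg ` C'" using Kbad by (auto simp: fine_def tg_def)
      ultimately have "(\<Sum>(x,k)\<in>tg ` C'. norm (measure lborel k *\<^sub>R f x - integral k f)) < e'" by (rule \<gamma>)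
      then have less: "(\<Sum>i\<in>C'. norm (measure lborel (B i) *\<^sub>R f (fst i) - integral (B i) f)) < e'"
        by (subst (asm) sum.reindex[OF \<open>inj_on tg C'\<close>]) (simp add: tg_def)
      have "measure lebesgue (B i) \<le> (real n + 1) * norm (measure lborel (B i) *\<^sub>R f (fst i) - integral (B i) f)"
        if "i \<in> C'" for i
      proof -
        obtain x y where i: "i = (x, y)" by (cases i)
        note * = Kbad[OF that, unfolded i fst_conv snd_conv]
        have xy: "x \<in> {a..b}" "y \<in> {a..b}" using * by (auto simp: bad_def)
        have "norm (measure lborel (B i) *\<^sub>R f (fst i) - integral (B i) f) = norm (F y - F x - (y - x) *\<^sub>R f x)"
        proof (cases "x \<le> y")
          case True
          then show ?thesis
            using integral_diff_eq_integral[OF f, of x y] xy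
            by (simp add: F_def i B norm_minus_commute)
        next
          case False
          then have I: "integral (B i) f = F x - F y" and m: "measure lborel (B i) = x - y"
            using integral_diff_eq_integral[OF f, of y x] xy by (simp_all add: F_def i B)
          have "measure lborel (B i) *\<^sub>R f x - integral (B i) f = F y - F x - (y - x) *\<^sub>R f x"
            unfolding I m by (simp add: algebra_simps)
          then show ?thesis by (simp add: i)
        qed
        moreover have "measure lebesgue (B i) = \<bar>y - x\<bar>" by (auto simp: B i min_def max_def)
        ultimately show ?thesis using * by (simp add: bad_def field_simps)
      qed
      then have "(\<Sum>i\<in>C'. measure lebesgue (B i))
          \<le> (real n + 1) * (\<Sum>i\<in>C'. norm (measure lborel (B i) *\<^sub>R f (fst i) - integral (B i) f))"
        unfolding sum_distrib_left by (rule sum_mono)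
      also have "\<dots> \<le> (real n + 1) * e'" using less by (intro mult_left_mono) auto
      finally show ?thesis by (simp add: e'_def)
    qed
    have UB: "(\<Union>i\<in>C. B i) \<in> lmeasurable" "measure lebesgue (\<Union>i\<in>C. B i) \<le> e"
    proof -
      have "measure lebesgue (\<Union>i\<in>C'. B i) \<le> e" if "C' \<subseteq> C" "finite C'" for C'
        using order_trans[OF measure_UNION_le[OF that(2), of B lebesgue] sum_le[OF that]] by (simp add: B)
      then show "(\<Union>i\<in>C. B i) \<in> lmeasurable" "measure lebesgue (\<Union>i\<in>C. B i) \<le> e"
        using fmeasurable_UN_bound[OF C(1), of B lebesgue e] measure_UN_bound[OF C(1), of B lebesgue e]
        by (auto simp: B)
    qed
    show "\<exists>T. E n \<subseteq> T \<and> T \<in> lmeasurable \<and> measure lebesgue T \<le> e"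
    proof (intro exI conjI)
      let ?Z = "E n - (\<Union>i\<in>C. B i)"
      have Z: "?Z \<in> null_sets lebesgue" using cov by (simp add: B_def negligible_iff_null_sets)
      show "E n \<subseteq> (\<Union>i\<in>C. B i) \<union> ?Z" by blast
      show "(\<Union>i\<in>C. B i) \<union> ?Z \<in> lmeasurable"
        using UB(1) fmeasurableI_null_sets[OF Z] by (rule fmeasurable.Un)
      show "measure lebesgue ((\<Union>i\<in>C. B i) \<union> ?Z) \<le> e"
        by (subst measure_Un_null_set[OF fmeasurableD[OF UB(1)] Z]) (rule UB(2))
    qed
  qed
  then have "negligible (\<Union>n. E n)" by (intro negligible_countable_Union) auto
  moreover have "(F has_vector_derivative f x) (at x)" if x: "x \<in> {a<..<b} - (\<Union>n. E n)" for x
  proof -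
    have "(F has_vector_derivative f x) (at x within {a..b})"
      unfolding has_vector_derivative_def has_derivative_within_alt
    proof (intro conjI allI impI)
      show "bounded_linear (\<lambda>h. h *\<^sub>R f x)" by (simp add: bounded_linear_scaleR_left)
      fix e :: real assume "e > 0"
      then obtain n where n: "1 / (real n + 1) < e" using nat_approx_posE by (metis add.commute of_nat_Suc)
      have "x \<notin> E n" using x by blast
      then obtain d where "d > 0" and d: "\<And>y. \<bar>y - x\<bar> < d \<Longrightarrow> \<not> bad n x y"
        using x unfolding E_def by auto
      have "norm (F y - F x - (y - x) *\<^sub>R f x) \<le> e * norm (y - x)" if "y \<in> {a..b}" "norm (y - x) < d" for y
      proof (cases "y = x")
        case False
        then have "norm (F y - F x - (y - x) *\<^sub>R f x) \<le> 1 / (real n + 1) * \<bar>y - x\<bar>"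
          using d[of y] that by (simp add: bad_def)
        also have "\<dots> \<le> e * \<bar>y - x\<bar>" using n by (intro mult_right_mono) auto
        finally show ?thesis by simp
      qed simp
      with \<open>d > 0\<close> show "\<exists>d>0. \<forall>y\<in>{a..b}. norm (y - x) < d \<longrightarrow> norm (F y - F x - (y - x) *\<^sub>R f x) \<le> e * norm (y - x)"
        by blast
    qed
    then show ?thesis using x by (simp add: at_within_Icc_at)
  qed
  ultimately show ?thesis using that unfolding F_def[abs_def] by blast
qed

lemma absolutely_integrable_mult_continuous:
  fixes f g :: "real \<Rightarrow> complex"
  assumes f: "f absolutely_integrable_on {a..b}" and g: "continuous_on {a..b} g"
  shows "(\<lambda>x. f x * g x) absolutely_integrable_on {a..b}"
proof -
  have "bounded (g ` {a..b})"
    using g compact_continuous_image compact_imp_bounded by blast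
  moreover have "g \<in> borel_measurable (lebesgue_on {a..b})"
    using g by (simp add: continuous_imp_measurable_on_sets_lebesgue)
  ultimately have "(\<lambda>x. g x * f x) absolutely_integrable_on {a..b}"
    using f by (intro absolutely_integrable_bounded_measurable_product[OF bilinear_times]) auto
  then show ?thesis by (simp add: mult.commute)
qed

lemma primitive_has_vector_derivative_ae:
  assumes f: "f absolutely_integrable_on {a..b}" and ab: "a \<le> 0" "0 \<le> b"
  obtains N where "negligible N"
    "\<And>x. x \<in> {a<..<b} - N \<Longrightarrow> (primitive f has_vector_derivative f x) (at x)"
proof -
  have "f integrable_on {a..b}" using f by (simp add: absolutely_integrable_on_def)
  then obtain N where N: "negligible N"
    "\<And>x. x \<in> {a<..<b} - N \<Longrightarrow> ((\<lambda>x. integral {a..x} f) has_vector_derivative f x) (at x)"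
    using lebesgue_differentiation_interval by metis
  have "(primitive f has_vector_derivative f x) (at x)" if x: "x \<in> {a<..<b} - N" for x
  proof -
    have "((\<lambda>x. integral {a..x} f - integral {a..0} f) has_vector_derivative f x - 0) (at x)"
      by (intro has_vector_derivative_diff N(2)[OF x] has_vector_derivative_const)
    then have *: "((\<lambda>x. integral {a..x} f - integral {a..0} f) has_vector_derivative f x) (at x)" by simp
    show ?thesis
    proof (rule has_vector_derivative_transform_within_open[OF *])
      show "integral {a..y} f - integral {a..0} f = primitive f y" if "y \<in> {a<..<b}" for y
        using that by (simp add: primitive_eq_diff[OF f ab])
    qed (use x in auto)
  qed
  with N(1) show ?thesis using that by blast
qed

lemma primitive_has_vector_derivative:
  assumes f: "continuous_on {a..b} f" and ab: "a \<le> 0" "0 \<le> b" and x: "x \<in> {a<..<b}"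
  shows "(primitive f has_vector_derivative f x) (at x)"
proof -
  have ai: "f absolutely_integrable_on {a..b}"
    using f absolutely_integrable_continuous_real by blast
  have "((\<lambda>x. integral {a..x} f) has_vector_derivative f x) (at x within {a..b})"
    using integral_has_vector_derivative[OF f] x by auto
  then have "((\<lambda>x. integral {a..x} f) has_vector_derivative f x) (at x)"
    using x by (simp add: at_within_Icc_at)
  then have "((\<lambda>x. integral {a..x} f - integral {a..0} f) has_vector_derivative f x - 0) (at x)"
    by (intro has_vector_derivative_diff has_vector_derivative_const)
  then have *: "((\<lambda>x. integral {a..x} f - integral {a..0} f) has_vector_derivative f x) (at x)" by simp
  show ?thesis
  proof (rule has_vector_derivative_transform_within_open[OF *])
    show "integral {a..y} f - integral {a..0} f = primitive f y" if "y \<in> {a<..<b}" for y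
      using that by (simp add: primitive_eq_diff[OF ai ab])
  qed (use x in auto)
qed

section \<open>A weighted estimate for Volterra operators\<close>

text \<open>
  The weight \<open>W\<close> of the norm \<open>sup \<bar>u\<bar> / W\<close>, in which the integral operators
  \<open>u \<mapsto> \<integral>\<^sub>0\<^sup>x f u\<close> with \<open>\<bar>f\<bar> \<le> \<kappa>\<close> have norm at most \<open>1/2\<close>.
\<close>

definition weight :: "(real \<Rightarrow> real) \<Rightarrow> real \<Rightarrow> real" where
  "weight \<kappa> x = exp (2 * norm (primitive (\<lambda>t. complex_of_real (\<kappa> t)) x))"

lemma weight_ge_1: "1 \<le> weight \<kappa> x" and weight_pos: "0 < weight \<kappa> x"
  by (simp_all add: weight_def)

lemma continuous_on_weight:
  assumes "(\<lambda>t. complex_of_real (\<kappa> t)) absolutely_integrable_on {a..b}" "a \<le> 0" "0 \<le> b"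
  shows "continuous_on {a..b} (weight \<kappa>)"
  unfolding weight_def[abs_def]
  using abs_cont_on_imp_continuous_on[OF abs_cont_on_primitive[OF assms]]
  by (intro continuous_intros)

text \<open>
  Since \<open>\<kappa> W\<close> is, up to sign, half the derivative of the weight \<open>W\<close>, integration gains a factor
  \<open>1/2\<close>. This one estimate gives both the convergence of the series of iterated integrals and
  the uniqueness of solutions.
\<close>

lemma norm_primitive_le_weight:
  assumes \<kappa>: "(\<lambda>t. complex_of_real (\<kappa> t)) absolutely_integrable_on {a..b}"
    and ab: "a \<le> 0" "0 \<le> b" and pos: "\<And>t. t \<in> {a..b} \<Longrightarrow> 0 \<le> \<kappa> t"
    and g: "g absolutely_integrable_on {a..b}" and "0 \<le> M"
    and le: "\<And>t. t \<in> {a..b} \<Longrightarrow> norm (g t) \<le> M * (\<kappa> t * weight \<kappa> t)"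
    and x: "x \<in> {a..b}"
  shows "norm (primitive g x) \<le> M / 2 * weight \<kappa> x"
proof -
  define K where "K = primitive (\<lambda>t. complex_of_real (\<kappa> t))"
  obtain N where N: "negligible N"
    "\<And>x. x \<in> {a<..<b} - N \<Longrightarrow> (K has_vector_derivative complex_of_real (\<kappa> x)) (at x)"
    using primitive_has_vector_derivative_ae[OF \<kappa> ab] unfolding K_def by metis
  have Kac: "abs_cont_on {a..b} K" unfolding K_def by (rule abs_cont_on_primitive[OF \<kappa> ab])
  have \<kappa>i: "\<kappa> integrable_on {a..b}"
  proof -
    have "(\<lambda>t. complex_of_real (\<kappa> t)) integrable_on {a..b}"
      using \<kappa> by (simp add: absolutely_integrable_on_def)
    then have "(Re \<circ> (\<lambda>t. complex_of_real (\<kappa> t))) integrable_on {a..b}"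
      by (rule integrable_linear[OF _ bounded_linear_Re])
    then show ?thesis by (simp add: o_def)
  qed
  have K_int: "integral {u..v} (\<lambda>t. complex_of_real (\<kappa> t)) = complex_of_real (integral {u..v} \<kappa>)"
    "0 \<le> integral {u..v} \<kappa>" if "{u..v} \<subseteq> {a..b}" for u v
  proof -
    have i: "\<kappa> integrable_on {u..v}" using \<kappa>i that integrable_on_subinterval by blast
    have "(complex_of_real \<circ> \<kappa> has_integral complex_of_real (integral {u..v} \<kappa>)) {u..v}"
      by (rule has_integral_linear[OF integrable_integral[OF i] bounded_linear_of_real])
    then show "integral {u..v} (\<lambda>t. complex_of_real (\<kappa> t)) = complex_of_real (integral {u..v} \<kappa>)"
      by (simp add: o_def integral_unique)
    show "0 \<le> integral {u..v} \<kappa>" using pos that by (intro integral_nonneg i) auto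
  qed
  have Kpos: "K t = complex_of_real (norm (K t))" if "0 \<le> t" "t \<in> {a..b}" for t
    using K_int[of 0 t] that ab by (simp add: K_def primitive_eq_integral[OF \<kappa> ab])
  have Kneg: "K t = - complex_of_real (norm (K t))" if "t \<le> 0" "t \<in> {a..b}" for t
    using K_int[of t 0] that ab by (cases "t = 0") (simp_all add: K_def primitive_eq_integral[OF \<kappa> ab])
  have exp_int: "((\<lambda>t. complex_of_real (\<kappa> t) * exp (of_real \<sigma> * 2 * K t)) has_integral
      of_real \<sigma> * (exp (of_real \<sigma> * 2 * K v) - exp (of_real \<sigma> * 2 * K u)) / 2) {u..v}"
    if "{u..v} \<subseteq> {a..b}" "u \<le> v" "\<sigma> = 1 \<or> \<sigma> = -1" for u v \<sigma> :: real
  proof -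
    let ?F = "\<lambda>t. of_real \<sigma> / 2 * exp (of_real \<sigma> * 2 * K t)"
    have "((\<lambda>t. complex_of_real (\<kappa> t) * exp (of_real \<sigma> * 2 * K t)) has_integral ?F v - ?F u) {u..v}"
    proof (rule abs_cont_on_has_integral[OF _ \<open>u \<le> v\<close>])
      have "abs_cont_on {a..b} ?F"
        by (intro abs_cont_on_mult abs_cont_on_exp abs_cont_on_const Kac)
      then show "abs_cont_on {u..v} ?F" using abs_cont_on_subset that(1) by blast
      show "negligible (N \<union> {u, v})" using N(1) by simp
      fix t assume t: "t \<in> {u..v} - (N \<union> {u, v})"
      then have "t \<in> {a<..<b} - N" using that(1) by auto
      note N(2)[OF this]
      then have 1: "((\<lambda>t. of_real \<sigma> * 2 * K t) has_vector_derivative of_real \<sigma> * 2 * of_real (\<kappa> t)) (at t)"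
        by (intro derivative_intros)
      have 2: "(?F has_vector_derivative of_real \<sigma> / 2 *
          (of_real \<sigma> * 2 * of_real (\<kappa> t) * exp (of_real \<sigma> * 2 * K t))) (at t)"
        using field_vector_diff_chain_at[OF 1 DERIV_exp]
        by (intro has_vector_derivative_mult_right) (simp add: o_def)
      show "(?F has_vector_derivative complex_of_real (\<kappa> t) * exp (of_real \<sigma> * 2 * K t)) (at t within {u..v})"
        using 2 that(3) by (auto intro: has_vector_derivative_at_within)
    qed
    then show ?thesis by (simp add: algebra_simps diff_divide_distrib)
  qed
  have W: "((\<lambda>t. M * (\<kappa> t * weight \<kappa> t)) has_integral M * ((weight \<kappa> x - 1) / 2)) {min 0 x..max 0 x}"
  proof -
    \<comment> \<open>The sign makes \<open>exp (2 \<sigma> K)\<close> equal to the weight on the segment from \<open>0\<close> to \<open>x\<close>.\<close>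
    define \<sigma> :: real where "\<sigma> = (if 0 \<le> x then 1 else -1)"
    have Kw: "exp (of_real \<sigma> * 2 * K t) = complex_of_real (weight \<kappa> t)" if "t \<in> {min 0 x..max 0 x}" for t
    proof -
      have "of_real \<sigma> * K t = complex_of_real (norm (K t))"
      proof (cases "0 \<le> x")
        case True
        then show ?thesis using Kpos[of t] that x ab by (simp add: \<sigma>_def)
      next
        case False
        then have "K t = - complex_of_real (norm (K t))" using Kneg[of t] that x ab by simp
        then have "- K t = complex_of_real (norm (K t))" by (metis minus_minus)
        then show ?thesis using False by (simp add: \<sigma>_def)
      qed
      then have "of_real \<sigma> * 2 * K t = complex_of_real (2 * norm (K t))"
        by (simp add: algebra_simps)
      then show ?thesis unfolding weight_def K_def[symmetric] by (simp only: exp_of_real)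
    qed
    have w0: "weight \<kappa> 0 = 1" by (simp add: weight_def)
    have sub: "{min 0 x..max 0 x} \<subseteq> {a..b}" using x ab by auto
    have "((\<lambda>t. complex_of_real (\<kappa> t) * exp (of_real \<sigma> * 2 * K t)) has_integral
      of_real \<sigma> * (exp (of_real \<sigma> * 2 * K (max 0 x)) - exp (of_real \<sigma> * 2 * K (min 0 x))) / 2) {min 0 x..max 0 x}"
      by (rule exp_int[OF sub]) (auto simp: \<sigma>_def)
    moreover have "of_real \<sigma> * (exp (of_real \<sigma> * 2 * K (max 0 x)) - exp (of_real \<sigma> * 2 * K (min 0 x))) / 2
        = complex_of_real ((weight \<kappa> x - 1) / 2)"
      using Kw[of x] Kw[of 0] w0 by (auto simp: \<sigma>_def min_def max_def)
    moreover have "((\<lambda>t. complex_of_real (\<kappa> t) * exp (of_real \<sigma> * 2 * K t)) has_integral y) {min 0 x..max 0 x}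
        \<longleftrightarrow> ((\<lambda>t. complex_of_real (\<kappa> t * weight \<kappa> t)) has_integral y) {min 0 x..max 0 x}" for y
      by (rule has_integral_cong) (simp add: Kw)
    ultimately have "((\<lambda>t. complex_of_real (\<kappa> t * weight \<kappa> t)) has_integral complex_of_real ((weight \<kappa> x - 1) / 2)) {min 0 x..max 0 x}"
      by simp
    then have "(Re \<circ> (\<lambda>t. complex_of_real (\<kappa> t * weight \<kappa> t)) has_integral Re (complex_of_real ((weight \<kappa> x - 1) / 2))) {min 0 x..max 0 x}"
      by (rule has_integral_linear[OF _ bounded_linear_Re])
    then have "((\<lambda>t. \<kappa> t * weight \<kappa> t) has_integral (weight \<kappa> x - 1) / 2) {min 0 x..max 0 x}"
      by (simp add: o_def)
    then show ?thesis by (rule has_integral_mult_right)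
  qed
  have "norm (primitive g x) = norm (integral {min 0 x..max 0 x} g)"
    by (simp add: primitive_eq_integral[OF g ab x])
  also have "\<dots> \<le> integral {min 0 x..max 0 x} (\<lambda>t. M * (\<kappa> t * weight \<kappa> t))"
  proof (rule integral_norm_bound_integral)
    have sub: "{min 0 x..max 0 x} \<subseteq> {a..b}" using x ab by auto
    then show "g integrable_on {min 0 x..max 0 x}"
      using g integrable_on_subinterval absolutely_integrable_on_def by blast
    show "(\<lambda>t. M * (\<kappa> t * weight \<kappa> t)) integrable_on {min 0 x..max 0 x}" using W by blast
    show "norm (g t) \<le> M * (\<kappa> t * weight \<kappa> t)" if "t \<in> {min 0 x..max 0 x}" for t
      using le sub that by blast
  qed
  also have "\<dots> = M * ((weight \<kappa> x - 1) / 2)" using W by (rule integral_unique)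
  also have "\<dots> \<le> M / 2 * weight \<kappa> x" using \<open>0 \<le> M\<close> by (simp add: algebra_simps)
  finally show ?thesis .
qed


section \<open>Iterated integrals\<close>

lemma sigma_finite_measure_lebesgue: "sigma_finite_measure (lebesgue :: real measure)"
proof
  show "\<exists>A. countable A \<and> A \<subseteq> sets lebesgue \<and> \<Union>A = space (lebesgue :: real measure)
      \<and> (\<forall>a\<in>A. emeasure lebesgue a \<noteq> \<infinity>)"
  proof (intro exI[of _ "range (\<lambda>n::nat. {- real n..real n})"] conjI)
    have "\<exists>n. x \<in> {- real n..real n}" for x :: real
    proof -
      obtain n where "\<bar>x\<bar> \<le> real n" using real_arch_simple by blast
      then have "x \<in> {- real n..real n}" by auto
      then show ?thesis ..
    qed
    then show "(\<Union>n::nat. {- real n..real n}) = space lebesgue" by auto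
  qed auto
qed

interpretation lebesgue_product: product_sigma_finite "\<lambda>_::nat. lebesgue :: real measure"
  by (intro product_sigma_finite.intro sigma_finite_measure_lebesgue)

text \<open>
  The simplex \<open>0 L s\<^sub>1 L \<dots> L s\<^sub>j L x\<close>, where \<open>L\<close> is \<open><\<close> to the right of \<open>0\<close> and \<open>>\<close> to the left of
  it. Every \<open>s i\<close> is bounded by both \<open>0\<close> and \<open>x\<close>, so that \<open>j = 0\<close> needs no separate treatment.
\<close>

definition ordered_simplex :: "(real \<Rightarrow> real \<Rightarrow> bool) \<Rightarrow> nat \<Rightarrow> real \<Rightarrow> (nat \<Rightarrow> real) set" where
  "ordered_simplex L j x =
    {s. (\<forall>i\<in>{1..j}. L 0 (s i) \<and> L (s i) x) \<and> (\<forall>i\<in>{1..<j}. L (s i) (s (Suc i)))}"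

text \<open>As in the definition of the trig operators, \<open>h i\<close> is the factor in the variable \<open>s i\<close>.\<close>

definition simplex_integral ::
    "(real \<Rightarrow> real \<Rightarrow> bool) \<Rightarrow> (nat \<Rightarrow> real \<Rightarrow> complex) \<Rightarrow> nat \<Rightarrow> real \<Rightarrow> complex" where
  "simplex_integral L h j x =
    (LINT s:ordered_simplex L j x|PiM {1..j} (\<lambda>_. lebesgue). (\<Prod>i=1..j. h i (s i)))"

lemma simplex_integral_0: "simplex_integral L h 0 x = 1"
  by (simp add: simplex_integral_def ordered_simplex_def set_lebesgue_integral_def PiM_empty
      space_PiM lebesgue_integral_count_space_finite measure_def)

lemma ordered_simplex_Suc:
  assumes "transp L"
  shows "s \<in> ordered_simplex L (Suc j) x \<longleftrightarrow>
    L 0 (s (Suc j)) \<and> L (s (Suc j)) x \<and> s \<in> ordered_simplex L j (s (Suc j))"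
proof
  assume s: "s \<in> ordered_simplex L (Suc j) x"
  have chain: "L (s i) (s (Suc i))" if "i \<in> {1..j}" for i
    using s that by (auto simp: ordered_simplex_def)
  have "L (s i) (s (Suc j))" if "1 \<le> i" "i \<le> j" for i
    using \<open>i \<le> j\<close>
  proof (induction rule: inc_induct)
    case base
    then show ?case using chain[of j] that by simp
  next
    case (step k)
    then show ?case using chain[of k] that assms by (metis Suc_leD atLeastAtMost_iff le_trans less_imp_le_nat transpE)
  qed
  then show "L 0 (s (Suc j)) \<and> L (s (Suc j)) x \<and> s \<in> ordered_simplex L j (s (Suc j))"
    using s by (auto simp: ordered_simplex_def)
next
  assume s: "L 0 (s (Suc j)) \<and> L (s (Suc j)) x \<and> s \<in> ordered_simplex L j (s (Suc j))"
  have "L (s i) x" if "i \<in> {1..j}" for i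
    using s that transpD[OF assms, of "s i" "s (Suc j)" x] by (auto simp: ordered_simplex_def)
  moreover have "L (s i) (s (Suc i))" if "i \<in> {1..j}" for i
    using s that by (cases "i = j") (auto simp: ordered_simplex_def)
  ultimately show "s \<in> ordered_simplex L (Suc j) x"
    using s by (auto simp: ordered_simplex_def le_Suc_eq less_Suc_eq_le)
qed

text \<open>Fubini's theorem, with the outermost variable \<open>s\<^sub>j\<^sub>+\<^sub>1\<close> integrated last.\<close>

lemma simplex_integral_Suc:
  fixes h :: "nat \<Rightarrow> real \<Rightarrow> complex"
  assumes L: "transp L" "L = (<) \<or> L = (>)"
    and A: "A = {t. L 0 t \<and> L t x}"
    and h: "\<And>i. i \<in> {1..Suc j} \<Longrightarrow> set_integrable lebesgue A (h i)"
    and meas: "(\<lambda>t. indicator A t *\<^sub>R (h (Suc j) t * simplex_integral L h j t)) \<in> borel_measurable lebesgue"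
  shows "simplex_integral L h (Suc j) x = (LINT t:A|lebesgue. h (Suc j) t * simplex_integral L h j t)"
proof -
  let ?S = "ordered_simplex L (Suc j) x"
  let ?P = "\<lambda>J. PiM J (\<lambda>_. lebesgue :: real measure)"
  let ?I = "{Suc j}" and ?J = "{1..j}"
  define g where "g i t = indicator A t *\<^sub>R h i t" for i t
  define F where "F s = indicator ?S s *\<^sub>R (\<Prod>i=1..Suc j. h i (s i))" for s
  define G where "G t = indicator A t *\<^sub>R (h (Suc j) t * simplex_integral L h j t)" for t
  have un: "?I \<union> ?J = {1..Suc j}" by auto
  have F_eq: "F s = indicator ?S s *\<^sub>R (\<Prod>i=1..Suc j. g i (s i))" for s
  proof (cases "s \<in> ?S")
    case True
    then have "s i \<in> A" if "i \<in> {1..Suc j}" for i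
      using that by (auto simp: ordered_simplex_def A)
    then have "(\<Prod>i=1..Suc j. h i (s i)) = (\<Prod>i=1..Suc j. g i (s i))"
      by (intro prod.cong refl) (simp only: g_def indicator_simps scaleR_one)
    then show ?thesis by (simp only: F_def)
  qed (simp add: F_def)
  have "integrable (?P {1..Suc j}) (\<lambda>s. \<Prod>i=1..Suc j. g i (s i))"
    using h by (intro lebesgue_product.product_integrable_prod) (auto simp: g_def set_integrable_def)
  moreover have "?S \<inter> space (?P {1..Suc j}) \<in> sets (?P {1..Suc j})"
  proof -
    have "(\<lambda>x. x) \<in> borel_measurable (lebesgue :: real measure)"
      by (rule measurable_completion) simp
    then have comp: "(\<lambda>s. s i) \<in> borel_measurable (?P {1..Suc j})" if "i \<in> {1..Suc j}" for i
      by (rule measurable_compose[OF measurable_component_singleton[OF that]])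
    have lt: "{s \<in> space (?P {1..Suc j}). L (u s) (v s)} \<in> sets (?P {1..Suc j})"
      if "u \<in> borel_measurable (?P {1..Suc j})" "v \<in> borel_measurable (?P {1..Suc j})" for u v :: "_ \<Rightarrow> real"
      using L(2) that by (auto intro!: borel_measurable_less)
    have "?S \<inter> space (?P {1..Suc j}) =
      {s \<in> space (?P {1..Suc j}). (\<forall>i\<in>{1..Suc j}. L 0 (s i) \<and> L (s i) x) \<and> (\<forall>i\<in>{1..<Suc j}. L (s i) (s (Suc i)))}"
      by (auto simp: ordered_simplex_def)
    also have "\<dots> \<in> sets (?P {1..Suc j})"
      by (intro sets.sets_Collect_conj sets.sets_Collect_finite_All lt comp borel_measurable_const) auto
    finally show ?thesis .
  qed
  ultimately have "integrable (?P {1..Suc j})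
      (\<lambda>s. indicator (?S \<inter> space (?P {1..Suc j})) s *\<^sub>R (\<Prod>i=1..Suc j. g i (s i)))"
    by (intro integrable_mult_indicator)
  then have F_int: "integrable (?P (?I \<union> ?J)) F"
    unfolding un by (rule Bochner_Integration.integrable_cong[THEN iffD1, rotated 2])
      (auto simp: F_eq indicator_def)
  have inner: "(LINT y|?P ?J. F (merge ?I ?J (s, y))) = G (s (Suc j))" for s
  proof -
    let ?t = "s (Suc j)"
    have "F (merge ?I ?J (s, y)) = (indicator A ?t *\<^sub>R h (Suc j) ?t) *
        (indicator (ordered_simplex L j ?t) y *\<^sub>R (\<Prod>i=1..j. h i (y i)))" for y
    proof -
      let ?m = "merge ?I ?J (s, y)"
      have m: "?m (Suc j) = ?t" "\<And>i. i \<in> {1..j} \<Longrightarrow> ?m i = y i" by (auto simp: merge_def)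
      have "?m \<in> ordered_simplex L j ?t \<longleftrightarrow> y \<in> ordered_simplex L j ?t"
        by (simp add: ordered_simplex_def m(2))
      then have "?m \<in> ?S \<longleftrightarrow> ?t \<in> A \<and> y \<in> ordered_simplex L j ?t"
        unfolding ordered_simplex_Suc[OF L(1)] m(1) A by blast
      moreover have "(\<Prod>i=1..Suc j. h i (?m i)) = h (Suc j) ?t * (\<Prod>i=1..j. h i (y i))"
      proof -
        have "(\<Prod>i=1..Suc j. h i (?m i)) = (\<Prod>i=1..j. h i (?m i)) * h (Suc j) (?m (Suc j))" by simp
        also have "(\<Prod>i=1..j. h i (?m i)) = (\<Prod>i=1..j. h i (y i))"
          by (intro prod.cong refl) (simp only: m(2))
        finally show ?thesis by (simp only: m(1) mult.commute)
      qed
      ultimately show ?thesis by (auto simp: F_def indicator_def)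
    qed
    then have "(LINT y|?P ?J. F (merge ?I ?J (s, y))) = (LINT y|?P ?J. (indicator A ?t *\<^sub>R h (Suc j) ?t) *
        (indicator (ordered_simplex L j ?t) y *\<^sub>R (\<Prod>i=1..j. h i (y i))))"
      by (intro Bochner_Integration.integral_cong refl)
    also have "\<dots> = (indicator A ?t *\<^sub>R h (Suc j) ?t) * simplex_integral L h j ?t"
      unfolding simplex_integral_def set_lebesgue_integral_def by (rule integral_mult_right_zero)
    finally show ?thesis by (simp add: G_def)
  qed
  have "simplex_integral L h (Suc j) x = integral\<^sup>L (?P (?I \<union> ?J)) F"
    unfolding un simplex_integral_def set_lebesgue_integral_def F_def[abs_def] ..
  also have "\<dots> = (LINT s|?P ?I. LINT y|?P ?J. F (merge ?I ?J (s, y)))"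
    by (rule lebesgue_product.product_integral_fold[OF _ _ _ F_int]) auto
  also have "\<dots> = (LINT s|?P ?I. G (s (Suc j)))" unfolding inner ..
  also have "\<dots> = integral\<^sup>L lebesgue G"
    using meas by (intro lebesgue_product.product_integral_singleton) (simp add: G_def[abs_def])
  finally show ?thesis by (simp add: G_def[abs_def] set_lebesgue_integral_def)
qed

text \<open>The factor \<open>f\<^sub>\<nu>\<^sub>(\<^sub>i\<^sub>)\<close> in the integrand of the iterated integrals.\<close>

abbreviation trig_factor :: "(real \<Rightarrow> complex) list \<Rightarrow> nat \<Rightarrow> real \<Rightarrow> complex" where
  "trig_factor fs i \<equiv> fs ! (\<nu> (length fs) i - 1)"

lemma trigS_0 [simp]: "trigS fs 0 x = 1"
  by (simp add: trigS_def)

lemma trigS_eq_simplex_integral: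
  "0 \<le> x \<Longrightarrow> trigS fs j x = simplex_integral (<) (trig_factor fs) j x"
  "x \<le> 0 \<Longrightarrow> trigS fs j x = (- 1) ^ j * simplex_integral (>) (trig_factor fs) j x"
proof -
  have pos: "trigS fs j x = simplex_integral (<) (trig_factor fs) j x" if "0 \<le> x" for x
    using that by (cases "j = 0")
      (simp_all add: trigS_def simplex_integral_0, simp add: simplex_integral_def ordered_simplex_def)
  then show "0 \<le> x \<Longrightarrow> trigS fs j x = simplex_integral (<) (trig_factor fs) j x" .
  have "trigS fs j 0 = (- 1) ^ j * simplex_integral (>) (trig_factor fs) j 0"
  proof (cases "j = 0")
    case False
    then have "1 \<in> {1..j}" by simp
    then have "ordered_simplex (>) j 0 = {}" "ordered_simplex (<) j 0 = {}"
      unfolding ordered_simplex_def by fastforce+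
    then show ?thesis
      by (simp add: pos simplex_integral_def set_lebesgue_integral_def)
  qed (simp add: simplex_integral_0)
  moreover have "trigS fs j x = (- 1) ^ j * simplex_integral (>) (trig_factor fs) j x" if "x < 0"
    using that by (cases "j = 0") (simp_all add: trigS_def simplex_integral_0, simp add: simplex_integral_def ordered_simplex_def conj_commute)
  ultimately show "x \<le> 0 \<Longrightarrow> trigS fs j x = (- 1) ^ j * simplex_integral (>) (trig_factor fs) j x"
    by (cases "x = 0") auto
qed

lemma \<nu>_in: "n \<noteq> 0 \<Longrightarrow> \<nu> n j \<in> {1..n}"
  by (auto simp: \<nu>_def Suc_leI less_imp_le)

lemma trig_factor_in: "fs \<noteq> [] \<Longrightarrow> trig_factor fs i \<in> set fs"
  using \<nu>_in[of "length fs" i] by (intro nth_mem) auto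

text \<open>
  Differentiating an iterated integral strips off its last factor. Continuity of the previous
  integral is needed for the integrability of the new integrand, and is removed as a hypothesis
  by induction below.
\<close>

lemma trigS_Suc_aux:
  assumes fs: "\<And>f. f \<in> set fs \<Longrightarrow> f absolutely_integrable_on {a..b}" and "fs \<noteq> []"
    and ab: "a \<le> 0" "0 \<le> b" and cont: "continuous_on {a..b} (trigS fs j)"
    and x: "x \<in> {a..b}"
  shows "trigS fs (Suc j) x = primitive (\<lambda>t. trig_factor fs (Suc j) t * trigS fs j t) x"
proof -
  let ?h = "trig_factor fs"
  have h: "?h i absolutely_integrable_on {a..b}" for i
    using fs trig_factor_in[OF \<open>fs \<noteq> []\<close>] by blast
  have prod: "(\<lambda>t. ?h (Suc j) t * trigS fs j t) absolutely_integrable_on {a..b}"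
    by (rule absolutely_integrable_mult_continuous[OF h cont])
  have sub: "set_integrable lebesgue A f" if "f absolutely_integrable_on {a..b}" "A \<subseteq> {a..b}" "A \<in> sets borel"
    for f :: "real \<Rightarrow> complex" and A
    using set_integrable_subset[OF that(1) _ that(2)] that(3) by simp
  show ?thesis
  proof (cases "0 \<le> x")
    case True
    define A where "A = {0<..<x}"
    have A: "A \<subseteq> {a..b}" "A \<in> sets borel" using x ab by (auto simp: A_def)
    have eq: "indicator A t *\<^sub>R (?h (Suc j) t * simplex_integral (<) ?h j t)
        = indicator A t *\<^sub>R (?h (Suc j) t * trigS fs j t)" for t
      by (auto simp: A_def trigS_eq_simplex_integral indicator_def)
    have "trigS fs (Suc j) x = simplex_integral (<) ?h (Suc j) x"
      by (rule trigS_eq_simplex_integral(1)[OF True])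
    also have "\<dots> = (LINT t:A|lebesgue. ?h (Suc j) t * simplex_integral (<) ?h j t)"
    proof (rule simplex_integral_Suc)
      show "A = {t. 0 < t \<and> t < x}" by (auto simp: A_def)
      show "(\<lambda>t. indicator A t *\<^sub>R (?h (Suc j) t * simplex_integral (<) ?h j t)) \<in> borel_measurable lebesgue"
        unfolding eq using sub[OF prod A] by (auto simp: set_integrable_def)
    qed (use sub[OF h A] in \<open>auto simp: transp_def\<close>)
    also have "\<dots> = (LINT t:A|lebesgue. ?h (Suc j) t * trigS fs j t)"
      unfolding set_lebesgue_integral_def eq ..
    also have "\<dots> = primitive (\<lambda>t. ?h (Suc j) t * trigS fs j t) x"
      using True by (simp add: primitive_def interval_lebesgue_integral_def A_def zero_ereal_def)
    finally show ?thesis .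
  next
    case False
    \<comment> \<open>The sign \<open>(-1)\<^sup>j\<^sup>+\<^sup>1\<close> supplies the minus of the integral from \<open>0\<close> down to \<open>x\<close>.\<close>
    define A where "A = {x<..<0}"
    have A: "A \<subseteq> {a..b}" "A \<in> sets borel" using x ab by (auto simp: A_def)
    have eq: "indicator A t *\<^sub>R (?h (Suc j) t * simplex_integral (>) ?h j t)
        = indicator A t *\<^sub>R ((- 1) ^ j * (?h (Suc j) t * trigS fs j t))" for t
      by (auto simp: A_def trigS_eq_simplex_integral indicator_def simp flip: power_add mult.assoc)
    have "trigS fs (Suc j) x = (- 1) ^ Suc j * simplex_integral (>) ?h (Suc j) x"
      using False by (intro trigS_eq_simplex_integral(2)) simp
    also have "simplex_integral (>) ?h (Suc j) x = (LINT t:A|lebesgue. ?h (Suc j) t * simplex_integral (>) ?h j t)"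
    proof (rule simplex_integral_Suc)
      show "A = {t. 0 > t \<and> t > x}" by (auto simp: A_def)
      show "(\<lambda>t. indicator A t *\<^sub>R (?h (Suc j) t * simplex_integral (>) ?h j t)) \<in> borel_measurable lebesgue"
        unfolding eq using sub[OF prod A] by (auto simp: set_integrable_def simp flip: mult_scaleR_right)
    qed (use sub[OF h A] in \<open>auto simp: transp_def\<close>)
    also have "\<dots> = (LINT t:A|lebesgue. (- 1) ^ j * (?h (Suc j) t * trigS fs j t))"
      unfolding set_lebesgue_integral_def eq ..
    also have "\<dots> = (- 1) ^ j * (LINT t:A|lebesgue. ?h (Suc j) t * trigS fs j t)"
      by (rule set_integral_mult_right)
    also have "(- 1) ^ Suc j * \<dots> = - (LINT t:A|lebesgue. ?h (Suc j) t * trigS fs j t)"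
      by (simp flip: mult.assoc power_add)
    also have "\<dots> = primitive (\<lambda>t. ?h (Suc j) t * trigS fs j t) x"
      using False by (simp add: primitive_def interval_lebesgue_integral_def A_def zero_ereal_def)
    finally show ?thesis .
  qed
qed

lemma continuous_on_trigS:
  assumes fs: "\<And>f. f \<in> set fs \<Longrightarrow> f absolutely_integrable_on {a..b}" and "fs \<noteq> []"
    and ab: "a \<le> 0" "0 \<le> b"
  shows "continuous_on {a..b} (trigS fs j)"
proof (induction j)
  case (Suc j)
  have "(\<lambda>t. trig_factor fs (Suc j) t * trigS fs j t) absolutely_integrable_on {a..b}"
    using fs trig_factor_in[OF \<open>fs \<noteq> []\<close>] by (intro absolutely_integrable_mult_continuous Suc) blast
  then have "continuous_on {a..b} (primitive (\<lambda>t. trig_factor fs (Suc j) t * trigS fs j t))"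
    by (intro abs_cont_on_imp_continuous_on abs_cont_on_primitive ab)
  then show ?case
    by (rule continuous_on_eq) (simp add: trigS_Suc_aux[OF fs \<open>fs \<noteq> []\<close> ab Suc])
qed (simp add: trigS_def)

lemma trigS_Suc:
  assumes fs: "\<And>f. f \<in> set fs \<Longrightarrow> f absolutely_integrable_on {a..b}" and "fs \<noteq> []"
    and ab: "a \<le> 0" "0 \<le> b" and x: "x \<in> {a..b}"
  shows "trigS fs (Suc j) x = primitive (\<lambda>t. trig_factor fs (Suc j) t * trigS fs j t) x"
  by (rule trigS_Suc_aux[OF fs \<open>fs \<noteq> []\<close> ab continuous_on_trigS[OF fs \<open>fs \<noteq> []\<close> ab] x])


section \<open>The cyclic system of the trig functions\<close>

text \<open>Termwise integration of a geometrically dominated series.\<close>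

lemma primitive_suminf:
  fixes u :: "nat \<Rightarrow> real \<Rightarrow> complex"
  assumes u: "\<And>k. u k absolutely_integrable_on {a..b}" and B: "B integrable_on {a..b}"
    and le: "\<And>k t. t \<in> {a..b} \<Longrightarrow> norm (u k t) \<le> (1 / 2) ^ k * B t"
    and ab: "a \<le> 0" "0 \<le> b"
  shows "(\<lambda>t. \<Sum>k. u k t) absolutely_integrable_on {a..b}"
    and "x \<in> {a..b} \<Longrightarrow> (\<lambda>k. primitive (u k) x) sums primitive (\<lambda>t. \<Sum>k. u k t) x"
proof -
  have B_nonneg: "0 \<le> B t" if "t \<in> {a..b}" for t
    using order_trans[OF norm_ge_zero le[OF that, of 0]] by simp
  have *: "set_integrable lebesgue S (\<lambda>t. \<Sum>k. u k t)"
    "(\<lambda>k. integral S (u k)) sums integral S (\<lambda>t. \<Sum>k. u k t)"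
    if S: "S = {c..d}" "{c..d} \<subseteq> {a..b}" for S c d
  proof -
    define v where "v k t = indicator S t *\<^sub>R u k t" for k t
    have uS: "set_integrable lebesgue S (u k)" for k
      using set_integrable_subset[OF u] S by simp
    have v: "integrable lebesgue (v k)" for k
      using uS by (simp add: set_integrable_def v_def[abs_def])
    have v_le: "norm (v k t) \<le> (1 / 2) ^ k * (indicator S t * B t)" for k t
      using le[of t k] S by (auto simp: v_def indicator_def)
    have "B absolutely_integrable_on {a..b}"
      using absolutely_integrable_on_iff_nonneg[of "{a..b}" B] B B_nonneg by blast
    then have "set_integrable lebesgue S B"
      using set_integrable_subset S by (metis lmeasurable_cbox fmeasurableD cbox_interval)
    then have BS: "integrable lebesgue (\<lambda>t. indicator S t * B t)"
      by (simp add: set_integrable_def)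
    have geo: "summable (\<lambda>k. (1 / 2 :: real) ^ k * c)" for c
      by (intro summable_mult2 summable_geometric) simp
    have 1: "AE t in lebesgue. summable (\<lambda>k. norm (v k t))"
    proof (rule AE_I2)
      fix t show "summable (\<lambda>k. norm (v k t))"
        by (rule summable_comparison_test'[OF geo[of "indicator S t * B t"], of 0]) (simp add: v_le)
    qed
    have "(LINT t|lebesgue. norm (v k t)) \<le> (1 / 2) ^ k * (LINT t|lebesgue. indicator S t * B t)" for k
      by (subst integral_mult_right_zero[symmetric], intro integral_mono integrable_norm v
          Bochner_Integration.integrable_mult_right BS v_le)
    then have 2: "summable (\<lambda>k. LINT t|lebesgue. norm (v k t))"
      by (intro summable_comparison_test'[OF geo, of 0]) simp
    have sum_v: "(\<Sum>k. v k t) = indicator S t *\<^sub>R (\<Sum>k. u k t)" for t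
      by (simp add: v_def indicator_def)
    show int: "set_integrable lebesgue S (\<lambda>t. \<Sum>k. u k t)"
      using integrable_suminf[OF v 1 2] by (simp add: set_integrable_def sum_v)
    have "(\<lambda>k. integral\<^sup>L lebesgue (v k)) sums (LINT t|lebesgue. (\<Sum>k. v k t))"
      by (rule sums_integral[OF v 1 2])
    from this[unfolded sum_v, unfolded v_def[abs_def]]
    have "(\<lambda>k. LINT t:S|lebesgue. u k t) sums (LINT t:S|lebesgue. (\<Sum>k. u k t))"
      by (simp only: set_lebesgue_integral_def)
    then show "(\<lambda>k. integral S (u k)) sums integral S (\<lambda>t. \<Sum>k. u k t)"
      using set_lebesgue_integral_eq_integral(2)[OF uS] set_lebesgue_integral_eq_integral(2)[OF int] by simp
  qed
  show int: "(\<lambda>t. \<Sum>k. u k t) absolutely_integrable_on {a..b}"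
    using *(1)[of "{a..b}" a b] by simp
  show "(\<lambda>k. primitive (u k) x) sums primitive (\<lambda>t. \<Sum>k. u k t) x" if x: "x \<in> {a..b}"
  proof (cases "0 \<le> x")
    case True
    then show ?thesis
      using *(2)[of "{0..x}" 0 x] x ab
      by (simp add: primitive_eq_integral[OF u ab x] primitive_eq_integral[OF int ab x])
  next
    case False
    have "(\<lambda>k. integral {x..0} (u k)) sums integral {x..0} (\<lambda>t. \<Sum>k. u k t)"
      by (rule *(2)[OF refl]) (use x ab in auto)
    from sums_minus[OF this] show ?thesis
      using False by (simp add: primitive_eq_integral[OF u ab x] primitive_eq_integral[OF int ab x])
  qed
qed

lemma \<nu>_Suc_eq_iff:
  assumes "n \<noteq> 0" "j \<in> {1..n}"
  shows "\<nu> n (Suc k) = j \<longleftrightarrow> \<nu> n k = (if j = 1 then n else j - 1)"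
proof -
  have "k mod n \<noteq> n" using assms(1) by (metis less_irrefl mod_less_divisor neq0_conv)
  then show ?thesis using assms by (auto simp: \<nu>_def mod_Suc)
qed

lemma trigS_le:
  fixes fs :: "(real \<Rightarrow> complex) list"
  defines "\<kappa> \<equiv> \<lambda>t. \<Sum>i<length fs. norm ((fs ! i) t)"
  assumes fs: "\<And>f. f \<in> set fs \<Longrightarrow> f absolutely_integrable_on {a..b}" and "fs \<noteq> []"
    and ab: "a \<le> 0" "0 \<le> b" and x: "x \<in> {a..b}"
  shows "(\<lambda>t. complex_of_real (\<kappa> t)) absolutely_integrable_on {a..b}"
    and "norm (trigS fs k x) \<le> (1 / 2) ^ k * weight \<kappa> x"
proof -
  show \<kappa>: "(\<lambda>t. complex_of_real (\<kappa> t)) absolutely_integrable_on {a..b}"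
  proof -
    have "(\<lambda>t. complex_of_real (norm ((fs ! i) t))) absolutely_integrable_on {a..b}" if "i < length fs" for i
    proof -
      have "(\<lambda>t. norm ((fs ! i) t)) absolutely_integrable_on {a..b}"
        using absolutely_integrable_norm[OF fs[OF nth_mem[OF that]]] by (simp add: o_def)
      then have "(complex_of_real \<circ> (\<lambda>t. norm ((fs ! i) t))) absolutely_integrable_on {a..b}"
        by (rule absolutely_integrable_linear[OF _ bounded_linear_of_real])
      then show ?thesis by (simp add: o_def)
    qed
    then show ?thesis unfolding \<kappa>_def of_real_sum by (intro absolutely_integrable_sum) auto
  qed
  have le: "norm (trig_factor fs i t) \<le> \<kappa> t" for i t
    unfolding \<kappa>_def using \<nu>_in[of "length fs" i] \<open>fs \<noteq> []\<close>
    by (intro member_le_sum[of _ "{..<length fs}" "\<lambda>i. norm ((fs ! i) t)"]) auto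
  show "norm (trigS fs k x) \<le> (1 / 2) ^ k * weight \<kappa> x"
    using x
  proof (induction k arbitrary: x)
    case 0
    then show ?case by (simp add: weight_ge_1)
  next
    case (Suc k)
    have "norm (primitive (\<lambda>t. trig_factor fs (Suc k) t * trigS fs k t) x) \<le> (1 / 2) ^ k / 2 * weight \<kappa> x"
    proof (rule norm_primitive_le_weight[OF \<kappa> ab _ _ _ _ Suc.prems])
      show "(\<lambda>t. trig_factor fs (Suc k) t * trigS fs k t) absolutely_integrable_on {a..b}"
        using fs trig_factor_in[OF \<open>fs \<noteq> []\<close>]
        by (intro absolutely_integrable_mult_continuous continuous_on_trigS[OF fs \<open>fs \<noteq> []\<close> ab]) blast+
      fix t assume t: "t \<in> {a..b}"
      have "norm (trig_factor fs (Suc k) t * trigS fs k t) \<le> \<kappa> t * ((1 / 2) ^ k * weight \<kappa> t)"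
        unfolding norm_mult using Suc.IH[OF t] le[of "Suc k" t]
        by (intro mult_mono) (auto intro: order_trans[OF norm_ge_zero])
      then show "norm (trig_factor fs (Suc k) t * trigS fs k t) \<le> (1 / 2) ^ k * (\<kappa> t * weight \<kappa> t)"
        by (simp add: algebra_simps)
    qed (auto simp: \<kappa>_def sum_nonneg)
    then show ?case
      by (simp add: trigS_Suc[OF fs \<open>fs \<noteq> []\<close> ab Suc.prems])
  qed
qed

text \<open>
  The cyclic first order system solved by the trig functions, in integrated form:
  \<open>T\<^sub>j' = f\<^sub>j T\<^sub>j\<^sub>-\<^sub>1\<close> with \<open>T\<^sub>0\<close> read as \<open>T\<^sub>n\<close>, and \<open>T\<^sub>n(0) = 1\<close>, \<open>T\<^sub>j(0) = 0\<close> for \<open>j < n\<close>.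
\<close>

lemma trigT_eq_primitive:
  fixes fs :: "(real \<Rightarrow> complex) list"
  defines "n \<equiv> length fs"
  assumes fs: "\<And>f. f \<in> set fs \<Longrightarrow> f absolutely_integrable_on {a..b}"
    and ab: "a \<le> 0" "0 \<le> b" and j: "j \<in> {1..n}"
  defines "p \<equiv> (if j = 1 then n else j - 1)"
  shows "(\<lambda>t. (fs ! (j - 1)) t * trigT fs p t) absolutely_integrable_on {a..b}"
    and "x \<in> {a..b} \<Longrightarrow>
      trigT fs j x = of_bool (j = n) + primitive (\<lambda>t. (fs ! (j - 1)) t * trigT fs p t) x"
proof -
  have ne: "fs \<noteq> []" using j by (auto simp: n_def)
  define \<kappa> where "\<kappa> t = (\<Sum>i<length fs. norm ((fs ! i) t))" for t
  \<comment> \<open>\<open>T\<^sub>i\<close> as a series over all \<open>k\<close>, of which only every \<open>n\<close>-th term is kept.\<close>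
  define c where "c i k x = (if \<nu> n k = i then trigS fs k x else 0)" for i k x
  have \<kappa>: "(\<lambda>t. complex_of_real (\<kappa> t)) absolutely_integrable_on {a..b}"
    unfolding \<kappa>_def using ab by (intro trigS_le(1)[OF fs ne, where x = 0]) auto
  have bound: "norm (trigS fs k t) \<le> (1 / 2) ^ k * weight \<kappa> t" if "t \<in> {a..b}" for k t
    unfolding \<kappa>_def[abs_def] by (rule trigS_le(2)[OF fs ne ab that])
  have c_le: "norm (c i k t) \<le> (1 / 2) ^ k * weight \<kappa> t" if "t \<in> {a..b}" for i k t
    using bound[OF that, of k] weight_pos[of \<kappa> t] by (auto simp: c_def)
  have geo: "summable (\<lambda>k. (1 / 2 :: real) ^ k * w)" for w
    by (intro summable_mult2 summable_geometric) simp
  have c_summable: "summable (\<lambda>k. norm (c i k t))" if "t \<in> {a..b}" for i t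
    using c_le[OF that] by (intro summable_comparison_test'[OF geo, of 0]) simp
  have c_summable': "summable (\<lambda>k. c i k t)" if "t \<in> {a..b}" for i t
    by (rule summable_norm_cancel[OF c_summable[OF that]])
  have T: "trigT fs i t = (\<Sum>k. c i k t)" if "t \<in> {a..b}" for i t
  proof -
    have "((\<lambda>k. c i k t) has_sum (\<Sum>k. c i k t)) UNIV"
      by (intro norm_summable_imp_has_sum c_summable c_summable' that summable_sums)
    then have "infsum (\<lambda>k. c i k t) UNIV = (\<Sum>k. c i k t)" by (rule infsumI)
    moreover have "infsum (\<lambda>k. c i k t) UNIV = trigT fs i t"
      unfolding trigT_def by (rule infsum_cong_neutral) (auto simp: c_def n_def)
    ultimately show ?thesis by simp
  qed
  have fj: "(fs ! (j - 1)) absolutely_integrable_on {a..b}"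
    using j by (intro fs nth_mem) (auto simp: n_def)
  define u where "u k t = (fs ! (j - 1)) t * c p k t" for k t
  have u_int: "u k absolutely_integrable_on {a..b}" for k
    unfolding u_def[abs_def] c_def
    by (intro absolutely_integrable_mult_continuous fj, cases "\<nu> n k = p")
      (simp_all add: continuous_on_trigS[OF fs ne ab])
  have fj_le: "norm ((fs ! (j - 1)) t) \<le> \<kappa> t" for t
    unfolding \<kappa>_def using j
    by (intro member_le_sum[of _ "{..<length fs}" "\<lambda>i. norm ((fs ! i) t)"]) (auto simp: n_def)
  have u_le: "norm (u k t) \<le> (1 / 2) ^ k * (\<kappa> t * weight \<kappa> t)" if "t \<in> {a..b}" for k t
  proof -
    have "norm (u k t) \<le> \<kappa> t * ((1 / 2) ^ k * weight \<kappa> t)"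
      unfolding u_def norm_mult using fj_le[of t] c_le[OF that, of p k]
      by (intro mult_mono) (auto intro: order_trans[OF norm_ge_zero])
    then show ?thesis by (simp add: algebra_simps)
  qed
  have \<kappa>W: "(\<lambda>t. \<kappa> t * weight \<kappa> t) integrable_on {a..b}"
  proof -
    have "(\<lambda>t. complex_of_real (\<kappa> t) * complex_of_real (weight \<kappa> t)) absolutely_integrable_on {a..b}"
      by (intro absolutely_integrable_mult_continuous \<kappa> continuous_on_of_real continuous_on_weight ab)
    then have "(Re \<circ> (\<lambda>t. complex_of_real (\<kappa> t) * complex_of_real (weight \<kappa> t))) integrable_on {a..b}"
      by (intro integrable_linear[OF _ bounded_linear_Re]) (simp add: absolutely_integrable_on_def)
    then show ?thesis by (simp add: o_def)
  qed
  have sum_u: "(\<Sum>k. u k t) = (fs ! (j - 1)) t * trigT fs p t" if "t \<in> {a..b}" for t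
    unfolding u_def T[OF that] by (rule suminf_mult[OF c_summable'[OF that]])
  have ps: "(\<lambda>t. \<Sum>k. u k t) absolutely_integrable_on {a..b}"
    "x \<in> {a..b} \<Longrightarrow> (\<lambda>k. primitive (u k) x) sums primitive (\<lambda>t. \<Sum>k. u k t) x"
    using primitive_suminf[where u = u and B = "\<lambda>t. \<kappa> t * weight \<kappa> t", OF u_int \<kappa>W _ ab] u_le
    by blast+
  show int: "(\<lambda>t. (fs ! (j - 1)) t * trigT fs p t) absolutely_integrable_on {a..b}"
    by (rule absolutely_integrable_spike[OF ps(1) negligible_empty]) (simp_all add: sum_u)
  show "trigT fs j x = of_bool (j = n) + primitive (\<lambda>t. (fs ! (j - 1)) t * trigT fs p t) x"
    if x: "x \<in> {a..b}"
  proof -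
    have c_Suc: "c j (Suc k) x = primitive (u k) x" for k
    proof (cases "\<nu> n (Suc k) = j")
      case True
      then have "\<nu> n k = p" using \<nu>_Suc_eq_iff[of n j k] j ne by (simp add: p_def n_def)
      then have "u k = (\<lambda>t. trig_factor fs (Suc k) t * trigS fs k t)"
        using True by (auto simp: u_def c_def n_def)
      then show ?thesis using True by (simp add: c_def trigS_Suc[OF fs ne ab x])
    next
      case False
      then have "\<nu> n k \<noteq> p" using \<nu>_Suc_eq_iff[of n j k] j ne by (simp add: p_def n_def)
      then have "u k = (\<lambda>t. 0)" by (auto simp: u_def c_def)
      then show ?thesis using False
        by (simp add: c_def primitive_def interval_lebesgue_integral_def)
    qed
    have "trigT fs j x = c j 0 x + (\<Sum>k. c j (Suc k) x)"
      unfolding T[OF x] by (subst suminf_split_head[OF c_summable'[OF x]]) simp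
    also have "(\<Sum>k. c j (Suc k) x) = primitive (\<lambda>t. \<Sum>k. u k t) x"
      unfolding c_Suc using ps(2)[OF x] by (rule sums_unique[symmetric])
    also have "\<dots> = primitive (\<lambda>t. (fs ! (j - 1)) t * trigT fs p t) x"
    proof -
      have "integral {s..t} (\<lambda>t. \<Sum>k. u k t) = integral {s..t} (\<lambda>t. (fs ! (j - 1)) t * trigT fs p t)"
        if "{s..t} \<subseteq> {a..b}" for s t
        using that by (intro integral_cong sum_u) auto
      then show ?thesis
        unfolding primitive_eq_integral[OF ps(1) ab x] primitive_eq_integral[OF int ab x] using x ab by auto
    qed
    also have "c j 0 x = of_bool (j = n)"
      by (auto simp: c_def \<nu>_def)
    finally show ?thesis .
  qed
qed


section \<open>Local integrability and absolute continuity on open intervals\<close>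

text \<open>Local integrability on an interval: integrability on its compact subintervals.\<close>

definition loc_integrable_on :: "real set \<Rightarrow> (real \<Rightarrow> complex) \<Rightarrow> bool" where
  "loc_integrable_on I f \<longleftrightarrow> (\<forall>a b. {a..b} \<subseteq> I \<longrightarrow> f absolutely_integrable_on {a..b})"

text \<open>Open intervals, bounded or not, around the base point \<open>0\<close> of the primitives.\<close>

definition zero_interval :: "real set \<Rightarrow> bool" where
  "zero_interval I \<longleftrightarrow> open I \<and> is_interval I \<and> 0 \<in> I"

lemma zero_interval_enlarge:
  assumes "zero_interval I" "{a..b} \<subseteq> I" "a \<le> b"
  shows "{min a 0..max b 0} \<subseteq> I"
proof
  fix x assume x: "x \<in> {min a 0..max b 0}"
  have "min a 0 \<in> I" "max b 0 \<in> I" using assms by (auto simp: zero_interval_def min_def max_def)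
  then show "x \<in> I" using x assms(1) mem_is_interval_1_I[of I "min a 0" "max b 0" x]
    unfolding zero_interval_def atLeastAtMost_iff by blast
qed

lemma zero_interval_nbhd:
  assumes "zero_interval I" "x \<in> I"
  obtains a b where "{a..b} \<subseteq> I" "a \<le> 0" "0 \<le> b" "x \<in> {a<..<b}"
proof -
  obtain e where e: "e > 0" "cball x e \<subseteq> I"
    using assms open_contains_cball unfolding zero_interval_def by blast
  have "{min (x - e) 0..max (x + e) 0} \<subseteq> I"
    using e by (intro zero_interval_enlarge[OF assms(1)]) (auto simp: cball_eq_atLeastAtMost)
  moreover have "x \<in> {min (x - e) 0<..<max (x + e) 0}" using e by auto
  ultimately show ?thesis using that[of "min (x - e) 0" "max (x + e) 0"] by simp
qed

lemma zero_interval_segment: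
  assumes "zero_interval I" "x \<in> I"
  shows "{min 0 x..max 0 x} \<subseteq> I"
  using zero_interval_enlarge[OF assms(1), of x x] assms(2) by (simp add: min.commute max.commute)

lemma loc_integrable_on_continuous: "continuous_on I f \<Longrightarrow> loc_integrable_on I f"
  unfolding loc_integrable_on_def
  using absolutely_integrable_continuous_real continuous_on_subset by blast

lemma loc_integrable_on_mult:
  "loc_integrable_on I f \<Longrightarrow> continuous_on I g \<Longrightarrow> loc_integrable_on I (\<lambda>x. f x * g x)"
  unfolding loc_integrable_on_def
  using absolutely_integrable_mult_continuous continuous_on_subset by blast

lemma loc_integrable_on_add:
  "loc_integrable_on I f \<Longrightarrow> loc_integrable_on I g \<Longrightarrow> loc_integrable_on I (\<lambda>x. f x + g x)"
  unfolding loc_integrable_on_def by (intro allI impI set_integral_add(1)) auto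

lemma loc_abs_cont_on_const: "loc_abs_cont_on I (\<lambda>x. c)"
  by (simp add: loc_abs_cont_on_def abs_cont_on_const)

lemma loc_abs_cont_on_add:
  "loc_abs_cont_on I f \<Longrightarrow> loc_abs_cont_on I g \<Longrightarrow> loc_abs_cont_on I (\<lambda>x. f x + g x)"
  by (simp add: loc_abs_cont_on_def abs_cont_on_add)

lemma loc_abs_cont_on_mult:
  "loc_abs_cont_on I f \<Longrightarrow> loc_abs_cont_on I g \<Longrightarrow> loc_abs_cont_on I (\<lambda>x. f x * g x)"
  by (simp add: loc_abs_cont_on_def abs_cont_on_mult)

lemma loc_abs_cont_on_diff:
  assumes "loc_abs_cont_on I f" "loc_abs_cont_on I g"
  shows "loc_abs_cont_on I (\<lambda>x. f x - g x)"
  using loc_abs_cont_on_add[OF assms(1) loc_abs_cont_on_mult[OF loc_abs_cont_on_const[of I "-1"] assms(2)]]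
  by simp

lemma loc_abs_cont_on_inverse:
  "loc_abs_cont_on I f \<Longrightarrow> (\<And>x. x \<in> I \<Longrightarrow> f x \<noteq> 0) \<Longrightarrow> loc_abs_cont_on I (\<lambda>x. inverse (f x))"
  by (auto simp: loc_abs_cont_on_def subset_iff intro!: abs_cont_on_inverse)

lemma loc_abs_cont_on_exp: "loc_abs_cont_on I f \<Longrightarrow> loc_abs_cont_on I (\<lambda>x. exp (f x))"
  by (simp add: loc_abs_cont_on_def abs_cont_on_exp)

lemma loc_abs_cont_on_cong:
  "(\<And>x. x \<in> I \<Longrightarrow> f x = g x) \<Longrightarrow> loc_abs_cont_on I f \<Longrightarrow> loc_abs_cont_on I g"
  unfolding loc_abs_cont_on_def using abs_cont_on_cong by (metis subsetD)

lemma loc_abs_cont_on_imp_continuous_on: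
  assumes f: "loc_abs_cont_on I f" and "open I"
  shows "continuous_on I f"
proof -
  have "isCont f x" if "x \<in> I" for x
  proof -
    obtain e where e: "e > 0" "cball x e \<subseteq> I"
      using \<open>open I\<close> \<open>x \<in> I\<close> open_contains_cball by blast
    then have "abs_cont_on {x - e..x + e} f"
      using f by (simp add: loc_abs_cont_on_def cball_eq_atLeastAtMost)
    then have "continuous_on {x - e..x + e} f" by (rule abs_cont_on_imp_continuous_on)
    then show ?thesis by (rule continuous_on_interior) (use e in simp)
  qed
  then show ?thesis by (simp add: continuous_at_imp_continuous_on)
qed

lemma loc_abs_cont_on_primitive:
  assumes I: "zero_interval I" and f: "loc_integrable_on I f"
  shows "loc_abs_cont_on I (primitive f)"
  unfolding loc_abs_cont_on_def
proof (intro allI impI)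
  fix a b assume ab: "{a..b} \<subseteq> I"
  show "abs_cont_on {a..b} (primitive f)"
  proof (cases "a \<le> b")
    case True
    have "f absolutely_integrable_on {min a 0..max b 0}"
      using f zero_interval_enlarge[OF I ab True] by (simp add: loc_integrable_on_def)
    then have "abs_cont_on {min a 0..max b 0} (primitive f)"
      by (rule abs_cont_on_primitive) auto
    then show ?thesis by (rule abs_cont_on_subset) auto
  next
    case False
    have "abs_cont_on {a..b} (\<lambda>x. 0)" by (rule abs_cont_on_const)
    then show ?thesis by (rule abs_cont_on_cong[rotated]) (use False in auto)
  qed
qed

text \<open>Countably many compact intervals, with rational end points, reduce this to the compact case.\<close>

lemma primitive_has_vector_derivative_AE:
  assumes I: "zero_interval I" and f: "loc_integrable_on I f"
  shows "AE x in lebesgue. x \<in> I \<longrightarrow> (primitive f has_vector_derivative f x) (at x)"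
proof -
  define Q where "Q = {pq :: real \<times> real. fst pq \<in> \<rat> \<and> snd pq \<in> \<rat> \<and> fst pq < snd pq \<and> {fst pq..snd pq} \<subseteq> I}"
  have "Q \<subseteq> \<rat> \<times> \<rat>" by (auto simp: Q_def)
  then have "countable Q" using countable_rat by (meson countable_SIGMA countable_subset)
  have "\<exists>N. negligible N \<and> (\<forall>x \<in> {fst pq<..<snd pq} - N. (primitive f has_vector_derivative f x) (at x))"
    if "pq \<in> Q" for pq
  proof -
    have *: "{min (fst pq) 0..max (snd pq) 0} \<subseteq> I"
      using that by (intro zero_interval_enlarge[OF I]) (auto simp: Q_def)
    then have "f absolutely_integrable_on {min (fst pq) 0..max (snd pq) 0}"
      using f by (simp add: loc_integrable_on_def)
    then obtain N where "negligible N" "\<And>x. x \<in> {min (fst pq) 0<..<max (snd pq) 0} - N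
        \<Longrightarrow> (primitive f has_vector_derivative f x) (at x)"
      by (rule primitive_has_vector_derivative_ae) auto
    moreover have "{fst pq<..<snd pq} \<subseteq> {min (fst pq) 0<..<max (snd pq) 0}" by auto
    ultimately show ?thesis by blast
  qed
  then obtain N where N: "\<And>pq. pq \<in> Q \<Longrightarrow> negligible (N pq)"
    "\<And>pq x. pq \<in> Q \<Longrightarrow> x \<in> {fst pq<..<snd pq} - N pq \<Longrightarrow> (primitive f has_vector_derivative f x) (at x)"
    by metis
  have "negligible (\<Union>(N ` Q))"
    using N(1) \<open>countable Q\<close> by (intro negligible_countable_Union) auto
  then have "\<Union>(N ` Q) \<in> null_sets lebesgue" by (simp add: negligible_iff_null_sets)
  then show ?thesis
  proof (rule AE_I', intro subsetI)
    fix x assume x: "x \<in> {x \<in> space lebesgue. \<not> (x \<in> I \<longrightarrow> (primitive f has_vector_derivative f x) (at x))}"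
    then have "x \<in> I" by blast
    then obtain e where e: "e > 0" "cball x e \<subseteq> I"
      using I open_contains_cball unfolding zero_interval_def by blast
    obtain p q where pq: "p \<in> \<rat>" "x - e < p" "p < x" "q \<in> \<rat>" "x < q" "q < x + e"
      using Rats_dense_in_real[of "x - e" x] Rats_dense_in_real[of x "x + e"] \<open>e > 0\<close> by auto
    have "(p, q) \<in> Q" using pq e by (force simp: Q_def cball_eq_atLeastAtMost)
    with N(2)[OF this] x pq show "x \<in> \<Union>(N ` Q)" by force
  qed
qed

lemma primitive_has_vector_derivative_on:
  assumes I: "zero_interval I" and f: "continuous_on I f" and "x \<in> I"
  shows "(primitive f has_vector_derivative f x) (at x)"
proof -
  obtain a b where "{a..b} \<subseteq> I" "a \<le> 0" "0 \<le> b" "x \<in> {a<..<b}"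
    by (rule zero_interval_nbhd[OF I \<open>x \<in> I\<close>])
  then show ?thesis using f continuous_on_subset primitive_has_vector_derivative by blast
qed

text \<open>The cyclic first order system, in differential form, on an open interval around \<open>0\<close>.\<close>

lemma
  fixes fs :: "(real \<Rightarrow> complex) list"
  assumes I: "zero_interval I" and fs: "\<And>f. f \<in> set fs \<Longrightarrow> loc_integrable_on I f"
    and j: "j \<in> {1..length fs}" and p: "p = (if j = 1 then length fs else j - 1)"
  shows loc_abs_cont_on_trigT: "loc_abs_cont_on I (trigT fs j)"
    and trigT_at_0: "trigT fs j 0 = of_bool (j = length fs)"
    and trigT_has_vector_derivative_AE: "AE x in lebesgue. x \<in> I \<longrightarrow>
      (trigT fs j has_vector_derivative (fs ! (j - 1)) x * trigT fs p x) (at x)"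
    and trigT_has_vector_derivative: "\<And>x. continuous_on I (fs ! (j - 1)) \<Longrightarrow> x \<in> I \<Longrightarrow>
      (trigT fs j has_vector_derivative (fs ! (j - 1)) x * trigT fs p x) (at x)"
proof -
  have ac: "loc_abs_cont_on I (trigT fs j) \<and> loc_integrable_on I (\<lambda>t. (fs ! (j - 1)) t * trigT fs p t)
      \<and> (\<forall>x\<in>I. trigT fs j x = of_bool (j = length fs) + primitive (\<lambda>t. (fs ! (j - 1)) t * trigT fs p t) x)"
    if j: "j \<in> {1..length fs}" and p: "p = (if j = 1 then length fs else j - 1)" for j p
  proof -
    let ?g = "\<lambda>t. (fs ! (j - 1)) t * trigT fs p t"
    have *: "?g absolutely_integrable_on {a..b}"
      "x \<in> {a..b} \<Longrightarrow> trigT fs j x = of_bool (j = length fs) + primitive ?g x"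
      if "{a..b} \<subseteq> I" "a \<le> 0" "0 \<le> b" for a b x
      using trigT_eq_primitive[OF _ that(2,3) j] fs that(1) unfolding p loc_integrable_on_def by blast+
    have 1: "loc_integrable_on I ?g"
      unfolding loc_integrable_on_def
    proof (intro allI impI)
      fix a b assume ab: "{a..b} \<subseteq> I"
      show "?g absolutely_integrable_on {a..b}"
      proof (cases "a \<le> b")
        case True
        have "?g absolutely_integrable_on {min a 0..max b 0}"
          by (rule *(1)[OF zero_interval_enlarge[OF I ab True]]) auto
        then show ?thesis by (rule set_integrable_subset) auto
      qed (simp add: set_integrable_def)
    qed
    have 2: "\<forall>x\<in>I. trigT fs j x = of_bool (j = length fs) + primitive ?g x"
    proof
      fix x assume "x \<in> I"
      show "trigT fs j x = of_bool (j = length fs) + primitive ?g x"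
        by (rule *(2)[OF zero_interval_segment[OF I \<open>x \<in> I\<close>]]) auto
    qed
    have "loc_abs_cont_on I (\<lambda>x. of_bool (j = length fs) + primitive ?g x)"
      by (intro loc_abs_cont_on_add loc_abs_cont_on_const loc_abs_cont_on_primitive I 1)
    then have "loc_abs_cont_on I (trigT fs j)" by (rule loc_abs_cont_on_cong[rotated]) (simp add: 2)
    with 1 2 show ?thesis by blast
  qed
  let ?g = "\<lambda>t. (fs ! (j - 1)) t * trigT fs p t"
  note J = ac[OF j p]
  then show "loc_abs_cont_on I (trigT fs j)" by blast
  have "0 \<in> I" "open I" using I by (auto simp: zero_interval_def)
  then show "trigT fs j 0 = of_bool (j = length fs)" using J by simp
  have der: "(trigT fs j has_vector_derivative ?g x) (at x)"
    if "x \<in> I" "(primitive ?g has_vector_derivative ?g x) (at x)" for x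
  proof -
    have "((\<lambda>x. of_bool (j = length fs) + primitive ?g x) has_vector_derivative 0 + ?g x) (at x)"
      by (intro has_vector_derivative_add has_vector_derivative_const that)
    then have "((\<lambda>x. of_bool (j = length fs) + primitive ?g x) has_vector_derivative ?g x) (at x)" by simp
    then show ?thesis
      by (rule has_vector_derivative_transform_within_open[OF _ \<open>open I\<close> \<open>x \<in> I\<close>]) (use J in simp)
  qed
  have "AE x in lebesgue. x \<in> I \<longrightarrow> (primitive ?g has_vector_derivative ?g x) (at x)"
    using primitive_has_vector_derivative_AE[OF I] J by blast
  then show "AE x in lebesgue. x \<in> I \<longrightarrow> (trigT fs j has_vector_derivative ?g x) (at x)"
    by eventually_elim (use der in blast)
  fix x assume cont: "continuous_on I (fs ! (j - 1))" and x: "x \<in> I"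
  have "p \<in> {1..length fs}" using j p by auto
  then have "continuous_on I (trigT fs p)"
    using ac[OF _ refl] loc_abs_cont_on_imp_continuous_on \<open>open I\<close> by blast
  then have "continuous_on I ?g" using cont by (intro continuous_intros)
  then show "(trigT fs j has_vector_derivative ?g x) (at x)"
    by (intro der x primitive_has_vector_derivative_on[OF I])
qed

section \<open>Uniqueness and general solutions\<close>

text \<open>
  Uniqueness for the companion system of the equation: with \<open>\<kappa> = 1 + \<Sum>\<bar>a\<^sub>i\<bar>\<close>, the bound \<open>M\<close> of a
  solution with zero initial values in the weighted supremum norm improves to \<open>M/2\<close>, indefinitely.
\<close>

lemma companion_system_zero:
  fixes as :: "(real \<Rightarrow> complex) list" and u :: "nat \<Rightarrow> real \<Rightarrow> complex"
  defines "n \<equiv> length as"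
  assumes I: "zero_interval I" and as: "\<And>f. f \<in> set as \<Longrightarrow> loc_integrable_on I f" and "as \<noteq> []"
    and der: "\<And>k x. k < n - 1 \<Longrightarrow> x \<in> I \<Longrightarrow> (u k has_vector_derivative u (Suc k) x) (at x)"
    and ac: "loc_abs_cont_on I (u (n - 1))"
    and der_AE: "AE x in lebesgue. x \<in> I \<longrightarrow>
      (u (n - 1) has_vector_derivative (\<Sum>i<n. (as ! i) x * u (n - 1 - i) x)) (at x)"
    and init: "\<And>k. k < n \<Longrightarrow> u k 0 = 0"
    and x: "x \<in> I" and k: "k < n"
  shows "u k x = 0"
proof -
  define a b where "a = min 0 x" and "b = max 0 x"
  have ab: "a \<le> 0" "0 \<le> b" "a \<le> b" "x \<in> {a..b}" by (auto simp: a_def b_def)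
  have sub: "{a..b} \<subseteq> I" unfolding a_def b_def by (rule zero_interval_segment[OF I x])
  have "n > 0" using \<open>as \<noteq> []\<close> by (simp add: n_def)
  have as_int: "f absolutely_integrable_on {a..b}" if "f \<in> set as" for f
    using as[OF that] sub by (simp add: loc_integrable_on_def)
  have "open I" using I by (simp add: zero_interval_def)
  have cont: "continuous_on {a..b} (u k)" if "k < n" for k
  proof (cases "k < n - 1")
    case True
    then have "continuous (at t) (u k)" if "t \<in> {a..b}" for t
      using der that sub has_vector_derivative_continuous by blast
    then show ?thesis by (simp add: continuous_at_imp_continuous_on)
  next
    case False
    then have "k = n - 1" using that by simp
    then show ?thesis
      using loc_abs_cont_on_imp_continuous_on[OF ac \<open>open I\<close>] sub continuous_on_subset by blast
  qed
  \<comment> \<open>The right hand sides of the companion system.\<close>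
  define v where "v k t = (if k < n - 1 then u (Suc k) t else \<Sum>i<n. (as ! i) t * u (n - 1 - i) t)" for k t
  have v_int: "v k absolutely_integrable_on {a..b}" for k
  proof (cases "k < n - 1")
    case True
    then show ?thesis
      unfolding v_def[abs_def] by (simp add: absolutely_integrable_continuous_real cont)
  next
    case False
    have "(\<lambda>t. \<Sum>i<n. (as ! i) t * u (n - 1 - i) t) absolutely_integrable_on {a..b}"
      using \<open>n > 0\<close>
      by (intro absolutely_integrable_sum absolutely_integrable_mult_continuous as_int cont)
        (auto simp: n_def)
    then show ?thesis using False unfolding v_def[abs_def] by simp
  qed
  obtain N where N: "negligible N" "\<And>t. t \<in> I - N \<Longrightarrow> (u (n - 1) has_vector_derivative v (n - 1) t) (at t)"
  proof -
    obtain N where "N \<in> null_sets lebesgue" "{x \<in> space lebesgue. \<not> (x \<in> I \<longrightarrow>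
        (u (n - 1) has_vector_derivative (\<Sum>i<n. (as ! i) x * u (n - 1 - i) x)) (at x))} \<subseteq> N"
      using der_AE by (auto simp: eventually_ae_filter)
    then show ?thesis using that[of N] by (auto simp: negligible_iff_null_sets v_def)
  qed
  have integ: "(v k has_integral u k d - u k c) {c..d}" if "k < n" "{c..d} \<subseteq> {a..b}" "c \<le> d" for k c d
  proof (cases "k < n - 1")
    case True
    show ?thesis
    proof (rule fundamental_theorem_of_calculus[OF \<open>c \<le> d\<close>])
      fix t assume "t \<in> {c..d}"
      then have "t \<in> I" using sub that(2) by blast
      with der[OF True] True have "(u k has_vector_derivative v k t) (at t)" by (simp add: v_def)
      then show "(u k has_vector_derivative v k t) (at t within {c..d})"
        by (rule has_vector_derivative_at_within)
    qed
  next
    case False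
    then have k: "k = n - 1" using that by simp
    show ?thesis
      unfolding k
    proof (rule abs_cont_on_has_integral[OF _ \<open>c \<le> d\<close> N(1)])
      show "abs_cont_on {c..d} (u (n - 1))"
        using ac order_trans[OF that(2) sub] unfolding loc_abs_cont_on_def by blast
      show "(u (n - 1) has_vector_derivative v (n - 1) t) (at t within {c..d})" if "t \<in> {c..d} - N" for t
      proof (rule has_vector_derivative_at_within, rule N(2))
        show "t \<in> I - N" using that \<open>{c..d} \<subseteq> {a..b}\<close> sub by blast
      qed
    qed
  qed
  have u_prim: "u k t = primitive (v k) t" if "k < n" "t \<in> {a..b}" for k t
    unfolding primitive_eq_integral[OF v_int ab(1,2) that(2)]
    using integral_unique[OF integ[OF that(1), of 0 t]] integral_unique[OF integ[OF that(1), of t 0]]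
      that(2) ab init[OF that(1)] by auto
  define \<kappa> where "\<kappa> t = 1 + (\<Sum>i<length as. norm ((as ! i) t))" for t
  have \<kappa>: "(\<lambda>t. complex_of_real (\<kappa> t)) absolutely_integrable_on {a..b}"
    unfolding \<kappa>_def of_real_add
    by (intro set_integral_add(1) trigS_le(1)[OF as_int \<open>as \<noteq> []\<close> ab(1,2,4)]
        absolutely_integrable_continuous_real continuous_on_const)
  have "\<exists>M. \<forall>t\<in>{a..b}. (\<Sum>k<n. norm (u k t)) \<le> M"
  proof -
    have "continuous_on {a..b} (\<lambda>t. \<Sum>k<n. norm (u k t))" by (intro continuous_intros cont) auto
    then have "bounded ((\<lambda>t. \<Sum>k<n. norm (u k t)) ` {a..b})"
      using compact_continuous_image compact_imp_bounded by blast
    then show ?thesis unfolding bounded_iff by (auto simp: sum_nonneg)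
  qed
  then obtain M where M: "\<And>t. t \<in> {a..b} \<Longrightarrow> (\<Sum>k<n. norm (u k t)) \<le> M" by blast
  have "0 \<le> M" using M[OF ab(4)] by (meson order_trans norm_ge_zero sum_nonneg)
  have bound: "norm (u k t) \<le> M * (1 / 2) ^ m * weight \<kappa> t" if "k < n" "t \<in> {a..b}" for k t m
    using that
  proof (induction m arbitrary: k t)
    case 0
    have "norm (u k t) \<le> (\<Sum>k<n. norm (u k t))"
      using 0 by (intro member_le_sum) auto
    also have "\<dots> \<le> M * weight \<kappa> t"
      using M[OF 0(2)] mult_left_mono[OF weight_ge_1 \<open>0 \<le> M\<close>, of \<kappa> t] by simp
    finally show ?case by simp
  next
    case (Suc m)
    let ?M = "M * (1 / 2) ^ m"
    have "norm (primitive (v k) t) \<le> ?M / 2 * weight \<kappa> t"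
    proof (rule norm_primitive_le_weight[OF \<kappa> ab(1,2) _ v_int _ _ Suc.prems(2)])
      show "0 \<le> \<kappa> t" for t by (simp add: \<kappa>_def sum_nonneg)
      show "0 \<le> ?M" using \<open>0 \<le> M\<close> by simp
      fix t assume t: "t \<in> {a..b}"
      let ?w = "?M * weight \<kappa> t"
      have w: "0 \<le> ?w" using \<open>0 \<le> M\<close> weight_pos[of \<kappa> t] by simp
      have "norm (v k t) \<le> \<kappa> t * ?w"
      proof (cases "k < n - 1")
        case True
        then have "norm (v k t) \<le> 1 * ?w" using Suc.IH[of "Suc k", OF _ t] by (simp add: v_def)
        also have "\<dots> \<le> \<kappa> t * ?w" by (intro mult_right_mono w) (simp add: \<kappa>_def sum_nonneg)
        finally show ?thesis .
      next
        case False
        have "norm (v k t) \<le> (\<Sum>i<n. norm ((as ! i) t) * ?w)"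
          using False \<open>n > 0\<close> unfolding v_def
          by (auto intro!: sum_norm_le mult_left_mono Suc.IH t simp: norm_mult)
        also have "\<dots> \<le> \<kappa> t * ?w"
          unfolding sum_distrib_right[symmetric] by (intro mult_right_mono w) (simp add: \<kappa>_def n_def)
        finally show ?thesis .
      qed
      then show "norm (v k t) \<le> ?M * (\<kappa> t * weight \<kappa> t)" by (simp add: algebra_simps)
    qed
    then show ?case by (simp add: u_prim[OF Suc.prems])
  qed
  have "(\<lambda>m. M * (1 / 2) ^ m * weight \<kappa> x) \<longlonglongrightarrow> M * 0 * weight \<kappa> x"
    by (intro tendsto_intros LIMSEQ_power_zero) simp
  then have "norm (u k x) \<le> M * 0 * weight \<kappa> x"
    by (rule LIMSEQ_le_const) (use bound[OF k ab(4)] in blast)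
  then show ?thesis by simp
qed

lemma D_Suc: "D (Suc k) y x = vector_derivative (D k y) (at x)" and D_0 [simp]: "D 0 y = y"
  by (simp_all add: D_def)

lemma D_eq_chain:
  assumes "open I" and y: "\<And>x. x \<in> I \<Longrightarrow> y x = g 0 x"
    and der: "\<And>k x. k < m \<Longrightarrow> x \<in> I \<Longrightarrow> (g k has_vector_derivative g (Suc k) x) (at x)"
    and "k \<le> m" "x \<in> I"
  shows "D k y x = g k x"
  using \<open>k \<le> m\<close> \<open>x \<in> I\<close>
proof (induction k arbitrary: x)
  case (Suc k)
  have "(D k y has_vector_derivative g (Suc k) x) (at x)"
    by (rule has_vector_derivative_transform_within_open[OF der \<open>open I\<close>]) (use Suc in auto)
  then show ?case by (simp add: D_Suc vector_derivative_at)
qed (simp add: y)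

text \<open>
  A solution is recognised from a chain of functions \<open>g 0, \<dots>, g (n - 1)\<close>, each the derivative of
  the previous one.
\<close>

lemma ode_solution_onI:
  fixes g :: "nat \<Rightarrow> real \<Rightarrow> complex"
  assumes "open I" "as \<noteq> []" and n: "n = length as" and y: "\<And>x. x \<in> I \<Longrightarrow> y x = g 0 x"
    and der: "\<And>k x. k < n - 1 \<Longrightarrow> x \<in> I \<Longrightarrow> (g k has_vector_derivative g (Suc k) x) (at x)"
    and ac: "loc_abs_cont_on I (g (n - 1))"
    and der_AE: "AE x in lebesgue. x \<in> I \<longrightarrow>
      (g (n - 1) has_vector_derivative (\<Sum>i<n. (as ! i) x * g (n - 1 - i) x)) (at x)"
  shows "ode_solution_on I as y" and "\<And>k x. k < n \<Longrightarrow> x \<in> I \<Longrightarrow> D k y x = g k x"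
proof -
  have D: "D k y x = g k x" if "k \<le> n - 1" "x \<in> I" for k x
    by (rule D_eq_chain[OF \<open>open I\<close> y der that])
  then show "\<And>k x. k < n \<Longrightarrow> x \<in> I \<Longrightarrow> D k y x = g k x" by simp
  have "D k y differentiable (at x)" if "k < n - 1" "x \<in> I" for k x
  proof -
    have "(D k y has_vector_derivative g (Suc k) x) (at x)"
      by (rule has_vector_derivative_transform_within_open[OF der \<open>open I\<close>]) (use D that in auto)
    then show ?thesis by (rule differentiableI_vector)
  qed
  moreover have "loc_abs_cont_on I (D (n - 1) y)"
    using ac by (rule loc_abs_cont_on_cong[rotated]) (simp add: D)
  moreover have "AE x in lebesgue. x \<in> I \<longrightarrow>
       (D (n - 1) y has_vector_derivative (\<Sum>i<n. (as ! i) x * D (n - 1 - i) y x)) (at x)"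
    using der_AE
  proof eventually_elim
    case (elim x)
    show ?case
    proof
      assume "x \<in> I"
      then have "(D (n - 1) y has_vector_derivative (\<Sum>i<n. (as ! i) x * g (n - 1 - i) x)) (at x)"
        by (intro has_vector_derivative_transform_within_open[OF elim[rule_format] \<open>open I\<close>]) (auto simp: D)
      then show "(D (n - 1) y has_vector_derivative (\<Sum>i<n. (as ! i) x * D (n - 1 - i) y x)) (at x)"
        using \<open>x \<in> I\<close> by (simp add: D)
    qed
  qed
  ultimately show "ode_solution_on I as y"
    unfolding ode_solution_on_def Let_def n by blast
qed

lemma general_solution_onI:
  assumes I: "zero_interval I" and as: "\<And>f. f \<in> set as \<Longrightarrow> loc_integrable_on I f" and "as \<noteq> []"
    and F: "\<And>c. ode_solution_on I as (F c)" "\<And>c k. k < length as \<Longrightarrow> D k (F c) 0 = c k"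
  shows "general_solution_on I as F"
  unfolding general_solution_on_def
proof (intro conjI allI impI ballI F)
  fix y x assume y: "ode_solution_on I as y" and x: "x \<in> I"
  define n where "n = length as"
  define z where "z = F (\<lambda>k. D k y 0)"
  have z: "ode_solution_on I as z" unfolding z_def by (rule F)
  have der: "(D k w has_vector_derivative D (Suc k) w x) (at x)"
    if "ode_solution_on I as w" "k < n - 1" "x \<in> I" for w k x
    using that by (auto simp: ode_solution_on_def Let_def n_def D_Suc vector_derivative_works)
  have AE: "AE x in lebesgue. x \<in> I \<longrightarrow>
      (D (n - 1) w has_vector_derivative (\<Sum>i<n. (as ! i) x * D (n - 1 - i) w x)) (at x)"
    "loc_abs_cont_on I (D (n - 1) w)" if "ode_solution_on I as w" for w
    using that by (simp_all add: ode_solution_on_def Let_def n_def)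
  have "n > 0" using \<open>as \<noteq> []\<close> by (simp add: n_def)
  have "(\<lambda>x. D k y x - D k z x) x = 0" if "k < n" for k
  proof (rule companion_system_zero[OF I as \<open>as \<noteq> []\<close>, folded n_def, where u = "\<lambda>k x. D k y x - D k z x"])
    show "((\<lambda>x. D k y x - D k z x) has_vector_derivative D (Suc k) y x - D (Suc k) z x) (at x)"
      if "k < n - 1" "x \<in> I" for k x
      using that by (intro has_vector_derivative_diff der y z)
    show "loc_abs_cont_on I (\<lambda>x. D (n - 1) y x - D (n - 1) z x)"
      by (intro loc_abs_cont_on_diff AE y z)
    show "AE x in lebesgue. x \<in> I \<longrightarrow> ((\<lambda>x. D (n - 1) y x - D (n - 1) z x) has_vector_derivative
        (\<Sum>i<n. (as ! i) x * (D (n - 1 - i) y x - D (n - 1 - i) z x))) (at x)"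
      using AE(1)[OF y] AE(1)[OF z]
    proof eventually_elim
      case (elim x)
      then show ?case
        using has_vector_derivative_diff[of "D (n - 1) y" _ "at x" "D (n - 1) z"]
        by (auto simp: right_diff_distrib sum_subtractf)
    qed
    show "D k y 0 - D k z 0 = 0" if "k < n" for k
      using F(2)[of k "\<lambda>k. D k y 0"] that by (simp add: z_def n_def)
  qed (use x that in auto)
  from this[of 0] \<open>n > 0\<close> show "y x = F (\<lambda>k. D k y 0) x" by (simp add: z_def)
qed

lemma loc_abs_cont_on_mult_const: "loc_abs_cont_on I f \<Longrightarrow> loc_abs_cont_on I (\<lambda>x. c * f x)"
  by (intro loc_abs_cont_on_mult loc_abs_cont_on_const)

lemma loc_abs_cont_on_power: "loc_abs_cont_on I f \<Longrightarrow> loc_abs_cont_on I (\<lambda>x. f x ^ n)"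
  by (induction n) (simp_all add: loc_abs_cont_on_const loc_abs_cont_on_mult)

lemma has_vector_derivative_inverse_complex:
  fixes f :: "real \<Rightarrow> complex"
  assumes "(f has_vector_derivative f') (at x)" "f x \<noteq> 0"
  shows "((\<lambda>x. inverse (f x)) has_vector_derivative - (inverse (f x))\<^sup>2 * f') (at x)"
  using field_vector_diff_chain_at[OF assms(1) DERIV_inverse[OF assms(2)]]
  by (simp add: o_def power2_eq_square algebra_simps)

lemma has_vector_derivative_exp_complex:
  fixes f :: "real \<Rightarrow> complex"
  assumes "(f has_vector_derivative f') (at x)"
  shows "((\<lambda>x. exp (f x)) has_vector_derivative f' * exp (f x)) (at x)"
  using field_vector_diff_chain_at[OF assms DERIV_exp] by (simp add: o_def)

section \<open>From cyclic systems to the equations\<close>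

text \<open>
  The trig functions of the cyclic rotations of one list form a fundamental system of the cyclic
  system, with the identity matrix as initial value.
\<close>

lemma trig_system_2:
  fixes c :: "nat \<Rightarrow> complex"
  assumes I: "zero_interval I" and f: "loc_integrable_on I f1" "continuous_on I f2"
  defines "Y \<equiv> \<lambda>x. c 0 * trigT [f1, f2] 2 x + c 1 * trigT [f2, f1] 1 x"
    and "Z \<equiv> \<lambda>x. c 0 * trigT [f1, f2] 1 x + c 1 * trigT [f2, f1] 2 x"
  shows "\<And>x. x \<in> I \<Longrightarrow> (Y has_vector_derivative f2 x * Z x) (at x)"
    "loc_abs_cont_on I Z"
    "AE x in lebesgue. x \<in> I \<longrightarrow> (Z has_vector_derivative f1 x * Y x) (at x)"
    "Y 0 = c 0" "Z 0 = c 1"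
proof -
  have fs: "f \<in> set [f1, f2] \<Longrightarrow> loc_integrable_on I f"
    "f \<in> set [f2, f1] \<Longrightarrow> loc_integrable_on I f" for f
    using f loc_integrable_on_continuous by auto
  have T1: "(trigT [f1, f2] 2 has_vector_derivative f2 x * trigT [f1, f2] 1 x) (at x)"
    and T2: "(trigT [f2, f1] 1 has_vector_derivative f2 x * trigT [f2, f1] 2 x) (at x)" if "x \<in> I" for x
    using trigT_has_vector_derivative[where fs = "[f1, f2]", OF I fs(1) _ refl, where j = 2]
      trigT_has_vector_derivative[where fs = "[f2, f1]", OF I fs(2) _ refl, where j = 1] that f by (simp_all add: numeral_eq_Suc)
  have A1: "AE x in lebesgue. x \<in> I \<longrightarrow> (trigT [f1, f2] 1 has_vector_derivative f1 x * trigT [f1, f2] 2 x) (at x)"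
    and A2: "AE x in lebesgue. x \<in> I \<longrightarrow> (trigT [f2, f1] 2 has_vector_derivative f1 x * trigT [f2, f1] 1 x) (at x)"
    using trigT_has_vector_derivative_AE[where fs = "[f1, f2]", OF I fs(1) _ refl, where j = 1]
      trigT_has_vector_derivative_AE[where fs = "[f2, f1]", OF I fs(2) _ refl, where j = 2] by (simp_all add: numeral_eq_Suc)
  show "(Y has_vector_derivative f2 x * Z x) (at x)" if "x \<in> I" for x
    unfolding Y_def Z_def using T1[OF that] T2[OF that]
    by (auto intro!: derivative_eq_intros simp: algebra_simps)
  show "loc_abs_cont_on I Z"
    unfolding Z_def by (intro loc_abs_cont_on_add loc_abs_cont_on_mult_const)
      (use loc_abs_cont_on_trigT[where fs = "[f1, f2]", OF I fs(1) _ refl] loc_abs_cont_on_trigT[where fs = "[f2, f1]", OF I fs(2) _ refl] in simp_all)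
  show "AE x in lebesgue. x \<in> I \<longrightarrow> (Z has_vector_derivative f1 x * Y x) (at x)"
    using A1 A2
  proof eventually_elim
    case (elim x)
    then show ?case
      unfolding Y_def Z_def by (auto intro!: derivative_eq_intros simp: algebra_simps)
  qed
  show "Y 0 = c 0" "Z 0 = c 1"
    using trigT_at_0[where fs = "[f1, f2]", OF I fs(1) _ refl] trigT_at_0[where fs = "[f2, f1]", OF I fs(2) _ refl] by (simp_all add: Y_def Z_def)
qed

lemma trig_system_3:
  fixes c :: "nat \<Rightarrow> complex"
  assumes I: "zero_interval I" and f: "loc_integrable_on I f1" "continuous_on I f2" "continuous_on I f3"
  defines "Y \<equiv> \<lambda>x. c 0 * trigT [f1, f2, f3] 3 x + c 1 * trigT [f3, f1, f2] 1 x + c 2 * trigT [f2, f3, f1] 2 x"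
    and "Z \<equiv> \<lambda>x. c 0 * trigT [f1, f2, f3] 2 x + c 1 * trigT [f3, f1, f2] 3 x + c 2 * trigT [f2, f3, f1] 1 x"
    and "W \<equiv> \<lambda>x. c 0 * trigT [f1, f2, f3] 1 x + c 1 * trigT [f3, f1, f2] 2 x + c 2 * trigT [f2, f3, f1] 3 x"
  shows "\<And>x. x \<in> I \<Longrightarrow> (Y has_vector_derivative f3 x * Z x) (at x)"
    "\<And>x. x \<in> I \<Longrightarrow> (Z has_vector_derivative f2 x * W x) (at x)"
    "loc_abs_cont_on I Z" "loc_abs_cont_on I W"
    "AE x in lebesgue. x \<in> I \<longrightarrow> (W has_vector_derivative f1 x * Y x) (at x)"
    "Y 0 = c 0" "Z 0 = c 1" "W 0 = c 2"
proof -
  have fs: "f \<in> set [f1, f2, f3] \<Longrightarrow> loc_integrable_on I f"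
    "f \<in> set [f3, f1, f2] \<Longrightarrow> loc_integrable_on I f"
    "f \<in> set [f2, f3, f1] \<Longrightarrow> loc_integrable_on I f" for f
    using f loc_integrable_on_continuous by auto
  note d1 = trigT_has_vector_derivative[where fs = "[f1, f2, f3]", OF I fs(1) _ refl]
    and d2 = trigT_has_vector_derivative[where fs = "[f3, f1, f2]", OF I fs(2) _ refl]
    and d3 = trigT_has_vector_derivative[where fs = "[f2, f3, f1]", OF I fs(3) _ refl]
  have Y': "(trigT [f1, f2, f3] 3 has_vector_derivative f3 x * trigT [f1, f2, f3] 2 x) (at x)"
    "(trigT [f3, f1, f2] 1 has_vector_derivative f3 x * trigT [f3, f1, f2] 3 x) (at x)"
    "(trigT [f2, f3, f1] 2 has_vector_derivative f3 x * trigT [f2, f3, f1] 1 x) (at x)" if "x \<in> I" for x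
    using d1[where j = 3 and x = x] d2[where j = 1 and x = x] d3[where j = 2 and x = x] f that by (simp_all add: numeral_eq_Suc)
  have Z': "(trigT [f1, f2, f3] 2 has_vector_derivative f2 x * trigT [f1, f2, f3] 1 x) (at x)"
    "(trigT [f3, f1, f2] 3 has_vector_derivative f2 x * trigT [f3, f1, f2] 2 x) (at x)"
    "(trigT [f2, f3, f1] 1 has_vector_derivative f2 x * trigT [f2, f3, f1] 3 x) (at x)" if "x \<in> I" for x
    using d1[where j = 2 and x = x] d2[where j = 3 and x = x] d3[where j = 1 and x = x] f that by (simp_all add: numeral_eq_Suc)
  have W': "AE x in lebesgue. x \<in> I \<longrightarrow> (trigT [f1, f2, f3] 1 has_vector_derivative f1 x * trigT [f1, f2, f3] 3 x) (at x)"
    "AE x in lebesgue. x \<in> I \<longrightarrow> (trigT [f3, f1, f2] 2 has_vector_derivative f1 x * trigT [f3, f1, f2] 1 x) (at x)"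
    "AE x in lebesgue. x \<in> I \<longrightarrow> (trigT [f2, f3, f1] 3 has_vector_derivative f1 x * trigT [f2, f3, f1] 2 x) (at x)"
    using trigT_has_vector_derivative_AE[where fs = "[f1, f2, f3]", OF I fs(1) _ refl, where j = 1]
      trigT_has_vector_derivative_AE[where fs = "[f3, f1, f2]", OF I fs(2) _ refl, where j = 2]
      trigT_has_vector_derivative_AE[where fs = "[f2, f3, f1]", OF I fs(3) _ refl, where j = 3] by (simp_all add: numeral_eq_Suc)
  show "(Y has_vector_derivative f3 x * Z x) (at x)" if "x \<in> I" for x
    unfolding Y_def Z_def using Y'[OF that]
    by (auto intro!: derivative_eq_intros simp: algebra_simps)
  show "(Z has_vector_derivative f2 x * W x) (at x)" if "x \<in> I" for x
    unfolding W_def Z_def using Z'[OF that]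
    by (auto intro!: derivative_eq_intros simp: algebra_simps)
  show "loc_abs_cont_on I Z" "loc_abs_cont_on I W"
    unfolding Z_def W_def by (use loc_abs_cont_on_trigT[where fs = "[f1, f2, f3]", OF I fs(1) _ refl] loc_abs_cont_on_trigT[where fs = "[f3, f1, f2]", OF I fs(2) _ refl]
        loc_abs_cont_on_trigT[where fs = "[f2, f3, f1]", OF I fs(3) _ refl] in \<open>auto intro!: loc_abs_cont_on_add loc_abs_cont_on_mult_const\<close>)
  show "AE x in lebesgue. x \<in> I \<longrightarrow> (W has_vector_derivative f1 x * Y x) (at x)"
    using W'
  proof eventually_elim
    case (elim x)
    then show ?case
      unfolding Y_def W_def by (auto intro!: derivative_eq_intros simp: algebra_simps)
  qed
  show "Y 0 = c 0" "Z 0 = c 1" "W 0 = c 2"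
    using trigT_at_0[where fs = "[f1, f2, f3]", OF I fs(1) _ refl] trigT_at_0[where fs = "[f3, f1, f2]", OF I fs(2) _ refl] trigT_at_0[where fs = "[f2, f3, f1]", OF I fs(3) _ refl]
    by (simp_all add: Y_def Z_def W_def)
qed

lemma trig_system_4:
  fixes c :: "nat \<Rightarrow> complex"
  assumes I: "zero_interval I" and f: "loc_integrable_on I f1" "continuous_on I f2" "continuous_on I f3"
    "continuous_on I f4"
  defines "Y \<equiv> \<lambda>x. c 0 * trigT [f1, f2, f3, f4] 4 x + c 1 * trigT [f4, f1, f2, f3] 1 x
      + c 2 * trigT [f3, f4, f1, f2] 2 x + c 3 * trigT [f2, f3, f4, f1] 3 x"
    and "Z \<equiv> \<lambda>x. c 0 * trigT [f1, f2, f3, f4] 3 x + c 1 * trigT [f4, f1, f2, f3] 4 x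
      + c 2 * trigT [f3, f4, f1, f2] 1 x + c 3 * trigT [f2, f3, f4, f1] 2 x"
    and "W \<equiv> \<lambda>x. c 0 * trigT [f1, f2, f3, f4] 2 x + c 1 * trigT [f4, f1, f2, f3] 3 x
      + c 2 * trigT [f3, f4, f1, f2] 4 x + c 3 * trigT [f2, f3, f4, f1] 1 x"
    and "V \<equiv> \<lambda>x. c 0 * trigT [f1, f2, f3, f4] 1 x + c 1 * trigT [f4, f1, f2, f3] 2 x
      + c 2 * trigT [f3, f4, f1, f2] 3 x + c 3 * trigT [f2, f3, f4, f1] 4 x"
  shows "\<And>x. x \<in> I \<Longrightarrow> (Y has_vector_derivative f4 x * Z x) (at x)"
    "\<And>x. x \<in> I \<Longrightarrow> (Z has_vector_derivative f3 x * W x) (at x)"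
    "\<And>x. x \<in> I \<Longrightarrow> (W has_vector_derivative f2 x * V x) (at x)"
    "loc_abs_cont_on I Z" "loc_abs_cont_on I W" "loc_abs_cont_on I V"
    "AE x in lebesgue. x \<in> I \<longrightarrow> (V has_vector_derivative f1 x * Y x) (at x)"
    "Y 0 = c 0" "Z 0 = c 1" "W 0 = c 2" "V 0 = c 3"
proof -
  have fs: "f \<in> set [f1, f2, f3, f4] \<Longrightarrow> loc_integrable_on I f"
    "f \<in> set [f4, f1, f2, f3] \<Longrightarrow> loc_integrable_on I f"
    "f \<in> set [f3, f4, f1, f2] \<Longrightarrow> loc_integrable_on I f"
    "f \<in> set [f2, f3, f4, f1] \<Longrightarrow> loc_integrable_on I f" for f
    using f loc_integrable_on_continuous by auto
  note d1 = trigT_has_vector_derivative[where fs = "[f1, f2, f3, f4]", OF I fs(1) _ refl]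
    and d2 = trigT_has_vector_derivative[where fs = "[f4, f1, f2, f3]", OF I fs(2) _ refl]
    and d3 = trigT_has_vector_derivative[where fs = "[f3, f4, f1, f2]", OF I fs(3) _ refl]
    and d4 = trigT_has_vector_derivative[where fs = "[f2, f3, f4, f1]", OF I fs(4) _ refl]
  have Y': "(trigT [f1, f2, f3, f4] 4 has_vector_derivative f4 x * trigT [f1, f2, f3, f4] 3 x) (at x)"
    "(trigT [f4, f1, f2, f3] 1 has_vector_derivative f4 x * trigT [f4, f1, f2, f3] 4 x) (at x)"
    "(trigT [f3, f4, f1, f2] 2 has_vector_derivative f4 x * trigT [f3, f4, f1, f2] 1 x) (at x)"
    "(trigT [f2, f3, f4, f1] 3 has_vector_derivative f4 x * trigT [f2, f3, f4, f1] 2 x) (at x)" if "x \<in> I" for x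
    using d1[where j = 4 and x = x] d2[where j = 1 and x = x] d3[where j = 2 and x = x] d4[where j = 3 and x = x] f that by (simp_all add: numeral_eq_Suc)
  have Z': "(trigT [f1, f2, f3, f4] 3 has_vector_derivative f3 x * trigT [f1, f2, f3, f4] 2 x) (at x)"
    "(trigT [f4, f1, f2, f3] 4 has_vector_derivative f3 x * trigT [f4, f1, f2, f3] 3 x) (at x)"
    "(trigT [f3, f4, f1, f2] 1 has_vector_derivative f3 x * trigT [f3, f4, f1, f2] 4 x) (at x)"
    "(trigT [f2, f3, f4, f1] 2 has_vector_derivative f3 x * trigT [f2, f3, f4, f1] 1 x) (at x)" if "x \<in> I" for x
    using d1[where j = 3 and x = x] d2[where j = 4 and x = x] d3[where j = 1 and x = x] d4[where j = 2 and x = x] f that by (simp_all add: numeral_eq_Suc)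
  have W': "(trigT [f1, f2, f3, f4] 2 has_vector_derivative f2 x * trigT [f1, f2, f3, f4] 1 x) (at x)"
    "(trigT [f4, f1, f2, f3] 3 has_vector_derivative f2 x * trigT [f4, f1, f2, f3] 2 x) (at x)"
    "(trigT [f3, f4, f1, f2] 4 has_vector_derivative f2 x * trigT [f3, f4, f1, f2] 3 x) (at x)"
    "(trigT [f2, f3, f4, f1] 1 has_vector_derivative f2 x * trigT [f2, f3, f4, f1] 4 x) (at x)" if "x \<in> I" for x
    using d1[where j = 2 and x = x] d2[where j = 3 and x = x] d3[where j = 4 and x = x] d4[where j = 1 and x = x] f that by (simp_all add: numeral_eq_Suc)
  have V': "AE x in lebesgue. x \<in> I \<longrightarrow> (trigT [f1, f2, f3, f4] 1 has_vector_derivative f1 x * trigT [f1, f2, f3, f4] 4 x) (at x)"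
    "AE x in lebesgue. x \<in> I \<longrightarrow> (trigT [f4, f1, f2, f3] 2 has_vector_derivative f1 x * trigT [f4, f1, f2, f3] 1 x) (at x)"
    "AE x in lebesgue. x \<in> I \<longrightarrow> (trigT [f3, f4, f1, f2] 3 has_vector_derivative f1 x * trigT [f3, f4, f1, f2] 2 x) (at x)"
    "AE x in lebesgue. x \<in> I \<longrightarrow> (trigT [f2, f3, f4, f1] 4 has_vector_derivative f1 x * trigT [f2, f3, f4, f1] 3 x) (at x)"
    using trigT_has_vector_derivative_AE[where fs = "[f1, f2, f3, f4]", OF I fs(1) _ refl, where j = 1]
      trigT_has_vector_derivative_AE[where fs = "[f4, f1, f2, f3]", OF I fs(2) _ refl, where j = 2]
      trigT_has_vector_derivative_AE[where fs = "[f3, f4, f1, f2]", OF I fs(3) _ refl, where j = 3]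
      trigT_has_vector_derivative_AE[where fs = "[f2, f3, f4, f1]", OF I fs(4) _ refl, where j = 4] by (simp_all add: numeral_eq_Suc)
  show "(Y has_vector_derivative f4 x * Z x) (at x)" if "x \<in> I" for x
    unfolding Y_def Z_def using Y'[OF that]
    by (auto intro!: derivative_eq_intros simp: algebra_simps)
  show "(Z has_vector_derivative f3 x * W x) (at x)" if "x \<in> I" for x
    unfolding W_def Z_def using Z'[OF that]
    by (auto intro!: derivative_eq_intros simp: algebra_simps)
  show "(W has_vector_derivative f2 x * V x) (at x)" if "x \<in> I" for x
    unfolding W_def V_def using W'[OF that]
    by (auto intro!: derivative_eq_intros simp: algebra_simps)
  show "loc_abs_cont_on I Z" "loc_abs_cont_on I W" "loc_abs_cont_on I V"
    unfolding Z_def W_def V_def by (use loc_abs_cont_on_trigT[where fs = "[f1, f2, f3, f4]", OF I fs(1) _ refl] loc_abs_cont_on_trigT[where fs = "[f4, f1, f2, f3]", OF I fs(2) _ refl]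
        loc_abs_cont_on_trigT[where fs = "[f3, f4, f1, f2]", OF I fs(3) _ refl] loc_abs_cont_on_trigT[where fs = "[f2, f3, f4, f1]", OF I fs(4) _ refl] in \<open>auto intro!: loc_abs_cont_on_add loc_abs_cont_on_mult_const\<close>)
  show "AE x in lebesgue. x \<in> I \<longrightarrow> (V has_vector_derivative f1 x * Y x) (at x)"
    using V'
  proof eventually_elim
    case (elim x)
    then show ?case
      unfolding Y_def V_def by (auto intro!: derivative_eq_intros simp: algebra_simps)
  qed
  show "Y 0 = c 0" "Z 0 = c 1" "W 0 = c 2" "V 0 = c 3"
    using trigT_at_0[where fs = "[f1, f2, f3, f4]", OF I fs(1) _ refl] trigT_at_0[where fs = "[f4, f1, f2, f3]", OF I fs(2) _ refl] trigT_at_0[where fs = "[f3, f4, f1, f2]", OF I fs(3) _ refl]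
      trigT_at_0[where fs = "[f2, f3, f4, f1]", OF I fs(4) _ refl]
    by (simp_all add: Y_def Z_def W_def V_def)
qed

lemma sum_lessThan_2_3_4:
  fixes f :: "nat \<Rightarrow> complex"
  shows "sum f {..<2} = f 0 + f 1" "sum f {..<3} = f 0 + f 1 + f 2" "sum f {..<4} = f 0 + f 1 + f 2 + f 3"
  by (simp_all add: numeral_eq_Suc)

text \<open>
  Reduction of the equations to cyclic systems. In each case the derivatives of \<open>y\<close> are explicit
  in the unknowns of the system, and the last derivative is absolutely continuous because it
  involves only absolutely continuous functions.
\<close>

lemma second_order_from_system:
  assumes I: "zero_interval I" and a1: "loc_integrable_on I a1"
  defines "E \<equiv> \<lambda>x. exp (primitive a1 x)"
  assumes Y: "\<And>x. x \<in> I \<Longrightarrow> (y has_vector_derivative E x * z x) (at x)"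
    and z: "loc_abs_cont_on I z"
    and Z: "AE x in lebesgue. x \<in> I \<longrightarrow> (z has_vector_derivative a2 x * exp (- primitive a1 x) * y x) (at x)"
  shows "ode_solution_on I [a1, a2] y"
    and "\<And>x. x \<in> I \<Longrightarrow> D 1 y x = E x * z x"
proof -
  have "open I" using I by (simp add: zero_interval_def)
  define g where "g k = [y, \<lambda>x. E x * z x] ! k" for k
  have E: "loc_abs_cont_on I E"
    unfolding E_def by (intro loc_abs_cont_on_exp loc_abs_cont_on_primitive I a1)
  have "(g k has_vector_derivative g (Suc k) x) (at x)" if "k < 2 - 1" "x \<in> I" for k x
    using that Y by (simp add: g_def)
  moreover have "loc_abs_cont_on I (g (2 - 1))"
    by (simp add: g_def loc_abs_cont_on_mult E z)
  moreover have "AE x in lebesgue. x \<in> I \<longrightarrow>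
      (g (2 - 1) has_vector_derivative (\<Sum>i<2. ([a1, a2] ! i) x * g (2 - 1 - i) x)) (at x)"
    using Z primitive_has_vector_derivative_AE[OF I a1]
  proof eventually_elim
    case (elim x)
    show ?case
    proof
      assume "x \<in> I"
      have E': "(E has_vector_derivative a1 x * E x) (at x)"
        unfolding E_def using elim \<open>x \<in> I\<close> by (intro has_vector_derivative_exp_complex) blast
      have "E x * exp (- primitive a1 x) = 1" by (simp add: E_def exp_minus)
      have "((\<lambda>x. E x * z x) has_vector_derivative
          E x * (a2 x * exp (- primitive a1 x) * y x) + a1 x * E x * z x) (at x)"
        using has_vector_derivative_mult[OF E'] elim \<open>x \<in> I\<close> by blast
      also have "E x * (a2 x * exp (- primitive a1 x) * y x) + a1 x * E x * z x
          = a1 x * (E x * z x) + a2 x * y x"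
        using \<open>E x * exp (- primitive a1 x) = 1\<close> by algebra
      finally show "(g (2 - 1) has_vector_derivative (\<Sum>i<2. ([a1, a2] ! i) x * g (2 - 1 - i) x)) (at x)"
        by (simp add: g_def sum_lessThan_2_3_4)
    qed
  qed
  ultimately have *: "ode_solution_on I [a1, a2] y" "\<And>k x. k < 2 \<Longrightarrow> x \<in> I \<Longrightarrow> D k y x = g k x"
    using ode_solution_onI[OF \<open>open I\<close>, of "[a1, a2]" 2 y g] by (simp_all add: g_def)
  then show "ode_solution_on I [a1, a2] y" by blast
  show "D 1 y x = E x * z x" if "x \<in> I" for x
    using *(2)[of 1 x] that by (simp add: g_def)
qed

text \<open>
  The function \<open>C\<close> solves the second order equation, which removes \<open>z\<close> from
  \<open>y''' - a\<^sub>1 y'' - a\<^sub>2 y' - a\<^sub>3 y\<close>; \<open>q\<close> is \<open>e\<^sup>-\<^sup>P C'\<close>.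
\<close>

lemma third_order_from_system:
  assumes I: "zero_interval I" and a1: "loc_integrable_on I a1"
  defines "E \<equiv> \<lambda>x. exp (primitive a1 x)"
  assumes C': "\<And>x. x \<in> I \<Longrightarrow> (C has_vector_derivative E x * q x) (at x)"
    and q: "loc_abs_cont_on I q"
    and q': "AE x in lebesgue. x \<in> I \<longrightarrow> (q has_vector_derivative a2 x * exp (- primitive a1 x) * C x) (at x)"
    and C: "loc_abs_cont_on I C" and nz: "\<And>x. x \<in> I \<Longrightarrow> C x \<noteq> 0"
    and Y: "\<And>x. x \<in> I \<Longrightarrow> (y has_vector_derivative C x * z x) (at x)"
    and Z: "\<And>x. x \<in> I \<Longrightarrow> (z has_vector_derivative E x * (inverse (C x))\<^sup>2 * w x) (at x)"
    and z: "loc_abs_cont_on I z" and w: "loc_abs_cont_on I w"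
    and W: "AE x in lebesgue. x \<in> I \<longrightarrow> (w has_vector_derivative a3 x * exp (- primitive a1 x) * C x * y x) (at x)"
  shows "ode_solution_on I [a1, a2, a3] y"
    and "\<And>x. x \<in> I \<Longrightarrow> D 1 y x = C x * z x"
    and "\<And>x. x \<in> I \<Longrightarrow> D 2 y x = E x * q x * z x + E x * inverse (C x) * w x"
proof -
  have "open I" using I by (simp add: zero_interval_def)
  define g where "g k = [y, \<lambda>x. C x * z x, \<lambda>x. E x * q x * z x + E x * inverse (C x) * w x] ! k" for k
  have E: "loc_abs_cont_on I E"
    unfolding E_def by (intro loc_abs_cont_on_exp loc_abs_cont_on_primitive I a1)
  have "(g k has_vector_derivative g (Suc k) x) (at x)" if "k < 3 - 1" "x \<in> I" for k x
  proof (cases "k = 0")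
    case True
    then show ?thesis using Y that by (simp add: g_def)
  next
    case False
    then have "k = 1" using that by simp
    have "C x * inverse (C x) = 1" using nz that by simp
    have "((\<lambda>x. C x * z x) has_vector_derivative
        C x * (E x * (inverse (C x))\<^sup>2 * w x) + E x * q x * z x) (at x)"
      by (intro has_vector_derivative_mult C' Z that)
    also have "C x * (E x * (inverse (C x))\<^sup>2 * w x) + E x * q x * z x
        = E x * q x * z x + E x * inverse (C x) * w x"
      using \<open>C x * inverse (C x) = 1\<close> by algebra
    finally show ?thesis using \<open>k = 1\<close> by (simp add: g_def)
  qed
  moreover have "loc_abs_cont_on I (g (3 - 1))"
    by (simp add: g_def) (intro loc_abs_cont_on_add loc_abs_cont_on_mult loc_abs_cont_on_inverse E q z w C nz)
  moreover have "AE x in lebesgue. x \<in> I \<longrightarrow>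
      (g (3 - 1) has_vector_derivative (\<Sum>i<3. ([a1, a2, a3] ! i) x * g (3 - 1 - i) x)) (at x)"
    using q' W primitive_has_vector_derivative_AE[OF I a1]
  proof eventually_elim
    case (elim x)
    show ?case
    proof
      assume "x \<in> I"
      let ?e = "exp (- primitive a1 x)" and ?ci = "inverse (C x)"
      have E': "(E has_vector_derivative a1 x * E x) (at x)"
        unfolding E_def using elim \<open>x \<in> I\<close> by (intro has_vector_derivative_exp_complex) blast
      have q': "(q has_vector_derivative a2 x * ?e * C x) (at x)"
        and W': "(w has_vector_derivative a3 x * ?e * C x * y x) (at x)" using elim \<open>x \<in> I\<close> by blast+
      note ci' = has_vector_derivative_inverse_complex[OF C'[OF \<open>x \<in> I\<close>] nz[OF \<open>x \<in> I\<close>]]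
      have 1: "E x * ?e = 1" "C x * ?ci = 1" using nz[OF \<open>x \<in> I\<close>] by (simp_all add: E_def exp_minus)
      have "((\<lambda>x. E x * q x * z x + E x * inverse (C x) * w x) has_vector_derivative
          (E x * q x * (E x * ?ci\<^sup>2 * w x) + (E x * (a2 x * ?e * C x) + a1 x * E x * q x) * z x) +
          (E x * ?ci * (a3 x * ?e * C x * y x) + (E x * (- ?ci\<^sup>2 * (E x * q x)) + a1 x * E x * ?ci) * w x)) (at x)"
        by (intro has_vector_derivative_add has_vector_derivative_mult E' q' W' ci' Z \<open>x \<in> I\<close>)
      also have "(E x * q x * (E x * ?ci\<^sup>2 * w x) + (E x * (a2 x * ?e * C x) + a1 x * E x * q x) * z x) +
          (E x * ?ci * (a3 x * ?e * C x * y x) + (E x * (- ?ci\<^sup>2 * (E x * q x)) + a1 x * E x * ?ci) * w x)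
        = a1 x * (E x * q x * z x + E x * ?ci * w x) + a2 x * (C x * z x) + a3 x * y x"
        using 1 by algebra
      finally show "(g (3 - 1) has_vector_derivative (\<Sum>i<3. ([a1, a2, a3] ! i) x * g (3 - 1 - i) x)) (at x)"
        by (simp add: g_def sum_lessThan_2_3_4)
    qed
  qed
  ultimately have *: "ode_solution_on I [a1, a2, a3] y" "\<And>k x. k < 3 \<Longrightarrow> x \<in> I \<Longrightarrow> D k y x = g k x"
    using ode_solution_onI[OF \<open>open I\<close>, of "[a1, a2, a3]" 3 y g] by (simp_all add: g_def)
  then show "ode_solution_on I [a1, a2, a3] y" by blast
  show "D 1 y x = C x * z x" "D 2 y x = E x * q x * z x + E x * inverse (C x) * w x" if "x \<in> I" for x
    using *(2)[of 1 x] *(2)[of 2 x] that by (simp_all add: g_def)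
qed

text \<open>
  Here \<open>p\<close> is a solution of the third order equation and \<open>r\<close> is chosen to satisfy
  \<open>p r'' + 3 p' r' + 3 p'' r = a\<^sub>1 (p r' + 2 p' r) + a\<^sub>2 p r\<close>, which is what makes the coefficient of
  \<open>w\<close> in \<open>y'''' - a\<^sub>1 y''' - a\<^sub>2 y'' - a\<^sub>3 y' - a\<^sub>4 y\<close> vanish; \<open>q\<close> is \<open>e\<^sup>-\<^sup>P p\<^sup>3 r'\<close>.
\<close>

lemma fourth_order_from_system:
  assumes I: "zero_interval I" and a1: "loc_integrable_on I a1"
  defines "E \<equiv> \<lambda>x. exp (primitive a1 x)"
  assumes p: "ode_solution_on I [a1, a2, a3] p" and pnz: "\<And>x. x \<in> I \<Longrightarrow> p x \<noteq> 0"
    and r': "\<And>x. x \<in> I \<Longrightarrow> (r has_vector_derivative E x * (inverse (p x)) ^ 3 * q x) (at x)"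
    and q: "loc_abs_cont_on I q"
    and q': "AE x in lebesgue. x \<in> I \<longrightarrow> (q has_vector_derivative exp (- primitive a1 x) * (p x)\<^sup>2 *
        (a2 x * p x + 2 * a1 x * D 1 p x - 3 * D 2 p x) * r x) (at x)"
    and r: "loc_abs_cont_on I r" and rnz: "\<And>x. x \<in> I \<Longrightarrow> r x \<noteq> 0"
    and Y: "\<And>x. x \<in> I \<Longrightarrow> (y has_vector_derivative p x * z x) (at x)"
    and Z: "\<And>x. x \<in> I \<Longrightarrow> (z has_vector_derivative r x * w x) (at x)"
    and W: "\<And>x. x \<in> I \<Longrightarrow> (w has_vector_derivative E x * (inverse (r x))\<^sup>2 * (inverse (p x)) ^ 3 * v x) (at x)"
    and ac: "loc_abs_cont_on I p" "loc_abs_cont_on I (D 1 p)" "loc_abs_cont_on I z"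
      "loc_abs_cont_on I w" "loc_abs_cont_on I v"
    and V: "AE x in lebesgue. x \<in> I \<longrightarrow> (v has_vector_derivative
        a4 x * exp (- primitive a1 x) * r x * (p x)\<^sup>2 * y x) (at x)"
  shows "ode_solution_on I [a1, a2, a3, a4] y"
    and "\<And>x. x \<in> I \<Longrightarrow> D 1 y x = p x * z x"
    and "\<And>x. x \<in> I \<Longrightarrow> D 2 y x = D 1 p x * z x + p x * r x * w x"
    and "\<And>x. x \<in> I \<Longrightarrow> D 3 y x = D 2 p x * z x + (2 * D 1 p x * r x + E x * (inverse (p x))\<^sup>2 * q x) * w x
        + E x * inverse (r x) * (inverse (p x))\<^sup>2 * v x"
proof -
  have "open I" using I by (simp add: zero_interval_def)
  define p1 p2 where "p1 = D 1 p" and "p2 = D 2 p"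
  have p': "(p has_vector_derivative p1 x) (at x)" "(p1 has_vector_derivative p2 x) (at x)" if "x \<in> I" for x
  proof -
    have "D k p differentiable (at x)" if "k < 2" for k
      using p \<open>x \<in> I\<close> that by (simp add: ode_solution_on_def Let_def)
    from this[of 0] this[of 1] show "(p has_vector_derivative p1 x) (at x)" "(p1 has_vector_derivative p2 x) (at x)"
      by (simp_all add: p1_def p2_def D_Suc numeral_2_eq_2 vector_derivative_works)
  qed
  have p2: "loc_abs_cont_on I p2"
    using p by (simp add: ode_solution_on_def Let_def p2_def numeral_2_eq_2)
  have p2': "AE x in lebesgue. x \<in> I \<longrightarrow>
      (p2 has_vector_derivative a1 x * p2 x + a2 x * p1 x + a3 x * p x) (at x)"
    using p by (simp add: ode_solution_on_def Let_def p1_def p2_def numeral_2_eq_2)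
  define g2 g3 where "g2 x = p1 x * z x + p x * r x * w x"
    and "g3 x = p2 x * z x + (2 * p1 x * r x + E x * (inverse (p x))\<^sup>2 * q x) * w x
        + E x * inverse (r x) * (inverse (p x))\<^sup>2 * v x" for x
  define g where "g k = [y, \<lambda>x. p x * z x, g2, g3] ! k" for k
  have E: "loc_abs_cont_on I E"
    unfolding E_def by (intro loc_abs_cont_on_exp loc_abs_cont_on_primitive I a1)
  have "(g k has_vector_derivative g (Suc k) x) (at x)" if k: "k < 4 - 1" and x: "x \<in> I" for k x
  proof -
    have inv: "p x * inverse (p x) = 1" "r x * inverse (r x) = 1" using pnz rnz x by simp_all
    consider "k = 0" | "k = 1" | "k = 2" using k by linarith
    then show ?thesis
    proof cases
      case 1
      then show ?thesis using Y x by (simp add: g_def)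
    next
      case 2
      have "((\<lambda>x. p x * z x) has_vector_derivative p x * (r x * w x) + p1 x * z x) (at x)"
        by (intro has_vector_derivative_mult p' Z x)
      also have "p x * (r x * w x) + p1 x * z x = g2 x" by (simp add: g2_def)
      finally show ?thesis using 2 by (simp add: g_def)
    next
      case 3
      let ?pi = "inverse (p x)" and ?ri = "inverse (r x)"
      have "((\<lambda>x. p1 x * z x + p x * r x * w x) has_vector_derivative
          (p1 x * (r x * w x) + p2 x * z x) +
          (p x * r x * (E x * ?ri\<^sup>2 * ?pi ^ 3 * v x) + (p x * (E x * ?pi ^ 3 * q x) + p1 x * r x) * w x)) (at x)"
        by (intro has_vector_derivative_add has_vector_derivative_mult p' Z W r' x)
      also have "(p1 x * (r x * w x) + p2 x * z x) +
          (p x * r x * (E x * ?ri\<^sup>2 * ?pi ^ 3 * v x) + (p x * (E x * ?pi ^ 3 * q x) + p1 x * r x) * w x) = g3 x"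
        using inv unfolding g3_def by algebra
      finally show ?thesis using 3 by (simp add: g_def g2_def[abs_def])
    qed
  qed
  moreover have "loc_abs_cont_on I (g (4 - 1))"
    by (simp add: g_def g3_def[abs_def])
      (intro loc_abs_cont_on_add loc_abs_cont_on_mult loc_abs_cont_on_inverse loc_abs_cont_on_power
        loc_abs_cont_on_const E q r p2 ac[folded p1_def] pnz rnz)
  moreover have "AE x in lebesgue. x \<in> I \<longrightarrow>
      (g (4 - 1) has_vector_derivative (\<Sum>i<4. ([a1, a2, a3, a4] ! i) x * g (4 - 1 - i) x)) (at x)"
    using q' V p2' primitive_has_vector_derivative_AE[OF I a1]
  proof eventually_elim
    case (elim x)
    show ?case
    proof
      assume x: "x \<in> I"
      let ?e = "exp (- primitive a1 x)" and ?pi = "inverse (p x)" and ?ri = "inverse (r x)"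
      let ?q' = "?e * (p x)\<^sup>2 * (a2 x * p x + 2 * a1 x * p1 x - 3 * p2 x) * r x"
      let ?r' = "E x * ?pi ^ 3 * q x" and ?w' = "E x * ?ri\<^sup>2 * ?pi ^ 3 * v x"
      let ?v' = "a4 x * ?e * r x * (p x)\<^sup>2 * y x" and ?p2' = "a1 x * p2 x + a2 x * p1 x + a3 x * p x"
      have E': "(E has_vector_derivative a1 x * E x) (at x)"
        unfolding E_def using elim x by (intro has_vector_derivative_exp_complex) blast
      have q': "(q has_vector_derivative ?q') (at x)" and v': "(v has_vector_derivative ?v') (at x)"
        and p2': "(p2 has_vector_derivative ?p2') (at x)" using elim x by (simp_all add: p1_def p2_def)
      have pi': "((\<lambda>x. inverse (p x)) has_vector_derivative - ?pi\<^sup>2 * p1 x) (at x)"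
        and ri': "((\<lambda>x. inverse (r x)) has_vector_derivative - ?ri\<^sup>2 * ?r') (at x)"
        by (intro has_vector_derivative_inverse_complex p' r' x pnz rnz)+
      have pi2': "((\<lambda>x. (inverse (p x))\<^sup>2) has_vector_derivative ?pi * (- ?pi\<^sup>2 * p1 x) + (- ?pi\<^sup>2 * p1 x) * ?pi) (at x)"
        unfolding power2_eq_square[of "inverse (p _)"]
        by (intro has_vector_derivative_mult pi'[unfolded power2_eq_square[of "inverse (p _)"]])
      have two: "((\<lambda>x. 2 * p1 x) has_vector_derivative 2 * p2 x) (at x)"
        by (intro has_vector_derivative_mult_right p' x)
      have inv: "E x * ?e = 1" "p x * ?pi = 1" "r x * ?ri = 1"
        using pnz[OF x] rnz[OF x] by (simp_all add: E_def exp_minus)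
      have "(g3 has_vector_derivative
          (p2 x * (r x * w x) + ?p2' * z x) +
          ((2 * p1 x * r x + E x * ?pi\<^sup>2 * q x) * ?w' +
           ((2 * p1 x * ?r' + 2 * p2 x * r x) +
            (E x * ?pi\<^sup>2 * ?q' + (E x * (?pi * (- ?pi\<^sup>2 * p1 x) + (- ?pi\<^sup>2 * p1 x) * ?pi) + a1 x * E x * ?pi\<^sup>2) * q x)) * w x) +
          (E x * ?ri * ?pi\<^sup>2 * ?v' +
           (E x * ?ri * (?pi * (- ?pi\<^sup>2 * p1 x) + (- ?pi\<^sup>2 * p1 x) * ?pi) +
            (E x * (- ?ri\<^sup>2 * ?r') + a1 x * E x * ?ri) * ?pi\<^sup>2) * v x)) (at x)"
        unfolding g3_def[abs_def]
        by (intro has_vector_derivative_add has_vector_derivative_mult[where g = z]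
            has_vector_derivative_mult[where g = w] has_vector_derivative_mult[where g = q]
            has_vector_derivative_mult[where g = r] has_vector_derivative_mult[where g = v]
            has_vector_derivative_mult[where g = "\<lambda>x. (inverse (p x))\<^sup>2"]
            has_vector_derivative_mult[where g = "\<lambda>x. inverse (r x)"]
            two E' q' v' p2' pi2' ri' Z W r' x)
      also have "(p2 x * (r x * w x) + ?p2' * z x) +
          ((2 * p1 x * r x + E x * ?pi\<^sup>2 * q x) * ?w' +
           ((2 * p1 x * ?r' + 2 * p2 x * r x) +
            (E x * ?pi\<^sup>2 * ?q' + (E x * (?pi * (- ?pi\<^sup>2 * p1 x) + (- ?pi\<^sup>2 * p1 x) * ?pi) + a1 x * E x * ?pi\<^sup>2) * q x)) * w x) +
          (E x * ?ri * ?pi\<^sup>2 * ?v' +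
           (E x * ?ri * (?pi * (- ?pi\<^sup>2 * p1 x) + (- ?pi\<^sup>2 * p1 x) * ?pi) +
            (E x * (- ?ri\<^sup>2 * ?r') + a1 x * E x * ?ri) * ?pi\<^sup>2) * v x)
        = a1 x * g3 x + a2 x * g2 x + a3 x * (p x * z x) + a4 x * y x"
      proof -
        have v'_eq: "E x * ?ri * ?pi\<^sup>2 * ?v' = a4 x * y x"
          using inv by algebra
        have q'_eq: "E x * ?pi\<^sup>2 * ?q' = (a2 x * p x + 2 * a1 x * p1 x - 3 * p2 x) * r x"
          using inv(1,2) by algebra
        have w'_eq: "r x * ?w' = E x * ?ri * ?pi ^ 3 * v x"
          using inv(3) by algebra
        show ?thesis
          unfolding v'_eq q'_eq g2_def g3_def using w'_eq by algebra
      qed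
      finally show "(g (4 - 1) has_vector_derivative (\<Sum>i<4. ([a1, a2, a3, a4] ! i) x * g (4 - 1 - i) x)) (at x)"
        by (simp add: g_def sum_lessThan_2_3_4)
    qed
  qed
  ultimately have *: "ode_solution_on I [a1, a2, a3, a4] y" "\<And>k x. k < 4 \<Longrightarrow> x \<in> I \<Longrightarrow> D k y x = g k x"
    using ode_solution_onI[OF \<open>open I\<close>, of "[a1, a2, a3, a4]" 4 y g] by (simp_all add: g_def)
  then show "ode_solution_on I [a1, a2, a3, a4] y" by blast
  show "D 1 y x = p x * z x" "D 2 y x = D 1 p x * z x + p x * r x * w x"
    "D 3 y x = D 2 p x * z x + (2 * D 1 p x * r x + E x * (inverse (p x))\<^sup>2 * q x) * w x
        + E x * inverse (r x) * (inverse (p x))\<^sup>2 * v x" if "x \<in> I" for x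
    using *(2)[of 1 x] *(2)[of 2 x] *(2)[of 3 x] that
    by (simp_all add: g_def g2_def g3_def p1_def p2_def)
qed


section \<open>General solutions by trig functions\<close>

theorem corollary1:
  fixes a1 a2 a3 a4 :: "real \<Rightarrow> complex"
    and C S \<phi>1 \<phi>2 \<phi>3 \<psi>1 \<psi>2 \<psi>3 \<psi>4 :: "real \<Rightarrow> complex"
  assumes "loc_integrable a1" "loc_integrable a2" "loc_integrable a3" "loc_integrable a4"
    and C: "C = trigT [\<lambda>x. a2 x * exp (- primitive a1 x), \<lambda>x. exp (primitive a1 x)] 2"
    and S: "S = trigT [\<lambda>x. exp (primitive a1 x), \<lambda>x. a2 x * exp (- primitive a1 x)] 1"
    and \<phi>3: "\<phi>3 = C"
    and \<phi>2: "\<phi>2 = (\<lambda>x. exp (primitive a1 x) * C x powi (-2))"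
    and \<phi>1: "\<phi>1 = (\<lambda>x. a3 x * exp (- primitive a1 x) * C x)"
    and \<psi>4: "\<psi>4 = trigT [\<phi>1, \<phi>2, \<phi>3] 3"
    and \<psi>3: "\<psi>3 = trigT
      [\<lambda>x. exp (- primitive a1 x) * (\<psi>4 x)\<^sup>2 *
             (a2 x * \<psi>4 x + 2 * a1 x * D 1 \<psi>4 x - 3 * D 2 \<psi>4 x),
       \<lambda>x. exp (primitive a1 x) * \<psi>4 x powi (-3)] 2"
    and \<psi>2: "\<psi>2 = (\<lambda>x. exp (primitive a1 x) * \<psi>3 x powi (-2) * \<psi>4 x powi (-3))"
    and \<psi>1: "\<psi>1 = (\<lambda>x. a4 x * exp (- primitive a1 x) * \<psi>3 x * (\<psi>4 x)\<^sup>2)"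
  shows
    "general_solution_on UNIV [a1, a2] (\<lambda>c x. c 0 * C x + c 1 * S x) \<and>
     (\<exists>\<epsilon>>0. \<forall>x\<in>{-\<epsilon><..<\<epsilon>}. C x \<noteq> 0) \<and>
     (\<forall>I. open I \<and> is_interval I \<and> 0 \<in> I \<and> (\<forall>x\<in>I. C x \<noteq> 0) \<longrightarrow>
       general_solution_on I [a1, a2, a3]
         (\<lambda>c x. c 0 * trigT [\<phi>1, \<phi>2, \<phi>3] 3 x
              + c 1 * trigT [\<phi>3, \<phi>1, \<phi>2] 1 x
              + c 2 * trigT [\<phi>2, \<phi>3, \<phi>1] 2 x)) \<and>
     (\<exists>\<epsilon>>0. \<forall>x\<in>{-\<epsilon><..<\<epsilon>}. C x \<noteq> 0 \<and> \<psi>4 x \<noteq> 0 \<and> \<psi>3 x \<noteq> 0) \<and>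
     (\<forall>I. open I \<and> is_interval I \<and> 0 \<in> I \<and>
          (\<forall>x\<in>I. C x \<noteq> 0 \<and> \<psi>4 x \<noteq> 0 \<and> \<psi>3 x \<noteq> 0) \<longrightarrow>
       general_solution_on I [a1, a2, a3, a4]
         (\<lambda>c x. c 0 * trigT [\<psi>1, \<psi>2, \<psi>3, \<psi>4] 4 x
              + c 1 * trigT [\<psi>4, \<psi>1, \<psi>2, \<psi>3] 1 x
              + c 2 * trigT [\<psi>3, \<psi>4, \<psi>1, \<psi>2] 2 x
              + c 3 * trigT [\<psi>2, \<psi>3, \<psi>4, \<psi>1] 3 x))"
proof -
  define P where "P = primitive a1"
  have U: "zero_interval UNIV" by (simp add: zero_interval_def)
  have loc: "loc_integrable_on I f" if "loc_integrable f" for I f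
    using that by (simp add: loc_integrable_def loc_integrable_on_def)
  note a = loc[OF assms(1)] loc[OF assms(2)] loc[OF assms(3)] loc[OF assms(4)]
  have P: "loc_abs_cont_on UNIV P"
    unfolding P_def by (rule loc_abs_cont_on_primitive[OF U a(1)])
  have contP: "continuous_on I P" for I
    using loc_abs_cont_on_imp_continuous_on[OF P] continuous_on_subset by blast
  have P0: "P 0 = 0" by (simp add: P_def)
  have f1: "loc_integrable_on I (\<lambda>x. a2 x * exp (- P x))" for I
    by (intro loc_integrable_on_mult a continuous_intros contP)
  have E: "continuous_on I (\<lambda>x. exp (P x))" for I by (intro continuous_intros contP)
  note sys2 = trig_system_2[OF U f1 E, folded C[folded P_def] S[folded P_def]]
  have sol2: "general_solution_on UNIV [a1, a2] (\<lambda>c x. c 0 * C x + c 1 * S x)"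
  proof (rule general_solution_onI[OF U])
    fix c :: "nat \<Rightarrow> complex"
    let ?Z = "\<lambda>x. c 0 * trigT [\<lambda>x. a2 x * exp (- P x), \<lambda>x. exp (P x)] 1 x
      + c 1 * trigT [\<lambda>x. exp (P x), \<lambda>x. a2 x * exp (- P x)] 2 x"
    note s = second_order_from_system[OF U a(1), folded P_def, where ?y = "\<lambda>x. c 0 * C x + c 1 * S x"
        and ?z = ?Z and ?a2.0 = a2, OF sys2(1) sys2(2) sys2(3)]
    show "ode_solution_on UNIV [a1, a2] (\<lambda>x. c 0 * C x + c 1 * S x)" by (rule s(1))
    show "D k (\<lambda>x. c 0 * C x + c 1 * S x) 0 = c k" if "k < length [a1, a2]" for k
    proof -
      have "k = 0 \<or> k = 1" using that by auto
      then show ?thesis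
        using sys2(4,5)[where c = c] s(2)[of 0] P0 by auto
    qed
  qed (use a in auto)

  \<comment> \<open>\<open>q\<close> is \<open>e\<^sup>-\<^sup>P C'\<close>.\<close>
  define q where "q = trigT [\<lambda>x. a2 x * exp (- P x), \<lambda>x. exp (P x)] 1"
  have C_sys: "\<And>x. (C has_vector_derivative exp (P x) * q x) (at x)"
    "loc_abs_cont_on UNIV q"
    "AE x in lebesgue. (q has_vector_derivative a2 x * exp (- P x) * C x) (at x)"
    "C 0 = 1" "q 0 = 0"
    using sys2[where c = "\<lambda>k. if k = 0 then 1 else 0"] unfolding q_def[symmetric] by simp_all
  have C_ac: "loc_abs_cont_on UNIV C"
    unfolding C by (rule loc_abs_cont_on_trigT[OF U _ _ refl])
      (use f1 E loc_integrable_on_continuous in \<open>auto simp: P_def[symmetric]\<close>)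
  have restrict: "loc_abs_cont_on I f" if "loc_abs_cont_on UNIV f" for I f
    using that by (simp add: loc_abs_cont_on_def)
  have C_cont: "continuous_on I C" for I
    using loc_abs_cont_on_imp_continuous_on[OF C_ac] continuous_on_subset by blast

  let ?F3 = "\<lambda>c x. c 0 * trigT [\<phi>1, \<phi>2, \<phi>3] 3 x + c 1 * trigT [\<phi>3, \<phi>1, \<phi>2] 1 x
    + c 2 * trigT [\<phi>2, \<phi>3, \<phi>1] 2 x"
  have third: "ode_solution_on I [a1, a2, a3] (?F3 c)"
    "k < 3 \<Longrightarrow> D k (?F3 c) 0 = c k" "loc_abs_cont_on I (D 1 (?F3 c))" "loc_abs_cont_on I (?F3 c)"
    if I: "zero_interval I" and nz: "\<forall>x\<in>I. C x \<noteq> 0" for I c k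
  proof -
    have "0 \<in> I" "open I" using I by (auto simp: zero_interval_def)
    have \<phi>: "loc_integrable_on I \<phi>1" "continuous_on I \<phi>2" "continuous_on I \<phi>3"
      unfolding \<phi>1 \<phi>2 \<phi>3 P_def[symmetric] using nz
      by (auto intro!: loc_integrable_on_mult a continuous_intros contP C_cont)
    note sys3 = trig_system_3[OF I \<phi>, where c = c]
    let ?Z = "\<lambda>x. c 0 * trigT [\<phi>1, \<phi>2, \<phi>3] 2 x + c 1 * trigT [\<phi>3, \<phi>1, \<phi>2] 3 x
      + c 2 * trigT [\<phi>2, \<phi>3, \<phi>1] 1 x"
    let ?W = "\<lambda>x. c 0 * trigT [\<phi>1, \<phi>2, \<phi>3] 1 x + c 1 * trigT [\<phi>3, \<phi>1, \<phi>2] 2 x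
      + c 2 * trigT [\<phi>2, \<phi>3, \<phi>1] 3 x"
    have \<phi>_eq: "\<phi>3 x = C x" "\<phi>2 x = exp (P x) * (inverse (C x))\<^sup>2" "\<phi>1 x = a3 x * exp (- P x) * C x" for x
      by (simp_all add: \<phi>1 \<phi>2 \<phi>3 P_def power_int_minus power_inverse)
    have q': "AE x in lebesgue. x \<in> I \<longrightarrow> (q has_vector_derivative a2 x * exp (- P x) * C x) (at x)"
      using C_sys(3) by eventually_elim simp
    have sys3': "(?F3 c has_vector_derivative C x * ?Z x) (at x)"
      "(?Z has_vector_derivative exp (P x) * (inverse (C x))\<^sup>2 * ?W x) (at x)" if "x \<in> I" for x
      using sys3(1,2)[OF that] by (simp_all only: \<phi>_eq[of x])
    have sys3_AE: "AE x in lebesgue. x \<in> I \<longrightarrow> (?W has_vector_derivative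
        a3 x * exp (- P x) * C x * ?F3 c x) (at x)"
      using sys3(5)
    proof eventually_elim
      case (elim x)
      then show ?case by (simp only: \<phi>_eq[of x])
    qed
    note s = third_order_from_system[OF I a(1), folded P_def, where ?C = C and ?q = q and ?y = "?F3 c"
        and ?z = ?Z and ?w = ?W and ?a2.0 = a2 and ?a3.0 = a3,
        OF C_sys(1) restrict[OF C_sys(2)] q' restrict[OF C_ac] nz[rule_format] sys3' sys3(3,4) sys3_AE]
    have *: "ode_solution_on I [a1, a2, a3] (?F3 c)"
      "\<And>x. x \<in> I \<Longrightarrow> D 1 (?F3 c) x = C x * ?Z x"
      "\<And>x. x \<in> I \<Longrightarrow> D 2 (?F3 c) x = exp (P x) * q x * ?Z x + exp (P x) * inverse (C x) * ?W x"
      by (rule s; assumption)+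
    show "ode_solution_on I [a1, a2, a3] (?F3 c)" by (rule *(1))
    show "loc_abs_cont_on I (D 1 (?F3 c))"
    proof (rule loc_abs_cont_on_cong)
      show "C x * ?Z x = D 1 (?F3 c) x" if "x \<in> I" for x by (rule *(2)[OF that, symmetric])
      show "loc_abs_cont_on I (\<lambda>x. C x * ?Z x)" by (rule loc_abs_cont_on_mult[OF restrict[OF C_ac] sys3(3)])
    qed
    show "loc_abs_cont_on I (?F3 c)"
    proof -
      have fs: "loc_integrable_on I f" if "f \<in> {\<phi>1, \<phi>2, \<phi>3}" for f
        using \<phi> that loc_integrable_on_continuous by auto
      show ?thesis
        by (intro loc_abs_cont_on_add loc_abs_cont_on_mult_const loc_abs_cont_on_trigT[OF I _ _ refl])
          (auto intro: fs)
    qed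
    show "D k (?F3 c) 0 = c k" if "k < 3"
    proof -
      have "k = 0 \<or> k = 1 \<or> k = 2" using that by auto
      then show ?thesis
        using sys3(6-8) *(2,3)[OF \<open>0 \<in> I\<close>] P0 C_sys(4,5) by auto
    qed
  qed
  have sol3: "general_solution_on I [a1, a2, a3] ?F3"
    if I: "zero_interval I" and nz: "\<forall>x\<in>I. C x \<noteq> 0" for I
    by (rule general_solution_onI[OF I]) (use a third[OF I nz] in auto)

  have \<psi>4_sol: "ode_solution_on I [a1, a2, a3] \<psi>4" "\<psi>4 0 = 1" "D 1 \<psi>4 0 = 0" "D 2 \<psi>4 0 = 0"
    "loc_abs_cont_on I (D 1 \<psi>4)" "loc_abs_cont_on I \<psi>4"
    if I: "zero_interval I" and nz: "\<forall>x\<in>I. C x \<noteq> 0" for I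
  proof -
    define c :: "nat \<Rightarrow> complex" where "c k = (if k = 0 then 1 else 0)" for k
    have "?F3 c = \<psi>4" by (simp add: c_def \<psi>4)
    then show "ode_solution_on I [a1, a2, a3] \<psi>4" "\<psi>4 0 = 1" "D 1 \<psi>4 0 = 0" "D 2 \<psi>4 0 = 0"
      "loc_abs_cont_on I (D 1 \<psi>4)" "loc_abs_cont_on I \<psi>4"
      using third(1,3,4)[OF I nz, of c] third(2)[OF I nz, of 0 c] third(2)[OF I nz, of 1 c]
        third(2)[OF I nz, of 2 c] by (simp_all add: c_def)
  qed

  \<comment> \<open>\<open>\<psi>3\<close> and its partner \<open>r\<close> form a cyclic system of length two, like \<open>C\<close> and \<open>q\<close>.\<close>
  define G where "G x = exp (- P x) * (\<psi>4 x)\<^sup>2 * (a2 x * \<psi>4 x + 2 * a1 x * D 1 \<psi>4 x - 3 * D 2 \<psi>4 x)" for x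
  define H where "H x = exp (P x) * \<psi>4 x powi (-3)" for x
  define r where "r = trigT [G, H] 1"
  have \<psi>3_eq: "\<psi>3 = trigT [G, H] 2" by (simp add: \<psi>3 G_def[abs_def] H_def[abs_def] P_def)
  have \<psi>3_sys: "\<And>x. x \<in> I \<Longrightarrow> (\<psi>3 has_vector_derivative H x * r x) (at x)"
    "loc_abs_cont_on I r"
    "AE x in lebesgue. x \<in> I \<longrightarrow> (r has_vector_derivative G x * \<psi>3 x) (at x)"
    "\<psi>3 0 = 1" "r 0 = 0" "loc_abs_cont_on I \<psi>3" "continuous_on I H"
    if I: "zero_interval I" and nz: "\<forall>x\<in>I. C x \<noteq> 0" "\<forall>x\<in>I. \<psi>4 x \<noteq> 0" for I
  proof -
    have "open I" using I by (simp add: zero_interval_def)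
    note p = \<psi>4_sol[OF I nz(1)]
    have cont: "continuous_on I \<psi>4" "continuous_on I (D 1 \<psi>4)" "continuous_on I (D 2 \<psi>4)"
      using p(1,5,6) loc_abs_cont_on_imp_continuous_on[OF _ \<open>open I\<close>]
      by (simp_all add: ode_solution_on_def Let_def numeral_2_eq_2)
    have "loc_integrable_on I (\<lambda>x. (a2 x * \<psi>4 x + a1 x * (2 * D 1 \<psi>4 x) + (- 3 * D 2 \<psi>4 x)) * (exp (- P x) * (\<psi>4 x)\<^sup>2))"
      by (intro loc_integrable_on_mult loc_integrable_on_add a loc_integrable_on_continuous continuous_intros contP cont)
    also have "(\<lambda>x. (a2 x * \<psi>4 x + a1 x * (2 * D 1 \<psi>4 x) + (- 3 * D 2 \<psi>4 x)) * (exp (- P x) * (\<psi>4 x)\<^sup>2)) = G"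
      by (simp add: G_def fun_eq_iff algebra_simps)
    finally have G: "loc_integrable_on I G" .
    show H: "continuous_on I H"
      unfolding H_def[abs_def] using nz by (intro continuous_intros contP cont) auto
    note sys = trig_system_2[OF I G H, where c = "\<lambda>k. if k = 0 then 1 else 0"]
    show "(\<psi>3 has_vector_derivative H x * r x) (at x)" if "x \<in> I" for x
      using sys(1)[OF that] by (simp add: r_def \<psi>3_eq)
    show "loc_abs_cont_on I r"
      "AE x in lebesgue. x \<in> I \<longrightarrow> (r has_vector_derivative G x * \<psi>3 x) (at x)"
      "\<psi>3 0 = 1" "r 0 = 0"
      using sys(2-5) by (simp_all add: r_def \<psi>3_eq)
    show "loc_abs_cont_on I \<psi>3"
      unfolding \<psi>3_eq by (rule loc_abs_cont_on_trigT[OF I _ _ refl])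
        (use G H loc_integrable_on_continuous in auto)
  qed

  let ?F4 = "\<lambda>c x. c 0 * trigT [\<psi>1, \<psi>2, \<psi>3, \<psi>4] 4 x + c 1 * trigT [\<psi>4, \<psi>1, \<psi>2, \<psi>3] 1 x
    + c 2 * trigT [\<psi>3, \<psi>4, \<psi>1, \<psi>2] 2 x + c 3 * trigT [\<psi>2, \<psi>3, \<psi>4, \<psi>1] 3 x"
  have sol4: "general_solution_on I [a1, a2, a3, a4] ?F4"
    if I: "zero_interval I" and nz: "\<forall>x\<in>I. C x \<noteq> 0" "\<forall>x\<in>I. \<psi>4 x \<noteq> 0" "\<forall>x\<in>I. \<psi>3 x \<noteq> 0" for I
  proof (rule general_solution_onI[OF I])
    fix c :: "nat \<Rightarrow> complex"
    have "0 \<in> I" "open I" using I by (auto simp: zero_interval_def)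
    note p = \<psi>4_sol[OF I nz(1)] and r = \<psi>3_sys[OF I nz(1,2)]
    have cont: "continuous_on I \<psi>4" "continuous_on I \<psi>3"
      using p(6) r(6) loc_abs_cont_on_imp_continuous_on[OF _ \<open>open I\<close>] by blast+
    have \<psi>: "loc_integrable_on I \<psi>1" "continuous_on I \<psi>2"
      unfolding \<psi>1 \<psi>2 P_def[symmetric] using nz
      by (auto intro!: loc_integrable_on_mult a continuous_intros contP cont)
    note sys4 = trig_system_4[OF I \<psi> cont(2,1), where c = c]
    let ?Z = "\<lambda>x. c 0 * trigT [\<psi>1, \<psi>2, \<psi>3, \<psi>4] 3 x + c 1 * trigT [\<psi>4, \<psi>1, \<psi>2, \<psi>3] 4 x
      + c 2 * trigT [\<psi>3, \<psi>4, \<psi>1, \<psi>2] 1 x + c 3 * trigT [\<psi>2, \<psi>3, \<psi>4, \<psi>1] 2 x"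
    let ?W = "\<lambda>x. c 0 * trigT [\<psi>1, \<psi>2, \<psi>3, \<psi>4] 2 x + c 1 * trigT [\<psi>4, \<psi>1, \<psi>2, \<psi>3] 3 x
      + c 2 * trigT [\<psi>3, \<psi>4, \<psi>1, \<psi>2] 4 x + c 3 * trigT [\<psi>2, \<psi>3, \<psi>4, \<psi>1] 1 x"
    let ?V = "\<lambda>x. c 0 * trigT [\<psi>1, \<psi>2, \<psi>3, \<psi>4] 1 x + c 1 * trigT [\<psi>4, \<psi>1, \<psi>2, \<psi>3] 2 x
      + c 2 * trigT [\<psi>3, \<psi>4, \<psi>1, \<psi>2] 3 x + c 3 * trigT [\<psi>2, \<psi>3, \<psi>4, \<psi>1] 4 x"
    have H_eq: "H x = exp (P x) * (inverse (\<psi>4 x)) ^ 3" for x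
      by (simp add: H_def power_int_minus power_inverse)
    have \<psi>2_eq: "\<psi>2 x = exp (P x) * (inverse (\<psi>3 x))\<^sup>2 * (inverse (\<psi>4 x)) ^ 3" for x
      by (simp add: \<psi>2 P_def power_int_minus power_inverse)
    have \<psi>1_eq: "\<psi>1 x = a4 x * exp (- P x) * \<psi>3 x * (\<psi>4 x)\<^sup>2" for x
      by (simp add: \<psi>1 P_def)
    have r': "(\<psi>3 has_vector_derivative exp (P x) * (inverse (\<psi>4 x)) ^ 3 * r x) (at x)" if "x \<in> I" for x
      using r(1)[OF that] by (simp only: H_eq)
    have sys4_W: "(?W has_vector_derivative exp (P x) * (inverse (\<psi>3 x))\<^sup>2 * (inverse (\<psi>4 x)) ^ 3 * ?V x) (at x)"
      if "x \<in> I" for x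
      using sys4(3)[OF that] by (simp only: \<psi>2_eq[of x])
    have sys4_AE: "AE x in lebesgue. x \<in> I \<longrightarrow> (?V has_vector_derivative
        a4 x * exp (- P x) * \<psi>3 x * (\<psi>4 x)\<^sup>2 * ?F4 c x) (at x)"
      using sys4(7)
    proof eventually_elim
      case (elim x)
      then show ?case by (simp only: \<psi>1_eq[of x])
    qed
    note s = fourth_order_from_system[OF I a(1), folded P_def, where ?p = \<psi>4 and ?r = \<psi>3 and ?q = r
        and ?y = "?F4 c" and ?z = ?Z and ?w = ?W and ?v = ?V and ?a2.0 = a2 and ?a3.0 = a3 and ?a4.0 = a4,
        OF p(1) nz(2)[rule_format] r' r(2) r(3)[unfolded G_def] r(6) nz(3)[rule_format]
          sys4(1,2) sys4_W p(6,5) sys4(4-6) sys4_AE]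
    have fourth: "ode_solution_on I [a1, a2, a3, a4] (?F4 c)"
      "\<And>x. x \<in> I \<Longrightarrow> D 1 (?F4 c) x = \<psi>4 x * ?Z x"
      "\<And>x. x \<in> I \<Longrightarrow> D 2 (?F4 c) x = D 1 \<psi>4 x * ?Z x + \<psi>4 x * \<psi>3 x * ?W x"
      "\<And>x. x \<in> I \<Longrightarrow> D 3 (?F4 c) x = D 2 \<psi>4 x * ?Z x
        + (2 * D 1 \<psi>4 x * \<psi>3 x + exp (P x) * (inverse (\<psi>4 x))\<^sup>2 * r x) * ?W x
        + exp (P x) * inverse (\<psi>3 x) * (inverse (\<psi>4 x))\<^sup>2 * ?V x"
      by (rule s; assumption)+
    show "ode_solution_on I [a1, a2, a3, a4] (?F4 c)" by (rule fourth(1))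
    show "D k (?F4 c) 0 = c k" if "k < length [a1, a2, a3, a4]" for k
    proof -
      have "k = 0 \<or> k = 1 \<or> k = 2 \<or> k = 3" using that by auto
      then show ?thesis
        using sys4(8-11) fourth(2-4)[OF \<open>0 \<in> I\<close>] P0 p(2-4) r(4,5) by auto
    qed
  qed (use a in auto)

  \<comment> \<open>\<open>\<psi>4\<close> and \<open>\<psi>3\<close> are known to be continuous only on intervals where \<open>C\<close>, and for \<open>\<psi>3\<close>
    also \<open>\<psi>4\<close>, does not vanish, so the neighbourhood is shrunk three times.\<close>
  have nbhd: "\<exists>\<epsilon>>0. {-\<epsilon><..<\<epsilon>} \<subseteq> I \<and> (\<forall>x\<in>{-\<epsilon><..<\<epsilon>}. f x \<noteq> 0)"
    if I: "zero_interval I" and f: "loc_abs_cont_on I f" "f 0 \<noteq> 0" for I and f :: "real \<Rightarrow> complex"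
  proof -
    have "0 \<in> I" "open I" using I by (auto simp: zero_interval_def)
    have "open {x \<in> I. f x \<noteq> 0}"
      using continuous_open_preimage[OF loc_abs_cont_on_imp_continuous_on[OF f(1) \<open>open I\<close>] \<open>open I\<close>, of "- {0}"]
      by (simp add: vimage_def Int_def open_Compl)
    moreover have "0 \<in> {x \<in> I. f x \<noteq> 0}" using \<open>0 \<in> I\<close> f by simp
    ultimately obtain e where "e > 0" "ball 0 e \<subseteq> {x \<in> I. f x \<noteq> 0}"
      using open_contains_ball by blast
    then show ?thesis by (intro exI[of _ e]) (auto simp: ball_eq_greaterThanLessThan)
  qed
  have sym_interval: "zero_interval {-\<epsilon><..<\<epsilon>}" if "\<epsilon> > 0" for \<epsilon> :: real
    using that by (simp add: zero_interval_def is_interval_oo)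
  obtain \<epsilon>1 where \<epsilon>1: "\<epsilon>1 > 0" "\<forall>x\<in>{-\<epsilon>1<..<\<epsilon>1}. C x \<noteq> 0"
    using nbhd[OF U C_ac] C_sys(4) by auto
  note \<psi>4_\<epsilon>1 = \<psi>4_sol[OF sym_interval[OF \<epsilon>1(1)] \<epsilon>1(2)]
  have "\<psi>4 0 \<noteq> 0" using \<psi>4_\<epsilon>1(2) by simp
  then obtain \<epsilon>2 where \<epsilon>2: "\<epsilon>2 > 0" "{-\<epsilon>2<..<\<epsilon>2} \<subseteq> {-\<epsilon>1<..<\<epsilon>1}" "\<forall>x\<in>{-\<epsilon>2<..<\<epsilon>2}. \<psi>4 x \<noteq> 0"
    using nbhd[OF sym_interval[OF \<epsilon>1(1)] \<psi>4_\<epsilon>1(6)] by blast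
  have C_\<epsilon>2: "\<forall>x\<in>{-\<epsilon>2<..<\<epsilon>2}. C x \<noteq> 0" using \<epsilon>1(2) \<epsilon>2(2) by blast
  note \<psi>3_\<epsilon>2 = \<psi>3_sys[OF sym_interval[OF \<epsilon>2(1)] C_\<epsilon>2 \<epsilon>2(3)]
  have "\<psi>3 0 \<noteq> 0" using \<psi>3_\<epsilon>2(4) by simp
  then obtain \<epsilon>3 where \<epsilon>3: "\<epsilon>3 > 0" "{-\<epsilon>3<..<\<epsilon>3} \<subseteq> {-\<epsilon>2<..<\<epsilon>2}" "\<forall>x\<in>{-\<epsilon>3<..<\<epsilon>3}. \<psi>3 x \<noteq> 0"
    using nbhd[OF sym_interval[OF \<epsilon>2(1)] \<psi>3_\<epsilon>2(6)] by blast
  show ?thesis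
  proof (intro conjI allI impI)
    show "\<exists>\<epsilon>>0. \<forall>x\<in>{-\<epsilon><..<\<epsilon>}. C x \<noteq> 0" using \<epsilon>1 by blast
    show "\<exists>\<epsilon>>0. \<forall>x\<in>{-\<epsilon><..<\<epsilon>}. C x \<noteq> 0 \<and> \<psi>4 x \<noteq> 0 \<and> \<psi>3 x \<noteq> 0"
    proof (intro exI[of _ \<epsilon>3] conjI ballI)
      fix x assume "x \<in> {-\<epsilon>3<..<\<epsilon>3}"
      then show "C x \<noteq> 0" "\<psi>4 x \<noteq> 0" "\<psi>3 x \<noteq> 0" using C_\<epsilon>2 \<epsilon>2(3) \<epsilon>3(2,3) by blast+
    qed (rule \<epsilon>3)
    show "general_solution_on UNIV [a1, a2] (\<lambda>c x. c 0 * C x + c 1 * S x)" by (rule sol2)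
    show "general_solution_on I [a1, a2, a3] ?F3"
      if "open I \<and> is_interval I \<and> 0 \<in> I \<and> (\<forall>x\<in>I. C x \<noteq> 0)" for I
      using that by (intro sol3) (auto simp: zero_interval_def)
    show "general_solution_on I [a1, a2, a3, a4] ?F4"
      if "open I \<and> is_interval I \<and> 0 \<in> I \<and> (\<forall>x\<in>I. C x \<noteq> 0 \<and> \<psi>4 x \<noteq> 0 \<and> \<psi>3 x \<noteq> 0)" for I
      using that by (intro sol4) (auto simp: zero_interval_def)
  qed
qed

end
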